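(* Let $d\geq 1$ be an integer and let $p,q\geq 1$ satisfy $$1<q\leq 1+\frac{2}{d}\qquad\text{and}\qquad \frac{2}{p}+\frac{d}{q}=d.$$ There is a constant $C_{d,q}$, depending only on $d$ and $q$, such that for every (finite or infinite) orthonormal system $(u_j)$ in $L^2(\mathbb{R}^d)$ and every sequence of coefficients $(n_j)\subset\mathbb{C}$, $$\int_{\mathbb{R}}\left(\int_{\mathbb{R}^d}\Big|\sum_j n_j\,\big|(e^{it\Delta}u_j)(x)\big|^2\Big|^q\,dx\right)^{p/q}dt\;\leq\; C_{d,q}^p\left(\sum_j |n_j|^{\frac{2q}{q+1}}\right)^{\frac{p(q+1)}{2q}}.$$ Equivalently, for $\gamma=\sum_j n_j|u_j\rangle\langle u_j|$ and $\gamma(t)=e^{it\Delta}\gamma e^{-it\Delta}$, $$\|\rho_{\gamma(t)}\|_{L^p_t(\mathbb{R},L^q_x(\mathbb{R}^d))}\leq C_{d,q}\,\|\gamma\|_{\mathfrak{S}^{\frac{2q}{q+1}}}.$$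
   Context: $e^{it\Delta}$ denotes the unitary free Schrödinger group on $L^2(\mathbb{R}^d)$: $e^{it\Delta}u$ is the solution of $i\partial_t u=-\Delta u$ with initial datum $u$ at time $0$. $|u\rangle\langle v|$ denotes the rank-one operator $f\mapsto\langle v,f\rangle u$. For an operator of the form $\gamma=\sum_j n_j|u_j\rangle\langle u_j|$ with $(u_j)$ orthonormal, its density is $\rho_\gamma(x)=\sum_j n_j|u_j(x)|^2$, and $\rho_{\gamma(t)}(x)=\sum_j n_j|(e^{it\Delta}u_j)(x)|^2$. The Schatten norm is $\|\gamma\|_{\mathfrak{S}^r}=(\sum_j |n_j|^r)^{1/r}$ for such $\gamma$ (in general, the $\ell^r$ norm of the singular values). *)

theory Defs
  imports "HOL-Analysis.Analysis"
begin

definition L2 :: "('a::euclidean_space \<Rightarrow> complex) \<Rightarrow> bool" where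
  "L2 f \<longleftrightarrow> f \<in> borel_measurable lborel \<and> integrable lborel (\<lambda>x. (norm (f x))^2)"

definition L2_inner :: "('a::euclidean_space \<Rightarrow> complex) \<Rightarrow> ('a \<Rightarrow> complex) \<Rightarrow> complex" where
  "L2_inner f g = integral\<^sup>L lborel (\<lambda>x. cnj (f x) * g x)"

definition orthonormal_system :: "nat set \<Rightarrow> (nat \<Rightarrow> 'a::euclidean_space \<Rightarrow> complex) \<Rightarrow> bool" where
  "orthonormal_system J u \<longleftrightarrow> (\<forall>j\<in>J. L2 (u j)) \<and>
     (\<forall>j\<in>J. \<forall>k\<in>J. L2_inner (u j) (u k) = (if j = k then 1 else 0))"

text \<open>Free Schroedinger propagator on L1 functions via its integral kernel, t \<noteq> 0:
  (e^{it\<Delta>} f)(x) = (4 pi i t)^{-d/2} \<integral> exp(i |x-y|^2/(4t)) f(y) dy.\<close>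
definition schr_kernel :: "real \<Rightarrow> ('a::euclidean_space \<Rightarrow> complex) \<Rightarrow> 'a \<Rightarrow> complex" where
  "schr_kernel t f x =
     (complex_of_real (4 * pi * t) * \<i>) powr (- (of_nat DIM('a)) / 2) *
     integral\<^sup>L lborel (\<lambda>y. exp (\<i> * complex_of_real ((norm (x - y))^2 / (4 * t))) * f y)"

text \<open>The unitary group e^{it\<Delta>} on L2: the L2-limit of the kernel applied to the
  truncations f * 1_{B(0,R)} (a representative chosen by Hilbert choice; it is unique a.e.).\<close>
definition schr :: "real \<Rightarrow> ('a::euclidean_space \<Rightarrow> complex) \<Rightarrow> 'a \<Rightarrow> complex" where
  "schr t f = (if t = 0 then f else
     (SOME v. L2 v \<and>
        ((\<lambda>R::nat. \<integral>\<^sup>+ x. ennreal ((norm (schr_kernel t (\<lambda>y. indicator (ball 0 (real R)) y * f y) x - v x))^2) \<partial>lborel)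
          \<longlonglongrightarrow> 0)))"

text \<open>Density of gamma(t) = sum_j n_j |e^{it\<Delta>}u_j><e^{it\<Delta>}u_j|.\<close>
definition density :: "nat set \<Rightarrow> (nat \<Rightarrow> complex) \<Rightarrow> (nat \<Rightarrow> 'a::euclidean_space \<Rightarrow> complex) \<Rightarrow> real \<Rightarrow> 'a \<Rightarrow> complex" where
  "density J n u t x = (\<Sum>\<^sub>\<infinity>j\<in>J. n j * complex_of_real ((norm (schr t (u j) x))^2))"

text \<open>Real power on [0,\<infinity>], with \<infinity> powr r = \<infinity> (used for r > 0).\<close>
definition enn_powr :: "ennreal \<Rightarrow> real \<Rightarrow> ennreal" where
  "enn_powr a r = (if a = \<infinity> then \<infinity> else ennreal (enn2real a powr r))"

end

(*
  The map n |-> rho is linear and positive, so Hoelder's inequality interpolates between the trivial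
  bound from l^1 to L^oo_t L^1_x and the endpoint p = q = 1 + 2/d; it remains to prove the endpoint for
  finite systems of bounded support satisfying Bessel's inequality, and to let the truncation go to
  infinity with Fatou's lemma.

  By duality the endpoint says that sum_j <u_j, A u_j>^(d+2) <= C (int W^(d+2))^2 for A = T* T,
  T u = W e^(it Delta) u. Split the kernel W(t,x) k W(t',x') of T T*, where |k| <= |t-t'|^(-d/2) and k is a
  contraction in x for fixed t, t', according to whether W(t,x) W(t',x') is below or above l K(t,t'). The
  first part has operator norm O(l), by Cwikel's dyadic argument in x and by Schur's test in t. The second
  part is Hilbert-Schmidt and bounds the sum of ||A u_j||^2 over the indices with ||A u_j|| > l/c. Integrating
  in l, the singularity |t-t'|^(-d) cancels against the d-th power of K(t,t') ~ 1/|t-t'|, up to the small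
  damping of K that makes Schur's test work and that is adapted to the function t |-> int W(t,x)^(d+2) dx.
*)
theory Submission
  imports Defs "HOL-Probability.Probability"
begin

section \<open>Oscillatory and Gaussian integrals\<close>

text \<open>The exponents fit as follows. W^2 tests the density in the dual of L^q, so W lies in
  L^(d+2), and the dual of the coefficient exponent (d+2)/(d+1) is again d+2. In the layer integral
  two powers of W come from the Hilbert-Schmidt norm and d from the measure d l^(d-1) dl, at each of
  the two space-time points: exactly d+2. The obstacle is K. With K = 1/|t-t'| nothing is lost in
  the cancellation, but the row integrals diverge logarithmically, at the diagonal and at infinity.
  A translation-invariant kernel with the right scaling is a multiple of this one, so a time scale
  must come from W; the scale taken is 1/H(t), with H a time density of mass at most one. Every loss
  must then be controlled by the integral of H alone. No spectral theory of A enters: all entries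
  <u_i, A u_j> are kept in one quadratic sum, half of which is absorbed against the bounded part
  and, once more, against the Hilbert-Schmidt part. Truncation to bounded sets and cubes only
  secures absolute convergence; the constants depend on d alone.\<close>

lemma fresnel_tail:
  fixes a b :: real
  assumes "1 \<le> a" "a \<le> b"
  shows "norm (LBINT y. indicator {a..b} y *\<^sub>R cis (y\<^sup>2)) \<le> 2"
proof -
  \<comment> \<open>Integration by parts: \<open>?F\<close> is a primitive of the phase up to the
    remainder \<open>?r\<close>, which is absolutely integrable at infinity. The two boundary terms
    and the remainder are at most 1/2 each.\<close>
  let ?F = "\<lambda>y::real. exp (\<i> * (of_real y)\<^sup>2) / (2 * \<i> * of_real y)"
  let ?r = "\<lambda>y::real. exp (\<i> * (of_real y)\<^sup>2) / (2 * \<i> * (of_real y)\<^sup>2)"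
  have nz: "complex_of_real y \<noteq> 0" if "a \<le> y" for y using that assms by auto
  have cis_eq: "cis (y\<^sup>2) = exp (\<i> * (of_real y)\<^sup>2)" for y by (simp add: cis_conv_exp)
  have cont1: "continuous_on {a..b} (\<lambda>y::real. exp (\<i> * (of_real y)\<^sup>2) - ?r y)"
    using nz by (intro continuous_intros) auto
  have cont2: "continuous_on {a..b} ?r"
    using nz by (intro continuous_intros) auto
  have d: "(?F has_vector_derivative (exp (\<i> * (of_real y)\<^sup>2) - ?r y)) (at y within {a..b})"
    if "a \<le> y" for y
  proof -
    have "((\<lambda>z. exp (\<i> * z\<^sup>2) / (2 * \<i> * z)) has_field_derivative
        (exp (\<i> * (of_real y)\<^sup>2) - ?r y)) (at (of_real y))"
      using nz[OF that] by (auto intro!: derivative_eq_intros simp: field_simps power2_eq_square)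
    then show ?thesis by (rule has_vector_derivative_real_field)
  qed
  have I1: "has_bochner_integral lborel
      (\<lambda>y. indicator {a..b} y *\<^sub>R (exp (\<i> * (of_real y)\<^sup>2) - ?r y)) (?F b - ?F a)"
    by (rule has_bochner_integral_FTC_Icc[OF assms(2) _ cont1]) (use d in auto)
  have d2: "((\<lambda>y::real. - 1 / (2*y)) has_real_derivative (1 / (2 * y\<^sup>2))) (at y)" if "a \<le> y" for y
    using that assms by (auto intro!: derivative_eq_intros simp: field_simps power2_eq_square)
  have I2: "has_bochner_integral lborel
      (\<lambda>y. (1 / (2 * y\<^sup>2)) * indicator {a..b} y) (- 1 / (2*b) - (- 1 / (2*a)))"
    by (rule has_bochner_integral_FTC_Icc_nonneg[OF _ _ _ assms(2)]) (use d2 in auto)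
  have i3: "integrable lborel (\<lambda>y. indicator {a..b} y *\<^sub>R ?r y)"
    using borel_integrable_compact[OF compact_Icc cont2] by (simp add: indicator_def if_distrib cong: if_cong)
  have "norm (LBINT y. indicator {a..b} y *\<^sub>R ?r y) \<le> (LBINT y. (1 / (2 * y\<^sup>2)) * indicator {a..b} y)"
    by (rule Bochner_Integration.integral_norm_bound_integral[OF i3])
      (use I2 in \<open>auto simp: has_bochner_integral_iff norm_mult norm_divide norm_power indicator_def\<close>)
  also have "\<dots> \<le> 1/2"
  proof -
    have "(LBINT y. (1 / (2 * y\<^sup>2)) * indicator {a..b} y) = 1 / (2*a) - 1 / (2*b)"
      using I2 by (simp add: has_bochner_integral_iff)
    also have "\<dots> \<le> 1 / (2 * a)" using assms by simp
    also have "\<dots> \<le> 1/2" using assms by (simp add: field_simps)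
    finally show ?thesis .
  qed
  finally have r: "norm (LBINT y. indicator {a..b} y *\<^sub>R ?r y) \<le> 1/2" .
  have "(LBINT y. indicator {a..b} y *\<^sub>R cis (y\<^sup>2)) =
      (LBINT y. indicator {a..b} y *\<^sub>R (exp (\<i> * (of_real y)\<^sup>2) - ?r y) + indicator {a..b} y *\<^sub>R ?r y)"
    by (intro Bochner_Integration.integral_cong refl) (auto simp: cis_eq indicator_def)
  also have "\<dots> = (?F b - ?F a) + (LBINT y. indicator {a..b} y *\<^sub>R ?r y)"
    using I1 i3 by (subst Bochner_Integration.integral_add) (auto simp: has_bochner_integral_iff)
  finally have eq: "(LBINT y. indicator {a..b} y *\<^sub>R cis (y\<^sup>2)) = (?F b - ?F a) + (LBINT y. indicator {a..b} y *\<^sub>R ?r y)" .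
  have nF: "norm (?F y) \<le> 1/2" if "1 \<le> y" for y
    using that by (auto simp: norm_divide norm_mult field_simps norm_exp_eq_Re power2_eq_square)
  have "norm (?F b - ?F a) \<le> 1/2 + 1/2"
    using nF[of a] nF[of b] assms by (intro order_trans[OF norm_triangle_ineq4] add_mono) auto
  with r show ?thesis unfolding eq
    by (intro order_trans[OF norm_triangle_ineq]) linarith
qed

lemma integrable_indicator_cis:
  fixes f :: "'a::euclidean_space \<Rightarrow> real"
  assumes [measurable]: "f \<in> borel_measurable borel" "A \<in> sets borel" and "emeasure lborel A < \<infinity>"
  shows "integrable lborel (\<lambda>y. indicator A y *\<^sub>R cis (f y))"
proof (rule Bochner_Integration.integrable_bound)
  show "integrable lborel (indicator A :: 'a \<Rightarrow> real)" using assms(3) by simp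
  show "(\<lambda>y. indicator A y *\<^sub>R cis (f y)) \<in> borel_measurable lborel"
    unfolding cis_conv_exp by measurable
qed (auto simp: indicator_def)

text \<open>The line is cut at -1 and 1. Both tails are bounded by 2, the left one after reflection,
  and the middle piece by its length 2. What matters is uniformity in the interval.\<close>

lemma fresnel_bound:
  fixes a b :: real
  shows "norm (LBINT y. indicator {a..b} y *\<^sub>R cis (y\<^sup>2)) \<le> 6"
proof -
  have nn: "norm (LBINT y. indicator {a'..b'} y *\<^sub>R cis (y\<^sup>2)) \<le> 2" if "1 \<le> a'" for a' b' :: real
    using fresnel_tail[OF that, of b'] by (cases "a' \<le> b'") auto
  have fin: "emeasure lborel {a'..b'} < \<infinity>" for a' b' :: real
    by (cases "a' \<le> b'") auto
  have int: "integrable lborel (\<lambda>y. indicator {a'..b'} y *\<^sub>R cis (y\<^sup>2))" for a' b' :: real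
    by (rule integrable_indicator_cis[OF _ _ fin]) auto
  have int2: "integrable lborel (\<lambda>y. indicator ({a..b} \<inter> {-1<..<1}) y *\<^sub>R cis (y\<^sup>2))"
    by (rule integrable_indicator_cis)
      (auto intro!: le_less_trans[OF emeasure_mono[of _ "{a..b}"] fin, simplified])
  have neg: "norm (LBINT y. indicator {a'..b'} y *\<^sub>R cis (y\<^sup>2)) \<le> 2" if "b' \<le> -1" for a' b' :: real
  proof -
    have "(LBINT y. indicator {a'..b'} y *\<^sub>R cis (y\<^sup>2)) = (LBINT y. indicator {-b'..-a'} y *\<^sub>R cis (y\<^sup>2))"
      by (subst lborel_integral_real_affine[of "-1" _ 0])
        (auto intro!: Bochner_Integration.integral_cong simp: indicator_def)
    with nn[of "-b'" "-a'"] that show ?thesis by simp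
  qed
  have mid: "norm (LBINT y. indicator ({a..b} \<inter> {-1<..<1}) y *\<^sub>R cis (y\<^sup>2)) \<le> 2"
  proof -
    have "norm (LBINT y. indicator ({a..b} \<inter> {-1<..<1}) y *\<^sub>R cis (y\<^sup>2)) \<le> (LBINT y. indicator {-1..1::real} y)"
      by (rule Bochner_Integration.integral_norm_bound_integral[OF int2])
         (auto simp: emeasure_lborel_Icc_eq split: split_indicator)
    then show ?thesis by simp
  qed
  have "(LBINT y. indicator {a..b} y *\<^sub>R cis (y\<^sup>2)) =
     (LBINT y. indicator {a..min b (-1)} y *\<^sub>R cis (y\<^sup>2) +
      (indicator ({a..b} \<inter> {-1<..<1}) y *\<^sub>R cis (y\<^sup>2) + indicator {max a 1..b} y *\<^sub>R cis (y\<^sup>2)))"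
    by (intro Bochner_Integration.integral_cong refl) (auto simp: indicator_def)
  also have "\<dots> = (LBINT y. indicator {a..min b (-1)} y *\<^sub>R cis (y\<^sup>2)) +
      ((LBINT y. indicator ({a..b} \<inter> {-1<..<1}) y *\<^sub>R cis (y\<^sup>2)) + (LBINT y. indicator {max a 1..b} y *\<^sub>R cis (y\<^sup>2)))"
    using int int2 by (subst Bochner_Integration.integral_add; simp)+
  finally show ?thesis
    using mid nn[of "max a 1" b] neg[of "min b (-1)" a]
      norm_triangle_ineq[of "(LBINT y. indicator {a..min b (-1)} y *\<^sub>R cis (y\<^sup>2))"
        "(LBINT y. indicator ({a..b} \<inter> {-1<..<1}) y *\<^sub>R cis (y\<^sup>2)) + (LBINT y. indicator {max a 1..b} y *\<^sub>R cis (y\<^sup>2))"]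
      norm_triangle_ineq[of "(LBINT y. indicator ({a..b} \<inter> {-1<..<1}) y *\<^sub>R cis (y\<^sup>2))"
        "(LBINT y. indicator {max a 1..b} y *\<^sub>R cis (y\<^sup>2))"]
    by simp
qed

text \<open>Completing the square: the substitution centred at
  \<open>\<eta> / (2 * \<sigma>)\<close> with scale \<open>1 / sqrt \<sigma>\<close> leaves the pure
  phase times a constant of modulus one. The linear term costs nothing, the interval merely
  moves.\<close>

lemma fresnel_quadratic_pos:
  fixes a b \<sigma> \<eta> :: real
  assumes "\<sigma> > 0"
  shows "norm (LBINT y. indicator {a..b} y *\<^sub>R cis (\<sigma> * y\<^sup>2 - \<eta> * y)) \<le> 6 / sqrt \<sigma>"
proof -
  let ?c = "\<eta> / (2 * \<sigma>)"
  have s: "sqrt \<sigma> > 0" "sqrt \<sigma> * sqrt \<sigma> = \<sigma>" using assms by auto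
  have ph: "\<sigma> * (?c + 1 / sqrt \<sigma> * y)\<^sup>2 - \<eta> * (?c + 1 / sqrt \<sigma> * y) = y\<^sup>2 - \<eta>\<^sup>2 / (4*\<sigma>)" for y
  proof -
    define c where "c = ?c"
    define x where "x = 1 / sqrt \<sigma> * y"
    have x: "\<sigma> * x\<^sup>2 = y\<^sup>2" using assms by (simp add: x_def power_divide)
    have c: "\<eta> = 2 * \<sigma> * c" using assms by (simp add: c_def)
    have e: "\<sigma> * c\<^sup>2 = \<eta>\<^sup>2 / (4*\<sigma>)" using assms by (simp add: c power2_eq_square)
    have "\<sigma> * (c + x)\<^sup>2 - \<eta> * (c + x) = \<sigma> * x\<^sup>2 - \<sigma> * c\<^sup>2"
      unfolding c by (simp add: power2_eq_square algebra_simps)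
    then show ?thesis unfolding x e unfolding c_def x_def .
  qed
  have ind: "indicator {a..b} (?c + 1 / sqrt \<sigma> * y) = (indicator {(a - ?c) * sqrt \<sigma> .. (b - ?c) * sqrt \<sigma>} y :: real)" for y
    using s(1) assms by (auto simp: indicator_def field_simps)
  have "(LBINT y. indicator {a..b} y *\<^sub>R cis (\<sigma> * y\<^sup>2 - \<eta> * y)) =
     (1 / sqrt \<sigma>) *\<^sub>R (LBINT y. indicator {(a - ?c) * sqrt \<sigma> .. (b - ?c) * sqrt \<sigma>} y *\<^sub>R cis (y\<^sup>2 - \<eta>\<^sup>2 / (4*\<sigma>)))"
    using s by (subst lborel_integral_real_affine[of "1 / sqrt \<sigma>" _ ?c]) (simp_all only: ph ind, auto)
  also have "(LBINT y. indicator {(a - ?c) * sqrt \<sigma> .. (b - ?c) * sqrt \<sigma>} y *\<^sub>R cis (y\<^sup>2 - \<eta>\<^sup>2 / (4*\<sigma>))) =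
     (LBINT y. (indicator {(a - ?c) * sqrt \<sigma> .. (b - ?c) * sqrt \<sigma>} y *\<^sub>R cis (y\<^sup>2)) * cis (- \<eta>\<^sup>2 / (4*\<sigma>)))"
    by (intro Bochner_Integration.integral_cong refl) (simp add: cis_mult)
  also have "\<dots> = (LBINT y. (indicator {(a - ?c) * sqrt \<sigma> .. (b - ?c) * sqrt \<sigma>} y *\<^sub>R cis (y\<^sup>2))) * cis (- \<eta>\<^sup>2 / (4*\<sigma>))"
    by (rule Bochner_Integration.integral_mult_left_zero)
  finally show ?thesis
    using fresnel_bound[of "(a - ?c) * sqrt \<sigma>" "(b - ?c) * sqrt \<sigma>"] s
    by (simp add: norm_mult divide_right_mono)
qed

lemma fresnel_quadratic:
  fixes a b \<sigma> \<eta> :: real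
  assumes "\<sigma> \<noteq> 0"
  shows "norm (LBINT y. indicator {a..b} y *\<^sub>R cis (\<sigma> * y\<^sup>2 - \<eta> * y)) \<le> 6 / sqrt \<bar>\<sigma>\<bar>"
proof (cases "\<sigma> > 0")
  case True then show ?thesis using fresnel_quadratic_pos[of \<sigma> a b \<eta>] by simp
next
  case False
  have "norm (LBINT y. indicator {a..b} y *\<^sub>R cis (\<sigma> * y\<^sup>2 - \<eta> * y)) =
      norm (cnj (LBINT y. indicator {a..b} y *\<^sub>R cis (\<sigma> * y\<^sup>2 - \<eta> * y)))" by simp
  also have "cnj (LBINT y. indicator {a..b} y *\<^sub>R cis (\<sigma> * y\<^sup>2 - \<eta> * y)) =
      (LBINT y. indicator {a..b} y *\<^sub>R cis ((-\<sigma>) * y\<^sup>2 - (-\<eta>) * y))"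
    by (subst Bochner_Integration.integral_cnj[symmetric]) (auto intro!: Bochner_Integration.integral_cong simp: cis_cnj algebra_simps)
  finally show ?thesis using fresnel_quadratic_pos[of "-\<sigma>" a b "-\<eta>"] False assms by simp
qed

lemma integral_lborel_prod:
  fixes f :: "'a::euclidean_space \<Rightarrow> real \<Rightarrow> complex"
  assumes "\<And>b. b \<in> Basis \<Longrightarrow> integrable lborel (f b)"
  shows "(LINT x|lborel. (\<Prod>b\<in>Basis. f b (x \<bullet> b))) = (\<Prod>b\<in>(Basis::'a set). LBINT x. f b x)"
proof -
  have m: "(\<lambda>x::'a. \<Prod>b\<in>Basis. f b (x \<bullet> b)) \<in> borel_measurable borel"
  proof (rule borel_measurable_prod)
    fix b :: 'a assume b: "b \<in> Basis"
    have [measurable]: "f b \<in> borel_measurable borel" using assms[OF b] by (auto dest: borel_measurable_integrable)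
    show "(\<lambda>x. f b (x \<bullet> b)) \<in> borel_measurable borel" by measurable
  qed
  interpret product_sigma_finite "\<lambda>b::'a. lborel :: real measure" by standard
  have "(LINT x|lborel. (\<Prod>b\<in>(Basis::'a set). f b (x \<bullet> b))) =
      (LINT x|Pi\<^sub>M (Basis::'a set) (\<lambda>b. lborel). (\<Prod>b\<in>(Basis::'a set). f b ((\<Sum>c\<in>Basis. x c *\<^sub>R c) \<bullet> b)))"
    by (subst lborel_eq, subst integral_distr) (use m in auto)
  also have "\<dots> = (LINT x|Pi\<^sub>M (Basis::'a set) (\<lambda>b. lborel). (\<Prod>b\<in>(Basis::'a set). f b (x b)))"
    by (intro Bochner_Integration.integral_cong refl prod.cong)
      (auto simp: inner_sum_left inner_Basis if_distrib cong: if_cong)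
  also have "\<dots> = (\<Prod>b\<in>(Basis::'a set). LBINT x. f b x)"
    by (rule product_integral_prod) (use assms in auto)
  finally show ?thesis .
qed

lemma cis_sum: "cis (\<Sum>b\<in>A. f b) = (\<Prod>b\<in>A. cis (f b))" if "finite A"
  using that by (induction A rule: finite_induct) (auto simp: cis_mult[symmetric])

lemma indicator_cbox_prod:
  fixes y :: "'a::euclidean_space"
  shows "indicator (cbox u v) y = (\<Prod>b\<in>Basis. indicator {u \<bullet> b..v \<bullet> b} (y \<bullet> b) :: real)"
proof (cases "y \<in> cbox u v")
  case True then show ?thesis by (auto simp: indicator_def mem_box)
next
  case False
  then obtain b where "b \<in> Basis" "\<not> (u \<bullet> b \<le> y \<bullet> b \<and> y \<bullet> b \<le> v \<bullet> b)" by (auto simp: mem_box)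
  then show ?thesis using False by (auto intro!: prod_zero[symmetric] bexI[of _ b] simp: indicator_def)
qed

text \<open>A cube, unlike a ball, has an indicator that factors over the coordinates, and so does
  the quadratic phase; each factor is a one-dimensional Fresnel integral. The bound sees neither the
  cube nor the frequency \<open>\<eta>\<close>, which makes the sharp cutoff harmless later.\<close>

lemma oscillatory_cube_bound:
  fixes \<eta> u v :: "'a::euclidean_space" and \<sigma> :: real
  assumes "\<sigma> \<noteq> 0"
  shows "norm (LINT y|lborel. indicator (cbox u v) y *\<^sub>R cis (\<sigma> * (norm y)\<^sup>2 - y \<bullet> \<eta>)) \<le> (6 / sqrt \<bar>\<sigma>\<bar>) ^ DIM('a)"
proof -
  let ?f = "\<lambda>b t. indicator {u \<bullet> b..v \<bullet> b} t *\<^sub>R cis (\<sigma> * t\<^sup>2 - (\<eta> \<bullet> b) * t)"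
  have "indicator (cbox u v) y *\<^sub>R cis (\<sigma> * (norm y)\<^sup>2 - y \<bullet> \<eta>) = (\<Prod>b\<in>Basis. ?f b (y \<bullet> b))" for y
  proof -
    have "\<sigma> * (norm y)\<^sup>2 - y \<bullet> \<eta> = (\<Sum>b\<in>Basis. \<sigma> * (y \<bullet> b)\<^sup>2 - (\<eta> \<bullet> b) * (y \<bullet> b))"
      unfolding power2_norm_eq_inner euclidean_inner[of y y] euclidean_inner[of y \<eta>]
      by (simp add: sum_subtractf sum_distrib_left power2_eq_square mult.commute)
    then show ?thesis
      by (simp add: cis_sum indicator_cbox_prod scaleR_conv_of_real prod.distrib)
  qed
  then have "(LINT y|lborel. indicator (cbox u v) y *\<^sub>R cis (\<sigma> * (norm y)\<^sup>2 - y \<bullet> \<eta>)) = (\<Prod>b\<in>Basis. LBINT t. ?f b t)"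
    by (simp only:) (rule integral_lborel_prod, rule integrable_indicator_cis, auto simp: emeasure_lborel_Icc_eq)
  then have "norm (LINT y|lborel. indicator (cbox u v) y *\<^sub>R cis (\<sigma> * (norm y)\<^sup>2 - y \<bullet> \<eta>)) = (\<Prod>b\<in>Basis. norm (LBINT t. ?f b t))"
    by (simp only: prod_norm)
  also have "\<dots> \<le> (\<Prod>b\<in>(Basis::'a set). 6 / sqrt \<bar>\<sigma>\<bar>)"
    by (intro prod_mono conjI fresnel_quadratic assms) auto
  finally show ?thesis by simp
qed

section \<open>Fourier transforms of Gaussians\<close>

lemma gaussian_fourier_real:
  fixes n \<theta> :: real
  assumes "n > 0"
  shows "integrable lborel (\<lambda>y. exp (- y\<^sup>2 / (2 * n\<^sup>2)) *\<^sub>R cis (\<theta> * y))" (is ?I)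
    and "(LBINT y. exp (- y\<^sup>2 / (2 * n\<^sup>2)) *\<^sub>R cis (\<theta> * y)) = of_real (n * sqrt (2 * pi) * exp (- (n * \<theta>)\<^sup>2 / 2))" (is ?E)
proof -
  have nd: "normal_density 0 n y = exp (- y\<^sup>2 / (2 * n\<^sup>2)) / (n * sqrt (2 * pi))" for y
    using assms by (simp add: normal_density_def real_sqrt_mult)
  have "integrable lborel (\<lambda>y. (n * sqrt (2*pi)) * normal_density 0 n y)"
    using integrable_normal_density[OF assms, of 0] by simp
  then have ie: "integrable lborel (\<lambda>y. exp (- y\<^sup>2 / (2 * n\<^sup>2)))"
    using assms by (simp add: nd)
  show ?I
    by (rule Bochner_Integration.integrable_bound[OF ie]) (auto simp: cis_conv_exp)
  have "char std_normal_distribution (n * \<theta>) = complex_of_real (exp (- (n * \<theta>)\<^sup>2 / 2))"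
    by (simp add: char_std_normal_distribution)
  then have st: "(LBINT y. std_normal_density y *\<^sub>R cis (n * \<theta> * y)) = complex_of_real (exp (- (n * \<theta>)\<^sup>2 / 2))"
    unfolding char_def by (subst (asm) integral_density) (auto simp: cis_conv_exp)
  have "(LBINT y. exp (- y\<^sup>2 / (2 * n\<^sup>2)) *\<^sub>R cis (\<theta> * y)) =
      n *\<^sub>R (LBINT y. exp (- (n * y)\<^sup>2 / (2 * n\<^sup>2)) *\<^sub>R cis (\<theta> * (n * y)))"
    using assms by (subst lborel_integral_real_affine[of n _ 0]) auto
  also have "(LBINT y. exp (- (n * y)\<^sup>2 / (2 * n\<^sup>2)) *\<^sub>R cis (\<theta> * (n * y))) =
      (LBINT y. sqrt (2*pi) *\<^sub>R (std_normal_density y *\<^sub>R cis (n * \<theta> * y)))"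
    using assms by (intro Bochner_Integration.integral_cong refl)
      (simp add: std_normal_density_def power_mult_distrib algebra_simps)
  also have "\<dots> = sqrt (2*pi) *\<^sub>R complex_of_real (exp (- (n * \<theta>)\<^sup>2 / 2))"
    by (subst integral_scaleR_right) (simp add: st)
  finally show ?E by (simp add: scaleR_conv_of_real)
qed

text \<open>Up to the factor \<open>2 * pi / \<bar>r\<bar>\<close> the integrand is the normal
  density of standard deviation \<open>1 / (n * \<bar>r\<bar>)\<close>; hence the value does not
  depend on \<open>n\<close>.\<close>

lemma nn_integral_gaussian_scaled:
  fixes n r :: real
  assumes "n > 0" "r \<noteq> 0"
  shows "(\<integral>\<^sup>+ \<eta>. ennreal (n * sqrt (2 * pi) * exp (- (n * (r * \<eta>))\<^sup>2 / 2)) \<partial>lborel) = ennreal (2 * pi / \<bar>r\<bar>)"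
proof -
  have nr: "n * \<bar>r\<bar> > 0" using assms by simp
  let ?s = "1 / (n * \<bar>r\<bar>)"
  have s: "?s > 0" using nr by simp
  have "n * sqrt (2 * pi) * exp (- (n * (r * \<eta>))\<^sup>2 / 2) = (2 * pi / \<bar>r\<bar>) * normal_density 0 ?s \<eta>" for \<eta>
  proof -
    have e: "- (n * (r * \<eta>))\<^sup>2 / 2 = - (\<eta> - 0)\<^sup>2 / (2 * ?s\<^sup>2)"
      using nr by (simp add: power_mult_distrib power_divide field_simps)
    have q: "sqrt (2 * pi * ?s\<^sup>2) = sqrt (2*pi) * ?s" using s by (simp only: real_sqrt_mult real_sqrt_abs)
    have p: "2 * pi = sqrt (2*pi) * sqrt (2*pi)" by simp
    have "n * sqrt (2 * pi) = (2 * pi / \<bar>r\<bar>) * (1 / (sqrt (2*pi) * ?s))"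
      using nr assms by (simp add: field_simps)
    then show ?thesis unfolding normal_density_def e q by simp
  qed
  then have "(\<integral>\<^sup>+ \<eta>. ennreal (n * sqrt (2 * pi) * exp (- (n * (r * \<eta>))\<^sup>2 / 2)) \<partial>lborel) =
      (\<integral>\<^sup>+ \<eta>. ennreal (2 * pi / \<bar>r\<bar>) * ennreal (normal_density 0 ?s \<eta>) \<partial>lborel)"
    using nr by (simp only: ennreal_mult[symmetric] normal_density_nonneg pi_ge_zero) (simp add: ennreal_mult[symmetric])
  also have "\<dots> = ennreal (2 * pi / \<bar>r\<bar>) * (\<integral>\<^sup>+ \<eta>. ennreal (normal_density 0 ?s \<eta>) \<partial>lborel)"
    by (rule nn_integral_cmult) auto
  also have "(\<integral>\<^sup>+ \<eta>. ennreal (normal_density 0 ?s \<eta>) \<partial>lborel) = ennreal 1"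
    using integral_normal_density[OF s, of 0] integrable_normal_density[OF s, of 0] s
    by (subst nn_integral_eq_integral) (auto simp del: nn_integral_eq_integral)
  finally show ?thesis by simp
qed

text \<open>Fourier transform at frequency \<open>r * \<eta>\<close> of the Gaussian of width
  \<open>n\<close>; for growing \<open>n\<close> an approximate identity up to a constant. Only its
  sign, its symmetry and its mass will enter.\<close>

definition gauss_ker :: "real \<Rightarrow> real \<Rightarrow> 'a::euclidean_space \<Rightarrow> real" where
  "gauss_ker n r \<eta> = (\<Prod>b\<in>Basis. n * sqrt (2 * pi) * exp (- (n * (r * (\<eta> \<bullet> b)))\<^sup>2 / 2))"

lemma gauss_ker_nonneg: "n > 0 \<Longrightarrow> 0 \<le> gauss_ker n r \<eta>"
  unfolding gauss_ker_def by (intro prod_nonneg) auto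

lemma measurable_gauss_ker[measurable]: "gauss_ker n r \<in> borel_measurable borel"
  unfolding gauss_ker_def by measurable

lemma gaussian_prod: "exp (- (norm y)\<^sup>2 / (2 * n\<^sup>2)) = (\<Prod>b\<in>Basis. exp (- (y \<bullet> b)\<^sup>2 / (2 * n\<^sup>2)))"
  for y :: "'a::euclidean_space"
  unfolding power2_norm_eq_inner euclidean_inner[of y y]
  by (simp add: exp_sum[symmetric] sum_negf sum_divide_distrib power2_eq_square)

lemma integrable_gaussian:
  assumes "n > 0"
  shows "integrable lborel (\<lambda>y::'a::euclidean_space. exp (- (norm y)\<^sup>2 / (2 * n\<^sup>2)))"
proof (rule integrableI_nonneg)
  have "(\<integral>\<^sup>+ y. ennreal (exp (- (norm (y::'a))\<^sup>2 / (2 * n\<^sup>2))) \<partial>lborel)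
     = (\<integral>\<^sup>+ y. (\<Prod>b\<in>Basis. ennreal (exp (- ((y::'a) \<bullet> b)\<^sup>2 / (2 * n\<^sup>2)))) \<partial>lborel)"
    by (simp only: gaussian_prod prod_ennreal exp_ge_zero)
  also have "\<dots> = (\<Prod>b\<in>(Basis::'a set). \<integral>\<^sup>+ t. ennreal (exp (- t\<^sup>2 / (2 * n\<^sup>2))) \<partial>lborel)"
    by (rule nn_integral_lborel_prod) auto
  also have "\<dots> < \<infinity>"
  proof -
    have "integrable lborel (\<lambda>t::real. norm (exp (- t\<^sup>2 / (2 * n\<^sup>2)) *\<^sub>R cis (0 * t)))"
      by (rule integrable_norm[OF gaussian_fourier_real(1)[OF assms, of 0]])
    then have "integrable lborel (\<lambda>t::real. exp (- t\<^sup>2 / (2 * n\<^sup>2)))" by simp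
    then have "(\<integral>\<^sup>+ t. ennreal (exp (- t\<^sup>2 / (2 * n\<^sup>2))) \<partial>lborel) < \<infinity>"
      by (subst nn_integral_eq_integral) auto
    then show ?thesis by (simp add: power_less_top_ennreal)
  qed
  finally show "(\<integral>\<^sup>+ y. ennreal (exp (- (norm (y::'a))\<^sup>2 / (2 * n\<^sup>2))) \<partial>lborel) < \<infinity>" .
qed auto

lemma gaussian_fourier:
  fixes \<eta> :: "'a::euclidean_space"
  assumes "n > 0"
  shows "(LINT y|lborel. exp (- (norm y)\<^sup>2 / (2 * n\<^sup>2)) *\<^sub>R cis (r * (y \<bullet> \<eta>))) = of_real (gauss_ker n r \<eta>)"
proof -
  have "exp (- (norm y)\<^sup>2 / (2 * n\<^sup>2)) *\<^sub>R cis (r * (y \<bullet> \<eta>)) =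
     (\<Prod>b\<in>Basis. exp (- (y \<bullet> b)\<^sup>2 / (2 * n\<^sup>2)) *\<^sub>R cis ((r * (\<eta> \<bullet> b)) * (y \<bullet> b)))" for y :: 'a
    unfolding gaussian_prod euclidean_inner[of y \<eta>]
    by (simp add: sum_distrib_left cis_sum scaleR_conv_of_real prod.distrib algebra_simps)
  then have "(LINT y|lborel. exp (- (norm y)\<^sup>2 / (2 * n\<^sup>2)) *\<^sub>R cis (r * (y \<bullet> \<eta>))) =
     (\<Prod>b\<in>(Basis::'a set). LBINT t. exp (- t\<^sup>2 / (2 * n\<^sup>2)) *\<^sub>R cis ((r * (\<eta> \<bullet> b)) * t))"
    by (simp only:) (rule integral_lborel_prod, rule gaussian_fourier_real(1)[OF assms])
  then show ?thesis
    by (simp only: gaussian_fourier_real(2)[OF assms] gauss_ker_def of_real_prod)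
qed

lemma nn_integral_gauss_ker:
  assumes "n > 0" "r \<noteq> 0"
  shows "(\<integral>\<^sup>+ \<eta>. ennreal (gauss_ker n r (\<eta>::'a::euclidean_space)) \<partial>lborel) = ennreal ((2 * pi / \<bar>r\<bar>) ^ DIM('a))"
proof -
  have "(\<integral>\<^sup>+ \<eta>. ennreal (gauss_ker n r (\<eta>::'a)) \<partial>lborel) =
    (\<integral>\<^sup>+ \<eta>. (\<Prod>b\<in>Basis. ennreal (n * sqrt (2 * pi) * exp (- (n * (r * ((\<eta>::'a) \<bullet> b)))\<^sup>2 / 2))) \<partial>lborel)"
    using assms(1) by (simp add: gauss_ker_def prod_ennreal)
  also have "\<dots> = (\<Prod>b\<in>(Basis::'a set). \<integral>\<^sup>+ t. ennreal (n * sqrt (2 * pi) * exp (- (n * (r * t))\<^sup>2 / 2)) \<partial>lborel)"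
    by (rule nn_integral_lborel_prod) auto
  finally show ?thesis
    unfolding nn_integral_gaussian_scaled[OF assms] by (simp add: ennreal_power)
qed

section \<open>Plancherel's inequality\<close>

abbreviation L2_mass :: "('a::euclidean_space \<Rightarrow> complex) \<Rightarrow> ennreal" where
  "L2_mass f \<equiv> (\<integral>\<^sup>+ x. ennreal ((norm (f x))\<^sup>2) \<partial>lborel)"

lemma integrable_lborel_pair_mult:
  fixes f :: "'a::euclidean_space \<Rightarrow> 'c::{real_normed_field,banach,second_countable_topology}"
    and g :: "'b::euclidean_space \<Rightarrow> 'c"
  assumes f: "integrable lborel f" and g: "integrable lborel g"
  shows "integrable (lborel \<Otimes>\<^sub>M lborel) (\<lambda>p. f (fst p) * g (snd p))"
proof (rule lborel_pair.Fubini_integrable)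
  have [measurable]: "f \<in> borel_measurable borel" "g \<in> borel_measurable borel"
    using f g by (auto dest: borel_measurable_integrable)
  show "(\<lambda>p. f (fst p) * g (snd p)) \<in> borel_measurable (lborel \<Otimes>\<^sub>M lborel)" by measurable
  show "integrable lborel (\<lambda>x. LBINT y. norm (f (fst (x, y)) * g (snd (x, y))))"
    using f by (simp add: norm_mult)
  show "AE x in lborel. integrable lborel (\<lambda>y. f (fst (x, y)) * g (snd (x, y)))"
    using g by simp
qed

lemma nn_integral_lborel_pair:
  fixes f :: "'a::euclidean_space \<times> 'b::euclidean_space \<Rightarrow> ennreal"
  assumes "f \<in> borel_measurable borel"
  shows "(\<integral>\<^sup>+ z. f z \<partial>lborel) = (\<integral>\<^sup>+ x. \<integral>\<^sup>+ y. f (x, y) \<partial>lborel \<partial>lborel)"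
  by (subst lborel_prod[symmetric], subst lborel.nn_integral_fst[symmetric]) (use assms in \<open>auto simp: lborel_prod\<close>)

lemma integral_lborel_pair_mult:
  fixes f :: "'a::euclidean_space \<Rightarrow> 'c::{real_normed_field,banach,second_countable_topology}"
    and g :: "'b::euclidean_space \<Rightarrow> 'c"
  assumes f: "integrable lborel f" and g: "integrable lborel g"
  shows "(LBINT p. f (fst p) * g (snd p)) = (LBINT x. f x) * (LBINT y. g y)"
  using lborel_pair.integral_fst'[OF integrable_lborel_pair_mult[OF f g]] by (simp add: lborel_prod)

lemma borel_measurable_cnj[measurable]: "cnj \<in> borel_measurable borel"
  by (intro borel_measurable_continuous_onI continuous_intros)

text \<open>The inner integral on the right-hand side is the kernel of \<open>T T\<^sup>*\<close>.\<close>

lemma gram_fubini: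
  fixes a a' :: "'b::euclidean_space \<Rightarrow> 'c::euclidean_space \<Rightarrow> complex" and w :: "'b \<Rightarrow> real"
  assumes m[measurable]: "(\<lambda>(y, z). a y z) \<in> borel_measurable (borel \<Otimes>\<^sub>M borel)"
      "(\<lambda>(y, z). a' y z) \<in> borel_measurable (borel \<Otimes>\<^sub>M borel)"
    and b: "\<And>y z. norm (a y z) \<le> 1" "\<And>y z. norm (a' y z) \<le> 1"
    and w: "integrable lborel w" and F: "integrable lborel F" and G: "integrable lborel G"
  shows "(LBINT y. w y *\<^sub>R (cnj (LBINT z. a y z * F z) * (LBINT z. a' y z * G z))) =
      (LBINT p. cnj (F (fst p)) * G (snd p) * (LBINT y. w y *\<^sub>R (cnj (a y (fst p)) * a' y (snd p))))" (is ?E)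
    and "integrable lborel (\<lambda>y. w y *\<^sub>R (cnj (LBINT z. a y z * F z) * (LBINT z. a' y z * G z)))" (is ?I1)
    and "integrable lborel (\<lambda>p. cnj (F (fst p)) * G (snd p) * (LBINT y. w y *\<^sub>R (cnj (a y (fst p)) * a' y (snd p))))" (is ?I2)
proof -
  have [measurable]: "F \<in> borel_measurable borel" "G \<in> borel_measurable borel" "w \<in> borel_measurable borel"
    using w F G by (auto dest: borel_measurable_integrable)
  define h :: "'b \<Rightarrow> 'c \<times> 'c \<Rightarrow> complex" where
    "h y p = w y *\<^sub>R ((cnj (a y (fst p)) * cnj (F (fst p))) * (a' y (snd p) * G (snd p)))" for y p
  have [measurable]: "(\<lambda>q::'b \<times> 'c \<times> 'c. a (fst q) (fst (snd q))) \<in> borel_measurable (borel \<Otimes>\<^sub>M borel \<Otimes>\<^sub>M borel)"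
    using measurable_compose[where f="\<lambda>q::'b \<times> 'c \<times> 'c. (fst q, fst (snd q))", OF _ m(1)] by simp
  have [measurable]: "(\<lambda>q::'b \<times> 'c \<times> 'c. a' (fst q) (snd (snd q))) \<in> borel_measurable (borel \<Otimes>\<^sub>M borel \<Otimes>\<^sub>M borel)"
    using measurable_compose[where f="\<lambda>q::'b \<times> 'c \<times> 'c. (fst q, snd (snd q))", OF _ m(2)] by simp
  have hm: "(\<lambda>q. h (fst q) (snd q)) \<in> borel_measurable (lborel \<Otimes>\<^sub>M lborel)"
    unfolding h_def lborel_prod[symmetric] by measurable
  have FG: "integrable lborel (\<lambda>p. norm (F (fst p)) * norm (G (snd p)))"
    using integrable_lborel_pair_mult[OF integrable_norm[OF F] integrable_norm[OF G]] by (simp add: lborel_prod)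
  have hi: "integrable (lborel \<Otimes>\<^sub>M lborel) (\<lambda>q. h (fst q) (snd q))"
  proof (rule Bochner_Integration.integrable_bound[OF integrable_lborel_pair_mult[OF w FG] hm])
    show "AE q in lborel \<Otimes>\<^sub>M lborel. norm (h (fst q) (snd q)) \<le> norm (w (fst q) * (norm (F (fst (snd q))) * norm (G (snd (snd q)))))"
    proof (rule AE_I2)
      fix q :: "'b \<times> 'c \<times> 'c"
      have "norm (a y z * c * (a' y z' * c')) \<le> norm c * norm c'" for y z z' c c'
        using mult_mono[OF mult_right_mono[OF b(1)[of y z]] mult_right_mono[OF b(2)[of y z']], of "norm c" "norm c'"]
        by (simp add: norm_mult)
      from this[of "fst q" "fst (snd q)" "cnj (cnj (F (fst (snd q))))"]
      show "norm (h (fst q) (snd q)) \<le> norm (w (fst q) * (norm (F (fst (snd q))) * norm (G (snd (snd q)))))"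
        by (auto simp: h_def norm_mult abs_mult intro!: mult_left_mono)
    qed
  qed
  have e1: "w y *\<^sub>R (cnj (LBINT z. a y z * F z) * (LBINT z. a' y z * G z)) = (LBINT p. h y p)" for y
  proof -
    have ay: "a y \<in> borel_measurable borel" "a' y \<in> borel_measurable borel" by measurable
    have i1: "integrable lborel (\<lambda>z. a y z * F z)"
      by (rule Bochner_Integration.integrable_bound[OF F]) (use ay b in \<open>auto simp: norm_mult intro!: mult_left_le_one_le AE_I2\<close>)
    have i2: "integrable lborel (\<lambda>z. a' y z * G z)"
      by (rule Bochner_Integration.integrable_bound[OF G]) (use ay b in \<open>auto simp: norm_mult intro!: mult_left_le_one_le AE_I2\<close>)
    have "cnj (LBINT z. a y z * F z) * (LBINT z. a' y z * G z) =
        (LBINT z. cnj (a y z * F z)) * (LBINT z. a' y z * G z)"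
      by (simp only: Bochner_Integration.integral_cnj)
    also have "\<dots> = (LBINT p. cnj (a y (fst p) * F (fst p)) * (a' y (snd p) * G (snd p)))"
      by (rule integral_lborel_pair_mult[symmetric, OF integrable_bounded_linear[OF bounded_linear_cnj i1] i2])
    finally show ?thesis by (simp add: h_def)
  qed
  have e2: "(LBINT y. h y p) = cnj (F (fst p)) * G (snd p) * (LBINT y. w y *\<^sub>R (cnj (a y (fst p)) * a' y (snd p)))" for p
  proof -
    have "(LBINT y. h y p) = (LBINT y. (cnj (F (fst p)) * G (snd p)) * (w y *\<^sub>R (cnj (a y (fst p)) * a' y (snd p))))"
      by (intro Bochner_Integration.integral_cong refl) (simp add: h_def scaleR_conv_of_real mult_ac)
    also have "\<dots> = (cnj (F (fst p)) * G (snd p)) * (LBINT y. (w y *\<^sub>R (cnj (a y (fst p)) * a' y (snd p))))"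
      by (rule Bochner_Integration.integral_mult_right_zero)
    finally show ?thesis .
  qed
  have hi': "integrable (lborel \<Otimes>\<^sub>M lborel) (\<lambda>(y, p). h y p)" using hi by (simp add: case_prod_unfold)
  show ?E unfolding e1 e2[symmetric]
    by (rule lborel_pair.Fubini_integral[OF hi', symmetric])
  show ?I1 unfolding e1 by (rule lborel_pair.integrable_fst'[OF hi, simplified])
  show ?I2 unfolding e2[symmetric] using lborel_pair.integrable_snd[OF hi'] by simp
qed

lemma nn_integral_lborel_translate:
  fixes f :: "'a::euclidean_space \<Rightarrow> ennreal"
  assumes [measurable]: "f \<in> borel_measurable borel"
  shows "(\<integral>\<^sup>+ x. f (x - c) \<partial>lborel) = (\<integral>\<^sup>+ x. f x \<partial>lborel)"
  by (subst (2) lborel_distr_plus[of "-c", symmetric], subst nn_integral_distr) auto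

lemma gauss_ker_minus: "gauss_ker n r (- \<eta>) = gauss_ker n r \<eta>"
  by (simp add: gauss_ker_def)

lemma measurable_integral_lborel[measurable (raw)]:
  fixes f :: "'a::euclidean_space \<Rightarrow> 'b::euclidean_space \<Rightarrow> 'c::{banach,second_countable_topology}"
  assumes "(\<lambda>(x, y). f x y) \<in> borel_measurable (borel \<Otimes>\<^sub>M borel)"
  shows "(\<lambda>x. LBINT y. f x y) \<in> borel_measurable borel"
  by (rule lborel.borel_measurable_lebesgue_integral) (use assms in measurable)

lemma ennreal_half_sum:
  assumes "0 \<le> c" "0 \<le> a" "0 \<le> b" "0 \<le> k"
  shows "ennreal (c * (a * k) + c * (b * k)) =
    ennreal c * (ennreal a * ennreal k) + ennreal c * (ennreal b * ennreal k)"
  using assms by (simp add: ennreal_mult)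

text \<open>The Gaussian factor makes Fubini legitimate after expanding the square. What results is
  a form with the nonnegative kernel \<open>gauss_ker\<close>, whose integral in either variable is
  the constant on the right, independent of \<open>n\<close>; the arithmetic-geometric mean then
  bounds it by the mass of \<open>\<phi>\<close>.\<close>

lemma plancherel_gauss:
  fixes \<phi> :: "'a::euclidean_space \<Rightarrow> complex"
  assumes \<phi>: "integrable lborel \<phi>" and r: "r \<noteq> 0" and n: "n > 0"
  shows "(\<integral>\<^sup>+ y. ennreal (exp (- (norm (y::'a))\<^sup>2 / (2 * n\<^sup>2)) * (norm (LBINT x. cis (r * (x \<bullet> y)) * \<phi> x))\<^sup>2) \<partial>lborel)
    \<le> ennreal ((2 * pi / \<bar>r\<bar>) ^ DIM('a)) * L2_mass \<phi>"
proof -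
  have [measurable]: "\<phi> \<in> borel_measurable borel" using \<phi> by (auto dest: borel_measurable_integrable)
  let ?w = "\<lambda>y::'a. exp (- (norm y)\<^sup>2 / (2 * n\<^sup>2))"
  let ?a = "\<lambda>(y::'a) x. cis (r * (x \<bullet> y))"
  let ?f = "\<lambda>y. LBINT x. ?a y x * \<phi> x"
  have am: "(\<lambda>(y, z). ?a y z) \<in> borel_measurable (borel \<Otimes>\<^sub>M borel)"
    unfolding cis_conv_exp by measurable
  have ab: "\<And>y x. norm (?a y x) \<le> 1" by simp
  note G = gram_fubini[where a="?a" and a'="?a", OF am am ab ab integrable_gaussian[OF n] \<phi> \<phi>]
  have inner: "(LBINT y. ?w y *\<^sub>R (cnj (?a y z) * ?a y z')) = of_real (gauss_ker n r (z' - z))" for z z' :: 'a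
    by (subst gaussian_fourier[OF n, symmetric])
      (auto intro!: Bochner_Integration.integral_cong simp: cis_cnj cis_mult algebra_simps inner_commute inner_diff_right)
  have sq: "?w y *\<^sub>R (cnj (?f y) * ?f y) = of_real (?w y * (norm (?f y))\<^sup>2)" for y
    by (subst mult.commute[of "cnj _"], subst complex_norm_square[symmetric]) (simp add: scaleR_conv_of_real)
  have I: "integrable lborel (\<lambda>y. ?w y * (norm (?f y))\<^sup>2)"
  proof -
    have "integrable lborel (\<lambda>y. complex_of_real (?w y * (norm (?f y))\<^sup>2))"
      using G(2) unfolding sq .
    from integrable_Re[OF this] show ?thesis by (simp only: Re_complex_of_real)
  qed
  have "(\<integral>\<^sup>+ y. ennreal (?w y * (norm (?f y))\<^sup>2) \<partial>lborel) = ennreal (LBINT y. ?w y * (norm (?f y))\<^sup>2)"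
    by (rule nn_integral_eq_integral[OF I]) auto
  also have "(LBINT y. ?w y * (norm (?f y))\<^sup>2) = norm (LBINT y. complex_of_real (?w y * (norm (?f y))\<^sup>2))"
    by (subst integral_of_real[OF I], subst norm_of_real, subst abs_of_nonneg) (auto intro!: Bochner_Integration.integral_nonneg)
  also have "\<dots> = norm (LBINT p. cnj (\<phi> (fst p)) * \<phi> (snd p) * of_real (gauss_ker n r (snd p - fst p)))"
    using G(1) unfolding sq inner by (simp only:)
  also have "ennreal \<dots> \<le> (\<integral>\<^sup>+ p. norm (cnj (\<phi> (fst p)) * \<phi> (snd p) * of_real (gauss_ker n r (snd p - fst p))) \<partial>lborel)"
    by (rule integral_norm_bound_ennreal) (use G(3) in \<open>simp only: inner\<close>)
  also have "\<dots> \<le> (\<integral>\<^sup>+ p. ennreal (1/2) * (ennreal ((norm (\<phi> (fst p)))\<^sup>2) * ennreal (gauss_ker n r (snd p - fst p))) +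
         ennreal (1/2) * (ennreal ((norm (\<phi> (snd p)))\<^sup>2) * ennreal (gauss_ker n r (fst p - snd p))) \<partial>(lborel \<Otimes>\<^sub>M lborel))"
    unfolding lborel_prod
  proof (rule nn_integral_mono)
    fix p :: "'a \<times> 'a"
    define k where "k = gauss_ker n r (snd p - fst p)"
    have k: "k \<ge> 0" using gauss_ker_nonneg[OF n] by (simp add: k_def)
    have k': "gauss_ker n r (fst p - snd p) = k" unfolding k_def by (subst gauss_ker_minus[symmetric]) simp
    have "norm (\<phi> (fst p)) * norm (\<phi> (snd p)) \<le> 1/2 * (norm (\<phi> (fst p)))\<^sup>2 + 1/2 * (norm (\<phi> (snd p)))\<^sup>2"
      using sum_squares_bound[of "norm (\<phi> (fst p))" "norm (\<phi> (snd p))"] by simp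
    note mm = mult_right_mono[OF this k]
    show "ennreal (norm (cnj (\<phi> (fst p)) * \<phi> (snd p) * of_real (gauss_ker n r (snd p - fst p)))) \<le>
       ennreal (1/2) * (ennreal ((norm (\<phi> (fst p)))\<^sup>2) * ennreal (gauss_ker n r (snd p - fst p))) +
         ennreal (1/2) * (ennreal ((norm (\<phi> (snd p)))\<^sup>2) * ennreal (gauss_ker n r (fst p - snd p)))"
      unfolding k' k_def[symmetric]
      by (subst ennreal_half_sum[symmetric]; (rule ennreal_leI)?; use k mm in \<open>simp add: norm_mult algebra_simps\<close>)
  qed
  also have "\<dots> = ennreal (1/2) * (\<integral>\<^sup>+ p. (ennreal ((norm (\<phi> (fst p)))\<^sup>2) * ennreal (gauss_ker n r (snd p - fst p))) \<partial>(lborel \<Otimes>\<^sub>M lborel)) +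
         ennreal (1/2) * (\<integral>\<^sup>+ p. (ennreal ((norm (\<phi> (snd p)))\<^sup>2) * ennreal (gauss_ker n r (fst p - snd p))) \<partial>(lborel \<Otimes>\<^sub>M lborel))"
    by (subst nn_integral_add, measurable, subst nn_integral_cmult, measurable, subst nn_integral_cmult, measurable)
  also have "(\<integral>\<^sup>+ p. (ennreal ((norm (\<phi> (fst p)))\<^sup>2) * ennreal (gauss_ker n r (snd p - fst p))) \<partial>(lborel \<Otimes>\<^sub>M lborel)) =
      (\<integral>\<^sup>+ x. (\<integral>\<^sup>+ y. (ennreal ((norm (\<phi> x))\<^sup>2) * ennreal (gauss_ker n r (y - x))) \<partial>lborel) \<partial>lborel)"
    by (subst lborel.nn_integral_fst[symmetric]) auto
  also have "\<dots> = (\<integral>\<^sup>+ x. ennreal ((norm (\<phi> x))\<^sup>2) * ennreal ((2 * pi / \<bar>r\<bar>) ^ DIM('a)) \<partial>lborel)"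
    by (subst nn_integral_cmult, measurable, subst nn_integral_lborel_translate[where f="\<lambda>z. ennreal (gauss_ker n r z)"],
        measurable, subst nn_integral_gauss_ker[OF n r], rule refl)
  also have "\<dots> = ennreal ((2 * pi / \<bar>r\<bar>) ^ DIM('a)) * L2_mass \<phi>"
    by (subst nn_integral_multc) (auto simp: mult.commute)
  also have "(\<integral>\<^sup>+ p. (ennreal ((norm (\<phi> (snd p)))\<^sup>2) * ennreal (gauss_ker n r (fst p - snd p))) \<partial>(lborel \<Otimes>\<^sub>M lborel)) =
      (\<integral>\<^sup>+ x. (\<integral>\<^sup>+ y. (ennreal ((norm (\<phi> x))\<^sup>2) * ennreal (gauss_ker n r (y - x))) \<partial>lborel) \<partial>lborel)"
    by (subst lborel_pair.nn_integral_snd[symmetric]) auto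
  also have "\<dots> = (\<integral>\<^sup>+ x. ennreal ((norm (\<phi> x))\<^sup>2) * ennreal ((2 * pi / \<bar>r\<bar>) ^ DIM('a)) \<partial>lborel)"
    by (subst nn_integral_cmult, measurable, subst nn_integral_lborel_translate[where f="\<lambda>z. ennreal (gauss_ker n r z)"],
        measurable, subst nn_integral_gauss_ker[OF n r], rule refl)
  also have "\<dots> = ennreal ((2 * pi / \<bar>r\<bar>) ^ DIM('a)) * L2_mass \<phi>"
    by (subst nn_integral_multc) (auto simp: mult.commute)
  also have "ennreal (1/2) * (ennreal ((2 * pi / \<bar>r\<bar>) ^ DIM('a)) * L2_mass \<phi>) +
      ennreal (1/2) * (ennreal ((2 * pi / \<bar>r\<bar>) ^ DIM('a)) * L2_mass \<phi>) =
      ennreal ((2 * pi / \<bar>r\<bar>) ^ DIM('a)) * L2_mass \<phi>"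
    by (subst distrib_right[symmetric], subst ennreal_plus[symmetric]) auto
  finally show ?thesis .
qed

text \<open>The Gaussian factors tend to 1 and the bound is uniform in \<open>n\<close>, so Fatou's
  lemma suffices. An infinite mass on the right is allowed, hence integrability of
  \<open>\<phi>\<close> is all that is assumed.\<close>

lemma plancherel_bound:
  fixes \<phi> :: "'a::euclidean_space \<Rightarrow> complex"
  assumes \<phi>: "integrable lborel \<phi>" and r: "r \<noteq> 0"
  shows "L2_mass (\<lambda>y. LBINT x. cis (r * (x \<bullet> y)) * \<phi> x)
    \<le> ennreal ((2 * pi / \<bar>r\<bar>) ^ DIM('a)) * L2_mass \<phi>" (is "_ \<le> ?B")
proof -
  let ?f = "\<lambda>y. LBINT x. cis (r * (x \<bullet> y)) * \<phi> x"
  let ?w = "\<lambda>n y::'a. exp (- (norm y)\<^sup>2 / (2 * (real (Suc n))\<^sup>2))"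
  have [measurable]: "\<phi> \<in> borel_measurable borel" using \<phi> by (auto dest: borel_measurable_integrable)
  have [measurable]: "?f \<in> borel_measurable borel"
    unfolding cis_conv_exp by measurable
  have "((\<lambda>n. ?w n y * (norm (?f y))\<^sup>2) \<longlongrightarrow> exp 0 * (norm (?f y))\<^sup>2) sequentially" for y
    by (intro tendsto_intros) real_asymp
  then have "(\<lambda>n. ennreal (?w n y * (norm (?f y))\<^sup>2)) \<longlonglongrightarrow> ennreal ((norm (?f y))\<^sup>2)" for y
    by (intro tendsto_ennrealI) simp
  then have "ennreal ((norm (?f y))\<^sup>2) = liminf (\<lambda>n. ennreal (?w n y * (norm (?f y))\<^sup>2))" for y
    by (intro lim_imp_Liminf[symmetric]) auto
  then have "L2_mass ?f \<le> liminf (\<lambda>n. \<integral>\<^sup>+ y. ennreal (?w n y * (norm (?f y))\<^sup>2) \<partial>lborel)"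
    by (simp only:) (rule nn_integral_liminf, measurable)
  also have "\<dots> \<le> liminf (\<lambda>n. ?B)"
    by (intro Liminf_mono always_eventually allI plancherel_gauss[OF \<phi> r]) simp
  finally show ?thesis by (simp add: Liminf_const)
qed

section \<open>The propagator on functions of bounded support, and Bessel systems\<close>

definition schr_phase :: "real \<Rightarrow> 'a::euclidean_space \<Rightarrow> 'a \<Rightarrow> real" where
  "schr_phase t x y = ((norm y)\<^sup>2 - 2 * (x \<bullet> y)) / (4 * t)"

definition schr_amp :: "nat \<Rightarrow> real \<Rightarrow> real" where
  "schr_amp d t = (1 / sqrt (4 * pi * \<bar>t\<bar>)) ^ d"

text \<open>\<open>schr_kernel\<close> without its unimodular prefactor.\<close>

definition schr_ext :: "('a::euclidean_space \<Rightarrow> complex) \<Rightarrow> real \<Rightarrow> 'a \<Rightarrow> complex" where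
  "schr_ext u t x = of_real (schr_amp DIM('a) t) * (LBINT y. cis (schr_phase t x y) * u y)"

text \<open>The kernel of \<open>e\<^sup>i\<^sup>t\<^sup>\<Delta> e\<^sup>-\<^sup>i\<^sup>t\<^sup>'\<^sup>\<Delta>\<close> with a sharp cutoff to the cube \<open>cbox (-v) v\<close> in the
  intermediate variable: it is bounded for \<open>t, t' \<noteq> 0\<close>, so every integral below converges absolutely,
  and the cutoff is invisible to functions supported in that cube.\<close>

definition schr_gram :: "'a \<Rightarrow> real \<Rightarrow> 'a \<Rightarrow> real \<Rightarrow> 'a::euclidean_space \<Rightarrow> complex" where
  "schr_gram v t x t' x' = of_real (schr_amp DIM('a) t * schr_amp DIM('a) t') *
     (LBINT y. indicator (cbox (-v) v) y *\<^sub>R cis (schr_phase t x y - schr_phase t' x' y))"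

lemma schr_amp_nonneg[simp]: "0 \<le> schr_amp d t"
  by (simp add: schr_amp_def)

lemma measurable_schr_amp[measurable]: "schr_amp d \<in> borel_measurable borel"
  unfolding schr_amp_def by measurable

lemma measurable_cis[measurable]: "cis \<in> borel_measurable borel"
  unfolding cis_conv_exp by measurable

lemma measurable_fst_borel[measurable]: "(fst :: 'a::second_countable_topology \<times> 'b::second_countable_topology \<Rightarrow> 'a) \<in> borel_measurable borel"
  by (intro borel_measurable_continuous_onI continuous_intros)

lemma measurable_snd_borel[measurable]: "(snd :: 'a::second_countable_topology \<times> 'b::second_countable_topology \<Rightarrow> 'b) \<in> borel_measurable borel"
  by (intro borel_measurable_continuous_onI continuous_intros)

lemma measurable_schr_phase[measurable (raw)]:
  assumes [measurable]: "f \<in> borel_measurable M" "g \<in> borel_measurable M" "h \<in> borel_measurable M"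
  shows "(\<lambda>w. schr_phase (f w) (g w) (h w)) \<in> borel_measurable M"
  unfolding schr_phase_def by measurable

lemma measurable_schr_ext[measurable (raw)]:
  fixes u :: "'a::euclidean_space \<Rightarrow> complex"
  assumes [measurable]: "u \<in> borel_measurable borel" "f \<in> borel_measurable M" "g \<in> borel_measurable M"
  shows "(\<lambda>w. schr_ext u (f w) (g w)) \<in> borel_measurable M"
  unfolding schr_ext_def by measurable

lemma measurable_schr_gram[measurable (raw)]:
  fixes f' :: "_ \<Rightarrow> 'a::euclidean_space"
  assumes [measurable]: "f \<in> borel_measurable M" "f' \<in> borel_measurable M" "g \<in> borel_measurable M" "g' \<in> borel_measurable M"
  shows "(\<lambda>w. schr_gram v (f w) (f' w) (g w) (g' w)) \<in> borel_measurable M"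
proof -
  have [measurable]: "cbox (-v) v \<in> sets borel" by simp
  show ?thesis unfolding schr_gram_def by measurable
qed

text \<open>Expanding the square in the phase, the part depending on \<open>x\<close> alone leaves
  the integral as a factor of modulus one. The complex power has modulus (4 pi |t|)^(-d/2) because
  its exponent is real.\<close>

lemma norm_schr_kernel:
  fixes f :: "'a::euclidean_space \<Rightarrow> complex"
  assumes "t \<noteq> 0"
  shows "norm (schr_kernel t f x) = norm (schr_ext f t x)"
proof -
  have p: "4 * pi * \<bar>t\<bar> > 0" using assms by simp
  have nz: "complex_of_real (4 * pi * t) * \<i> \<noteq> 0" using assms by simp
  have "norm ((complex_of_real (4 * pi * t) * \<i>) powr (- (of_nat DIM('a)) / 2)) = exp (- real DIM('a) / 2 * ln (4 * pi * \<bar>t\<bar>))"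
    using nz assms by (simp add: powr_def norm_exp_eq_Re norm_mult abs_mult)
  also have "\<dots> = (4 * pi * \<bar>t\<bar>) powr (- real DIM('a) / 2)" using assms by (simp add: powr_def)
  also have "\<dots> = ((4 * pi * \<bar>t\<bar>) powr (-1/2)) powr real DIM('a)"
    by (simp add: powr_powr)
  also have "(4 * pi * \<bar>t\<bar>) powr (-1/2) = 1 / sqrt (4 * pi * \<bar>t\<bar>)"
    using p by (simp add: powr_minus_divide powr_half_sqrt)
  also have "(1 / sqrt (4 * pi * \<bar>t\<bar>)) powr real DIM('a) = schr_amp DIM('a) t"
    unfolding schr_amp_def using p by (intro powr_realpow) simp
  finally have a: "norm ((complex_of_real (4 * pi * t) * \<i>) powr (- (of_nat DIM('a)) / 2)) = schr_amp DIM('a) t" .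
  have "exp (\<i> * complex_of_real ((norm (x - y))\<^sup>2 / (4 * t))) * f y = cis ((norm x)\<^sup>2 / (4*t)) * (cis (schr_phase t x y) * f y)" for y
  proof -
    have "(norm (x - y))\<^sup>2 / (4 * t) = (norm x)\<^sup>2 / (4*t) + schr_phase t x y"
      by (simp add: schr_phase_def power2_norm_eq_inner inner_diff_left inner_diff_right inner_commute add_divide_distrib[symmetric])
    then show ?thesis by (simp only: cis_conv_exp[symmetric] cis_mult[symmetric] mult.assoc)
  qed
  then have "(LBINT y. exp (\<i> * complex_of_real ((norm (x - y))\<^sup>2 / (4 * t))) * f y) =
      cis ((norm x)\<^sup>2 / (4*t)) * (LBINT y. cis (schr_phase t x y) * f y)"
    by (simp only: integral_mult_right_zero)
  then show ?thesis unfolding schr_kernel_def schr_ext_def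
    using a by (simp add: norm_mult)
qed

lemma schr_amp_sq: "t \<noteq> 0 \<Longrightarrow> (schr_amp d t)\<^sup>2 * (4 * pi * \<bar>t\<bar>) ^ d = 1"
  by (simp add: schr_amp_def power_mult_distrib[symmetric] power_one_over power_divide
    power_mult[symmetric] mult.commute[of d 2] power_mult real_sqrt_pow2)

text \<open>Plancherel with \<open>r = s / (2 * t)\<close>: the constant is the d-th power of
  \<open>4 * pi * \<bar>t\<bar>\<close>, cancelled by the squared amplitude. The sign
  \<open>s\<close> is -1 for the propagator and 1 for its adjoint.\<close>

lemma schr_amp_plancherel:
  fixes u :: "'a::euclidean_space \<Rightarrow> complex"
  assumes t: "t \<noteq> 0" and u: "integrable lborel u" and s: "\<bar>s\<bar> = 1"
  shows "L2_mass (\<lambda>y. of_real (schr_amp DIM('a) t) * (LBINT x. cis (s / (2*t) * (x \<bullet> y)) * u x))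
     \<le> L2_mass u"
proof -
  have [measurable]: "u \<in> borel_measurable borel" using u by (auto dest: borel_measurable_integrable)
  have r: "s / (2*t) \<noteq> 0" using t s by auto
  have r': "2 * pi / \<bar>s / (2*t)\<bar> = 4 * pi * \<bar>t\<bar>" using t s by (simp add: abs_mult)
  have "L2_mass (\<lambda>y. of_real (schr_amp DIM('a) t) * (LBINT x. cis (s / (2*t) * (x \<bullet> y)) * u x))
     = ennreal ((schr_amp DIM('a) t)\<^sup>2) * L2_mass (\<lambda>y. LBINT x. cis (s / (2*t) * (x \<bullet> y)) * u x)"
    by (subst nn_integral_cmult[symmetric]) (auto simp: norm_mult power_mult_distrib ennreal_mult)
  also have "\<dots> \<le> ennreal ((schr_amp DIM('a) t)\<^sup>2) * (ennreal ((4 * pi * \<bar>t\<bar>) ^ DIM('a)) * L2_mass u)"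
    using plancherel_bound[OF u r] unfolding r' by (intro mult_left_mono) auto
  also have "\<dots> = ennreal ((schr_amp DIM('a) t)\<^sup>2 * (4 * pi * \<bar>t\<bar>) ^ DIM('a)) * L2_mass u"
    by (simp add: ennreal_mult mult.assoc)
  finally show ?thesis using schr_amp_sq[OF t, of "DIM('a)"] by simp
qed

text \<open>The chirp exp(i |y|^2 / (4t)) has modulus one and is absorbed into \<open>u\<close>; a
  rescaled Fourier transform remains.\<close>

lemma schr_ext_L2_bound:
  fixes u :: "'a::euclidean_space \<Rightarrow> complex"
  assumes t: "t \<noteq> 0" and u: "integrable lborel u"
  shows "L2_mass (schr_ext u t) \<le> L2_mass u"
proof -
  define u' where "u' y = cis ((norm y)\<^sup>2 / (4*t)) * u y" for y
  have [measurable]: "u \<in> borel_measurable borel" using u by (auto dest: borel_measurable_integrable)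
  have [measurable]: "u' \<in> borel_measurable borel" unfolding u'_def[abs_def] by measurable
  have u': "integrable lborel u'"
    by (rule Bochner_Integration.integrable_bound[OF u]) (auto simp: u'_def norm_mult)
  have "cis (schr_phase t x y) * u y = cis (- 1 / (2*t) * (y \<bullet> x)) * u' y" for x y
  proof -
    have e: "schr_phase t x y = - 1 / (2*t) * (y \<bullet> x) + (norm y)\<^sup>2 / (4*t)"
      using t by (simp add: schr_phase_def field_simps inner_commute)
    show ?thesis unfolding e u'_def cis_mult[symmetric] by simp
  qed
  then have e: "schr_ext u t x = of_real (schr_amp DIM('a) t) * (LBINT y. cis (- 1 / (2*t) * (y \<bullet> x)) * u' y)" for x
    by (simp add: schr_ext_def)
  show ?thesis unfolding e
    using schr_amp_plancherel[OF t u', of "-1"] by (simp add: u'_def norm_mult)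
qed

text \<open>Here the integration runs over the variable that enters the phase linearly, so the chirp
  in \<open>y\<close> is a mere prefactor.\<close>

lemma schr_adjoint_L2_bound:
  fixes u :: "'a::euclidean_space \<Rightarrow> complex"
  assumes t: "t \<noteq> 0" and u: "integrable lborel u"
  shows "L2_mass (\<lambda>y. of_real (schr_amp DIM('a) t) * (LBINT x. cis (- 1 * schr_phase t x y) * u x))
    \<le> L2_mass u"
proof -
  have "norm (LBINT x. cis (- 1 * schr_phase t x y) * u x) = norm (LBINT x. cis (1 / (2*t) * (x \<bullet> y)) * u x)" for y :: 'a
  proof -
    have "cis (- 1 * schr_phase t x y) * u x = cis (- (norm y)\<^sup>2 / (4*t)) * (cis (1 / (2*t) * (x \<bullet> y)) * u x)" for x
    proof -
      have "- 1 * schr_phase t x y = - (norm y)\<^sup>2 / (4*t) + 1 / (2*t) * (x \<bullet> y)"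
        using t by (simp add: schr_phase_def field_simps)
      then show ?thesis by (simp only: cis_mult[symmetric] mult.assoc)
    qed
    then have "(LBINT x. cis (- 1 * schr_phase t x y) * u x) =
        cis (- (norm y)\<^sup>2 / (4*t)) * (LBINT x. cis (1 / (2*t) * (x \<bullet> y)) * u x)"
      by (simp only: integral_mult_right_zero)
    then show ?thesis by (simp add: norm_mult)
  qed
  then show ?thesis using schr_amp_plancherel[OF t u, of 1] by (simp only: norm_mult)
qed

section \<open>The two-time kernel: dispersive decay and contraction\<close>

text \<open>The difference of the two phases is quadratic in \<open>y\<close> with leading
  coefficient \<open>(t' - t) / (4 * t * t')\<close>. Against the two amplitudes the individual
  times cancel, leaving |t - t'|^(-1/2) per coordinate; the cutoff does no harm because the Fresnel
  bound is uniform in the cube.\<close>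

lemma schr_gram_bound:
  fixes v x x' :: "'a::euclidean_space"
  assumes t: "t \<noteq> 0" "t' \<noteq> 0" "t \<noteq> t'"
  shows "norm (schr_gram v t x t' x') \<le> (1 / sqrt \<bar>t - t'\<bar>) ^ DIM('a)"
proof -
  let ?\<sigma> = "1/(4*t) - 1/(4*t')" and ?\<eta> = "(1/(2*t)) *\<^sub>R x - (1/(2*t')) *\<^sub>R x'"
  have \<sigma>: "?\<sigma> = (t' - t) / (4 * t * t')" using t by (simp add: field_simps)
  have ph: "schr_phase t x y - schr_phase t' x' y = ?\<sigma> * (norm y)\<^sup>2 - y \<bullet> ?\<eta>" for y
    using t by (simp add: schr_phase_def inner_diff_right inner_commute field_simps)
  have "norm (schr_gram v t x t' x') \<le> (schr_amp DIM('a) t * schr_amp DIM('a) t') * (6 / sqrt \<bar>?\<sigma>\<bar>) ^ DIM('a)"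
    unfolding schr_gram_def ph norm_mult
    using oscillatory_cube_bound[of ?\<sigma> "-v" v ?\<eta>] t by (intro mult_mono) (auto simp: \<sigma> norm_mult)
  also have "\<dots> = (1 / sqrt (4 * pi * \<bar>t\<bar>) * (1 / sqrt (4 * pi * \<bar>t'\<bar>)) * (6 / sqrt \<bar>?\<sigma>\<bar>)) ^ DIM('a)"
    by (simp only: schr_amp_def power_mult_distrib)
  also have "\<dots> \<le> (1 / sqrt \<bar>t - t'\<bar>) ^ DIM('a)"
  proof (rule power_mono)
    have "sqrt \<bar>?\<sigma>\<bar> = sqrt \<bar>t - t'\<bar> / (2 * sqrt \<bar>t\<bar> * sqrt \<bar>t'\<bar>)"
      unfolding \<sigma> by (simp add: abs_mult real_sqrt_divide real_sqrt_mult abs_minus_commute)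
    \<comment> \<open>The factor per coordinate is \<open>3 / pi\<close>, below 1: the crude Fresnel
      constant 6 is just good enough for a decay estimate with constant 1.\<close>
    then have "1 / sqrt (4 * pi * \<bar>t\<bar>) * (1 / sqrt (4 * pi * \<bar>t'\<bar>)) * (6 / sqrt \<bar>?\<sigma>\<bar>) = (3 / pi) * (1 / sqrt \<bar>t - t'\<bar>)"
      using t by (simp add: real_sqrt_mult field_simps)
    also have "\<dots> \<le> 1 * (1 / sqrt \<bar>t - t'\<bar>)"
      using pi_gt3 by (intro mult_right_mono) auto
    finally show "1 / sqrt (4 * pi * \<bar>t\<bar>) * (1 / sqrt (4 * pi * \<bar>t'\<bar>)) * (6 / sqrt \<bar>?\<sigma>\<bar>) \<le> 1 / sqrt \<bar>t - t'\<bar>" by simp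
  qed auto
  finally show ?thesis .
qed

lemma norm_integral_mult_le:
  fixes f g :: "'a \<Rightarrow> complex"
  assumes [measurable]: "f \<in> borel_measurable M" "g \<in> borel_measurable M"
    and f: "(\<integral>\<^sup>+ x. ennreal ((norm (f x))\<^sup>2) \<partial>M) \<le> ennreal A" and g: "(\<integral>\<^sup>+ x. ennreal ((norm (g x))\<^sup>2) \<partial>M) \<le> ennreal B"
    and AB: "A \<ge> 0" "B \<ge> 0"
  shows "norm (LINT x|M. f x * g x) \<le> sqrt A * sqrt B"
proof (cases "integrable M (\<lambda>x. f x * g x)")
  case False then show ?thesis using AB by (simp add: not_integrable_integral_eq)
next
  case True
  have "ennreal (norm (LINT x|M. f x * g x)) \<le> (\<integral>\<^sup>+ x. ennreal (norm (f x)) * ennreal (norm (g x)) \<partial>M)"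
    using integral_norm_bound_ennreal[OF True] by (simp add: norm_mult ennreal_mult)
  then have "(ennreal (norm (LINT x|M. f x * g x)))\<^sup>2 \<le> (\<integral>\<^sup>+ x. ennreal (norm (f x)) * ennreal (norm (g x)) \<partial>M)\<^sup>2"
    by (intro power_mono) auto
  also have "\<dots> \<le> (\<integral>\<^sup>+ x. (ennreal (norm (f x)))\<^sup>2 \<partial>M) * (\<integral>\<^sup>+ x. (ennreal (norm (g x)))\<^sup>2 \<partial>M)"
    by (rule Cauchy_Schwarz_nn_integral) auto
  also have "\<dots> \<le> ennreal A * ennreal B"
    using f g by (intro mult_mono) (auto simp: ennreal_power)
  finally have "ennreal ((norm (LINT x|M. f x * g x))\<^sup>2) \<le> ennreal (A * B)"
    using AB by (simp add: ennreal_power ennreal_mult)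
  then have "(norm (LINT x|M. f x * g x))\<^sup>2 \<le> A * B" using AB by (simp add: ennreal_le_iff)
  then have "norm (LINT x|M. f x * g x) \<le> sqrt (A * B)" by (rule real_le_rsqrt)
  then show ?thesis by (simp add: real_sqrt_mult)
qed

lemma integrable_indicator_cbox: "integrable lborel (indicator (cbox (-v) v) :: 'a::euclidean_space \<Rightarrow> real)"
  using emeasure_bounded_finite[OF bounded_cbox, of "-v" v] by simp

text \<open>The form factors through L2 of the intermediate variable \<open>y\<close>: it is the
  inner product over the cube of the adjoint propagators applied to \<open>\<phi>\<close> and
  \<open>\<psi>\<close>. Both are contractions, restriction to the cube only decreases the norm, and
  Cauchy-Schwarz finishes.\<close>

lemma schr_gram_form_bound:
  fixes \<phi> \<psi> :: "'a::euclidean_space \<Rightarrow> complex"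
  assumes t: "t \<noteq> 0" "t' \<noteq> 0" and i: "integrable lborel \<phi>" "integrable lborel \<psi>"
    and i2: "integrable lborel (\<lambda>x. (norm (\<phi> x))\<^sup>2)" "integrable lborel (\<lambda>x. (norm (\<psi> x))\<^sup>2)"
  shows "norm (LBINT p. cnj (\<phi> (fst p)) * \<psi> (snd p) * schr_gram v t (fst p) t' (snd p))
     \<le> sqrt (LBINT x. (norm (\<phi> x))\<^sup>2) * sqrt (LBINT x. (norm (\<psi> x))\<^sup>2)"
proof -
  have [measurable]: "\<phi> \<in> borel_measurable borel" "\<psi> \<in> borel_measurable borel" using i by (auto dest: borel_measurable_integrable)
  have [measurable]: "cbox (-v) v \<in> sets borel" by simp
  let ?a = "\<lambda>t y x. cis (- 1 * schr_phase t x y)"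
  let ?w = "\<lambda>y. indicator (cbox (-v) v) y :: real"
  let ?A = "schr_amp DIM('a)"
  define f where "f y = cnj (of_real (?A t) * (LBINT x. ?a t y x * \<phi> x))" for y
  define g where "g y = of_real (?A t') * (LBINT x. ?a t' y x * \<psi> x)" for y
  have am: "(\<lambda>(y, z). ?a s y z) \<in> borel_measurable (borel \<Otimes>\<^sub>M borel)" for s :: real by measurable
  have ab: "\<And>y x. norm (?a s y x) \<le> 1" for s by simp
  note G = gram_fubini[where a="?a t" and a'="?a t'", OF am am ab ab integrable_indicator_cbox[of v] i]
  have inner: "(LBINT y. ?w y *\<^sub>R (cnj (?a t y z) * ?a t' y z')) =
     (LBINT y. ?w y *\<^sub>R cis (schr_phase t z y - schr_phase t' z' y))" for z z' :: 'a
    by (simp add: cis_cnj cis_mult)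
  have "(LBINT p. cnj (\<phi> (fst p)) * \<psi> (snd p) * schr_gram v t (fst p) t' (snd p)) =
     (LBINT p. of_real (?A t * ?A t') * (cnj (\<phi> (fst p)) * \<psi> (snd p) *
       (LBINT y. ?w y *\<^sub>R (cnj (?a t y (fst p)) * ?a t' y (snd p)))))"
    unfolding inner schr_gram_def by (intro Bochner_Integration.integral_cong refl) (simp add: mult_ac)
  also have "\<dots> = of_real (?A t * ?A t') * (LBINT y. ?w y *\<^sub>R (cnj (LBINT z. ?a t y z * \<phi> z) * (LBINT z. ?a t' y z * \<psi> z)))"
    unfolding G(1) by (rule integral_mult_right_zero)
  also have "\<dots> = (LBINT y. of_real (?A t * ?A t') * (?w y *\<^sub>R (cnj (LBINT z. ?a t y z * \<phi> z) * (LBINT z. ?a t' y z * \<psi> z))))"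
    by (rule integral_mult_right_zero[symmetric])
  also have "\<dots> = (LBINT y. (?w y *\<^sub>R f y) * g y)"
    by (intro Bochner_Integration.integral_cong refl) (simp add: f_def g_def mult_ac scaleR_conv_of_real)
  finally have eq: "(LBINT p. cnj (\<phi> (fst p)) * \<psi> (snd p) * schr_gram v t (fst p) t' (snd p)) = (LBINT y. (?w y *\<^sub>R f y) * g y)" .
  have [measurable]: "f \<in> borel_measurable borel" "g \<in> borel_measurable borel" unfolding f_def g_def by measurable
  have "L2_mass f \<le> L2_mass \<phi>"
    unfolding f_def complex_mod_cnj by (rule schr_adjoint_L2_bound[OF t(1) i(1)])
  also have "\<dots> = ennreal (LBINT x. (norm (\<phi> x))\<^sup>2)" by (rule nn_integral_eq_integral[OF i2(1)]) simp
  finally have f1: "L2_mass f \<le> ennreal (LBINT x. (norm (\<phi> x))\<^sup>2)" .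
  have f2: "L2_mass (\<lambda>y. ?w y *\<^sub>R f y) \<le> ennreal (LBINT x. (norm (\<phi> x))\<^sup>2)"
    by (rule order_trans[OF nn_integral_mono f1]) (auto simp: indicator_def)
  have "L2_mass g \<le> L2_mass \<psi>"
    unfolding g_def by (rule schr_adjoint_L2_bound[OF t(2) i(2)])
  also have "\<dots> = ennreal (LBINT x. (norm (\<psi> x))\<^sup>2)" by (rule nn_integral_eq_integral[OF i2(2)]) simp
  finally have g1: "L2_mass g \<le> ennreal (LBINT x. (norm (\<psi> x))\<^sup>2)" .
  show ?thesis unfolding eq
    by (rule norm_integral_mult_le[OF _ _ f2 g1]) auto
qed

text \<open>Truncation destroys orthonormality but preserves Bessel's inequality, which is all that the
  estimates use.\<close>

definition bessel_system :: "nat set \<Rightarrow> (nat \<Rightarrow> 'a::euclidean_space \<Rightarrow> complex) \<Rightarrow> bool" where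
  "bessel_system J u \<longleftrightarrow> (\<forall>j\<in>J. L2 (u j)) \<and>
     (\<forall>\<phi>. L2 \<phi> \<longrightarrow> (\<Sum>j\<in>J. (norm (L2_inner (u j) \<phi>))\<^sup>2) \<le> (LBINT x. (norm (\<phi> x))\<^sup>2))"

section \<open>Square-integrable functions and Bessel's inequality\<close>

lemma L2_measurable: "L2 f \<Longrightarrow> f \<in> borel_measurable borel" by (simp add: L2_def)

lemma L2_integrable_mult:
  fixes f g :: "'a::euclidean_space \<Rightarrow> complex"
  assumes "L2 f" "L2 g"
  shows "integrable lborel (\<lambda>x. cnj (f x) * g x)"
proof (rule Bochner_Integration.integrable_bound)
  have [measurable]: "f \<in> borel_measurable borel" "g \<in> borel_measurable borel" using assms by (auto simp: L2_def)
  show "integrable lborel (\<lambda>x. (norm (f x))\<^sup>2 + (norm (g x))\<^sup>2)" using assms by (auto simp: L2_def)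
  show "(\<lambda>x. cnj (f x) * g x) \<in> borel_measurable lborel" by measurable
  show "AE x in lborel. norm (cnj (f x) * g x) \<le> norm ((norm (f x))\<^sup>2 + (norm (g x))\<^sup>2)"
  proof (rule AE_I2)
    fix x
    have "norm (f x) * norm (g x) \<le> (norm (f x))\<^sup>2 + (norm (g x))\<^sup>2"
      using sum_squares_bound[of "norm (f x)" "norm (g x)"] mult_nonneg_nonneg[of "norm (f x)" "norm (g x)"]
      unfolding mult.assoc by (smt (verit) norm_ge_zero)
    then show "norm (cnj (f x) * g x) \<le> norm ((norm (f x))\<^sup>2 + (norm (g x))\<^sup>2)" by (simp add: norm_mult)
  qed
qed

lemma L2_add:
  fixes f g :: "'a::euclidean_space \<Rightarrow> complex"
  assumes "L2 f" "L2 g" shows "L2 (\<lambda>x. f x + g x)"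
proof -
  have [measurable]: "f \<in> borel_measurable borel" "g \<in> borel_measurable borel" using assms by (auto simp: L2_def)
  have "integrable lborel (\<lambda>x. (norm (f x + g x))\<^sup>2)"
  proof (rule Bochner_Integration.integrable_bound)
    show "integrable lborel (\<lambda>x. 2 * (norm (f x))\<^sup>2 + 2 * (norm (g x))\<^sup>2)" using assms by (auto simp: L2_def)
    show "AE x in lborel. norm ((norm (f x + g x))\<^sup>2) \<le> norm (2 * (norm (f x))\<^sup>2 + 2 * (norm (g x))\<^sup>2)"
    proof (rule AE_I2)
      fix x
      have "(norm (f x + g x))\<^sup>2 \<le> (norm (f x) + norm (g x))\<^sup>2" by (intro power_mono norm_triangle_ineq) auto
      also have "\<dots> \<le> 2 * (norm (f x))\<^sup>2 + 2 * (norm (g x))\<^sup>2"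
        using sum_squares_bound[of "norm (f x)" "norm (g x)"] by (simp add: power2_sum)
      finally show "norm ((norm (f x + g x))\<^sup>2) \<le> norm (2 * (norm (f x))\<^sup>2 + 2 * (norm (g x))\<^sup>2)" by simp
    qed
  qed measurable
  then show ?thesis by (simp add: L2_def)
qed

lemma L2_cmult: "L2 f \<Longrightarrow> L2 (\<lambda>x. c * f x)"
  by (auto simp: L2_def norm_mult power_mult_distrib)

lemma L2_sum: "finite J \<Longrightarrow> (\<And>j. j \<in> J \<Longrightarrow> L2 (f j)) \<Longrightarrow> L2 (\<lambda>x. \<Sum>j\<in>J. f j x)"
proof (induction J rule: finite_induct)
  case empty then show ?case by (simp add: L2_def)
next
  case (insert j J) then show ?case by (simp add: L2_add)
qed

text \<open>Expansion of the squared distance from \<open>\<phi>\<close> to its orthogonal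
  projection \<open>S\<close> onto the span of the finite subsystem.\<close>

lemma orthonormal_imp_bessel:
  fixes u :: "nat \<Rightarrow> 'a::euclidean_space \<Rightarrow> complex"
  assumes "orthonormal_system J0 u" "finite J" "J \<subseteq> J0"
  shows "bessel_system J u"
  unfolding bessel_system_def
proof (intro conjI ballI allI impI)
  have uL: "L2 (u j)" if "j \<in> J" for j using assms that by (auto simp: orthonormal_system_def)
  then show "L2 (u j)" if "j \<in> J" for j using that .
  have on: "L2_inner (u j) (u k) = (if j = k then 1 else 0)" if "j \<in> J" "k \<in> J" for j k
    using assms that unfolding orthonormal_system_def by blast
  fix \<phi> :: "'a \<Rightarrow> complex" assume \<phi>: "L2 \<phi>"
  define c where "c j = L2_inner (u j) \<phi>" for j
  define S where "S x = (\<Sum>j\<in>J. c j * u j x)" for x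
  have S: "L2 S" unfolding S_def[abs_def] by (intro L2_sum L2_cmult uL assms)
  have iS: "integrable lborel (\<lambda>x. cnj (f x) * S x)" if "L2 f" for f by (rule L2_integrable_mult[OF that S])
  have inner_S: "(LBINT x. cnj (f x) * S x) = (\<Sum>j\<in>J. c j * L2_inner f (u j))" if "L2 f" for f
  proof -
    have "(LBINT x. cnj (f x) * S x) = (LBINT x. (\<Sum>j\<in>J. c j * (cnj (f x) * u j x)))"
      by (intro Bochner_Integration.integral_cong refl) (simp add: S_def sum_distrib_left mult_ac)
    also have "\<dots> = (\<Sum>j\<in>J. (LBINT x. c j * (cnj (f x) * u j x)))"
      by (rule Bochner_Integration.integral_sum) (auto intro!: integrable_mult_right L2_integrable_mult that uL)
    finally show ?thesis by (simp add: L2_inner_def)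
  qed
  have sw: "(LBINT x. cnj (f x) * g x) = cnj (LBINT x. cnj (g x) * f x)" for f g :: "'a \<Rightarrow> complex"
    by (subst Bochner_Integration.integral_cnj[symmetric]) (simp add: mult.commute)
  have uS: "(LBINT x. cnj (u k x) * S x) = c k" if "k \<in> J" for k
    using that assms(2) by (simp add: inner_S[OF uL] on if_distrib cong: if_cong)
  have SS: "(LBINT x. cnj (S x) * S x) = of_real (\<Sum>j\<in>J. (norm (c j))\<^sup>2)"
  proof -
    have "(LBINT x. cnj (S x) * S x) = (\<Sum>j\<in>J. c j * L2_inner S (u j))" by (rule inner_S[OF S])
    also have "\<dots> = (\<Sum>j\<in>J. c j * cnj (c j))"
      by (intro sum.cong refl) (simp add: L2_inner_def sw[of S "u _"] uS)
    finally show ?thesis unfolding complex_norm_square[symmetric] of_real_sum .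
  qed
  have \<phi>S: "(LBINT x. cnj (\<phi> x) * S x) = of_real (\<Sum>j\<in>J. (norm (c j))\<^sup>2)"
  proof -
    have "(LBINT x. cnj (\<phi> x) * S x) = (\<Sum>j\<in>J. c j * L2_inner \<phi> (u j))" by (rule inner_S[OF \<phi>])
    also have "\<dots> = (\<Sum>j\<in>J. c j * cnj (c j))"
      by (intro sum.cong refl) (simp add: L2_inner_def c_def sw[of \<phi> "u _"])
    finally show ?thesis unfolding complex_norm_square[symmetric] of_real_sum .
  qed
  have "0 \<le> (LBINT x. (norm (\<phi> x - S x))\<^sup>2)" by (intro Bochner_Integration.integral_nonneg) auto
  also have "\<dots> = (LBINT x. (norm (\<phi> x))\<^sup>2 - 2 * Re (cnj (\<phi> x) * S x) + Re (cnj (S x) * S x))"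
  proof (intro Bochner_Integration.integral_cong refl)
    fix x
    have "complex_of_real ((norm (\<phi> x - S x))\<^sup>2) = complex_of_real ((norm (\<phi> x))\<^sup>2) - (cnj (\<phi> x) * S x + cnj (cnj (\<phi> x) * S x)) + cnj (S x) * S x"
      unfolding complex_norm_square by (simp add: algebra_simps)
    also have "cnj (\<phi> x) * S x + cnj (cnj (\<phi> x) * S x) = of_real (2 * Re (cnj (\<phi> x) * S x))" by (rule complex_add_cnj)
    finally show "(norm (\<phi> x - S x))\<^sup>2 = (norm (\<phi> x))\<^sup>2 - 2 * Re (cnj (\<phi> x) * S x) + Re (cnj (S x) * S x)"
      by (metis Re_complex_of_real minus_complex.simps(1) plus_complex.simps(1))
  qed
  also have "\<dots> = (LBINT x. (norm (\<phi> x))\<^sup>2) - 2 * Re (LBINT x. cnj (\<phi> x) * S x) + Re (LBINT x. cnj (S x) * S x)"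
    using iS[OF \<phi>] iS[OF S] \<phi> by (simp add: L2_def del: complex_cnj_cnj times_complex.simps)
  finally show "(\<Sum>j\<in>J. (norm (L2_inner (u j) \<phi>))\<^sup>2) \<le> (LBINT x. (norm (\<phi> x))\<^sup>2)"
    unfolding \<phi>S SS by (simp add: c_def)
qed

lemma L2_indicator:
  fixes f :: "'a::euclidean_space \<Rightarrow> complex"
  assumes "L2 f" and [measurable]: "A \<in> sets borel"
  shows "L2 (\<lambda>x. indicator A x * f x)"
proof -
  have [measurable]: "f \<in> borel_measurable borel" using assms by (auto simp: L2_def)
  have "integrable lborel (\<lambda>x. (norm (indicator A x * f x))\<^sup>2)"
    by (rule Bochner_Integration.integrable_bound[of _ "\<lambda>x. (norm (f x))\<^sup>2"])
      (use assms in \<open>auto simp: L2_def indicator_def\<close>)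
  then show ?thesis by (simp add: L2_def)
qed

text \<open>The indicator can be moved to the test function, whose norm it does not
  increase.\<close>

lemma bessel_system_indicator:
  assumes b: "bessel_system J u" and A: "A \<in> sets borel"
  shows "bessel_system J (\<lambda>j x. indicator A x * u j x)"
  unfolding bessel_system_def
proof (intro conjI ballI allI impI)
  show "L2 (\<lambda>x. indicator A x * u j x)" if "j \<in> J" for j
    using b that A by (intro L2_indicator) (auto simp: bessel_system_def)
  fix \<phi> :: "'a \<Rightarrow> complex" assume \<phi>: "L2 \<phi>"
  have "L2_inner (\<lambda>x. indicator A x * u j x) \<phi> = L2_inner (u j) (\<lambda>x. indicator A x * \<phi> x)" for j
    unfolding L2_inner_def by (intro Bochner_Integration.integral_cong refl) (simp add: indicator_def)
  then have "(\<Sum>j\<in>J. (norm (L2_inner (\<lambda>x. indicator A x * u j x) \<phi>))\<^sup>2) \<le> (LBINT x. (norm (indicator A x * \<phi> x))\<^sup>2)"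
    using b L2_indicator[OF \<phi> A] by (simp add: bessel_system_def)
  also have "\<dots> \<le> (LBINT x. (norm (\<phi> x))\<^sup>2)"
    using L2_indicator[OF \<phi> A] \<phi> by (intro integral_mono) (auto simp: L2_def indicator_def)
  finally show "(\<Sum>j\<in>J. (norm (L2_inner (\<lambda>x. indicator A x * u j x) \<phi>))\<^sup>2) \<le> (LBINT x. (norm (\<phi> x))\<^sup>2)" .
qed

lemma L2_cbox_integrable:
  fixes f :: "'a::euclidean_space \<Rightarrow> complex"
  assumes f: "L2 f" and s: "\<And>x. x \<notin> cbox (-v) v \<Longrightarrow> f x = 0"
  shows "integrable lborel f"
proof (rule Bochner_Integration.integrable_bound)
  show "integrable lborel (\<lambda>x. indicator (cbox (-v) v) x + (norm (f x))\<^sup>2)"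
    using f integrable_indicator_cbox[of v] by (auto simp: L2_def simp del: integrable_indicator_iff)
  show "f \<in> borel_measurable lborel" using f by (simp add: L2_def)
  show "AE x in lborel. norm (f x) \<le> norm (indicator (cbox (-v) v) x + (norm (f x))\<^sup>2)"
  proof (rule AE_I2)
    fix x
    have "norm (f x) \<le> 1 + (norm (f x))\<^sup>2"
      using sum_squares_bound[of "norm (f x)" 1] norm_ge_zero[of "f x"] by (smt (verit) mult_cancel_left2 one_power2)
    then show "norm (f x) \<le> norm (indicator (cbox (-v) v) x + (norm (f x))\<^sup>2)"
      using s[of x] by (cases "x \<in> cbox (-v) v") auto
  qed
qed

text \<open>\<open>\<Phi>\<close> is the adjoint of the extension operator applied to
  \<open>F\<close>, so the coefficients on the left are the inner products of \<open>u j\<close>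
  with it. Bessel's inequality bounds their squares by the squared norm of the cut-off
  \<open>\<Phi>\<close>, which \<open>gram_fubini\<close> rewrites as the form of
  \<open>schr_gram\<close>.\<close>

lemma gram_bessel:
  fixes u :: "nat \<Rightarrow> 'a::euclidean_space \<Rightarrow> complex" and F :: "real \<times> 'a \<Rightarrow> complex"
  assumes fin: "finite J" and b: "bessel_system J u"
    and supp: "\<And>j x. j \<in> J \<Longrightarrow> x \<notin> cbox (-v) v \<Longrightarrow> u j x = 0"
    and F: "integrable lborel (\<lambda>z. of_real (schr_amp DIM('a) (fst z)) * F z)"
  shows "(\<Sum>j\<in>J. (norm (LBINT z. cnj (schr_ext (u j) (fst z) (snd z)) * F z))\<^sup>2) \<le>
      Re (LBINT p. cnj (F (fst p)) * F (snd p) * schr_gram v (fst (fst p)) (snd (fst p)) (fst (snd p)) (snd (snd p)))"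
proof -
  \<comment> \<open>The amplitude, unbounded near time 0, is moved to this function, so that the
    remaining kernel has modulus one as \<open>gram_fubini\<close> demands.\<close>
  define G where "G z = of_real (schr_amp DIM('a) (fst z)) * F z" for z
  have G: "integrable lborel G" using F by (simp add: G_def[abs_def])
  have [measurable]: "G \<in> borel_measurable borel" using G by (auto dest: borel_measurable_integrable)
  have [measurable]: "cbox (-v) v \<in> sets borel" by simp
  let ?a = "\<lambda>(y::'a) z. cis (- schr_phase (fst z) (snd z) y)"
  let ?w = "\<lambda>y. indicator (cbox (-v) v) y :: real"
  define \<Phi> where "\<Phi> y = (LBINT z. ?a y z * G z)" for y
  have [measurable]: "\<Phi> \<in> borel_measurable borel" unfolding \<Phi>_def by measurable
  have am: "(\<lambda>(y, z). ?a y z) \<in> borel_measurable (borel \<Otimes>\<^sub>M borel)" by measurable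
  have ab: "\<And>y z. norm (?a y z) \<le> 1" by simp
  note H = gram_fubini[where a="?a" and a'="?a", OF am am ab ab integrable_indicator_cbox[of v] G G]
  have sq: "?w y *\<^sub>R (cnj (\<Phi> y) * \<Phi> y) = of_real ((norm (indicator (cbox (-v) v) y * \<Phi> y))\<^sup>2)" for y
    by (subst mult.commute[of "cnj _"], subst complex_norm_square[symmetric]) (simp add: indicator_def)
  have i\<Phi>: "integrable lborel (\<lambda>y. (norm (indicator (cbox (-v) v) y * \<Phi> y))\<^sup>2)"
  proof -
    have "integrable lborel (\<lambda>y. complex_of_real ((norm (indicator (cbox (-v) v) y * \<Phi> y))\<^sup>2))"
      using H(2) unfolding \<Phi>_def[symmetric] sq .
    from integrable_Re[OF this] show ?thesis by (simp only: Re_complex_of_real)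
  qed
  have \<Phi>: "L2 (\<lambda>y. indicator (cbox (-v) v) y * \<Phi> y)" using i\<Phi> by (simp add: L2_def)
  have c: "(LBINT z. cnj (schr_ext (u j) (fst z) (snd z)) * F z) = L2_inner (u j) (\<lambda>y. indicator (cbox (-v) v) y * \<Phi> y)"
    if j: "j \<in> J" for j
  proof -
    have uj: "L2 (u j)" using b j by (simp add: bessel_system_def)
    have [measurable]: "u j \<in> borel_measurable borel" using uj by (rule L2_measurable)
    have ui: "integrable lborel (u j)" by (rule L2_cbox_integrable[OF uj supp[OF j]])
    have "(LBINT z. cnj (schr_ext (u j) (fst z) (snd z)) * F z) =
        (LBINT z. (LBINT y. cnj (u j y) * (?a y z * G z)))"
    proof (intro Bochner_Integration.integral_cong refl)
      fix z :: "real \<times> 'a"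
      have "(LBINT y. cnj (u j y) * (?a y z * G z)) = (LBINT y. cnj (cis (schr_phase (fst z) (snd z) y) * u j y) * G z)"
        by (intro Bochner_Integration.integral_cong refl) (simp add: cis_cnj mult_ac)
      also have "\<dots> = cnj (LBINT y. cis (schr_phase (fst z) (snd z) y) * u j y) * G z"
        by (simp only: integral_mult_left_zero Bochner_Integration.integral_cnj)
      finally have eq: "(LBINT y. cnj (u j y) * (?a y z * G z)) = cnj (LBINT y. cis (schr_phase (fst z) (snd z) y) * u j y) * G z" .
      have gen: "cnj (of_real A * L) * X = cnj L * (of_real A * X)" for A :: real and L X by (simp add: algebra_simps)
      show "cnj (schr_ext (u j) (fst z) (snd z)) * F z = (LBINT y. cnj (u j y) * (?a y z * G z))"
        unfolding eq schr_ext_def unfolding G_def by (rule gen)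
    qed
    also have "\<dots> = (LBINT y. (LBINT z. cnj (u j y) * (?a y z * G z)))"
    proof (rule lborel_pair.Fubini_integral)
      show "integrable (lborel \<Otimes>\<^sub>M lborel) (\<lambda>(y, z). cnj (u j y) * (?a y z * G z))"
      proof (rule Bochner_Integration.integrable_bound[OF integrable_lborel_pair_mult[OF integrable_bounded_linear[OF bounded_linear_cnj ui] G]])
        show "(\<lambda>(y, z). cnj (u j y) * (?a y z * G z)) \<in> borel_measurable (lborel \<Otimes>\<^sub>M lborel)"
          by measurable
      qed (auto simp: norm_mult)
    qed
    also have "\<dots> = (LBINT y. cnj (u j y) * (indicator (cbox (-v) v) y * \<Phi> y))"
    proof (intro Bochner_Integration.integral_cong refl)
      fix y
      have "(LBINT z. cnj (u j y) * (?a y z * G z)) = cnj (u j y) * \<Phi> y"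
        unfolding \<Phi>_def by (rule integral_mult_right_zero)
      \<comment> \<open>\<open>u j\<close> vanishes outside the cube, so the cutoff may be
        inserted.\<close>
      then show "(LBINT z. cnj (u j y) * (?a y z * G z)) = cnj (u j y) * (indicator (cbox (-v) v) y * \<Phi> y)"
        using supp[OF j, of y] by (cases "y \<in> cbox (-v) v") auto
    qed
    finally show ?thesis by (simp add: L2_inner_def)
  qed
  have "(\<Sum>j\<in>J. (norm (LBINT z. cnj (schr_ext (u j) (fst z) (snd z)) * F z))\<^sup>2) \<le> (LBINT y. (norm (indicator (cbox (-v) v) y * \<Phi> y))\<^sup>2)"
  proof -
    have "(\<Sum>j\<in>J. (norm (LBINT z. cnj (schr_ext (u j) (fst z) (snd z)) * F z))\<^sup>2) =
        (\<Sum>j\<in>J. (norm (L2_inner (u j) (\<lambda>y. indicator (cbox (-v) v) y * \<Phi> y)))\<^sup>2)"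
      by (rule sum.cong[OF refl]) (simp only: c)
    then show ?thesis using b \<Phi> by (simp only: bessel_system_def)
  qed
  also have "\<dots> = Re (LBINT y. ?w y *\<^sub>R (cnj (\<Phi> y) * \<Phi> y))"
    unfolding sq by (subst integral_of_real[OF i\<Phi>]) simp
  also have "(LBINT y. ?w y *\<^sub>R (cnj (\<Phi> y) * \<Phi> y)) =
      (LBINT p. cnj (G (fst p)) * G (snd p) * (LBINT y. ?w y *\<^sub>R (cnj (?a y (fst p)) * ?a y (snd p))))"
    unfolding \<Phi>_def by (rule H(1))
  also have "\<dots> = (LBINT p. cnj (F (fst p)) * F (snd p) * schr_gram v (fst (fst p)) (snd (fst p)) (fst (snd p)) (snd (snd p)))"
    by (intro Bochner_Integration.integral_cong refl) (simp add: schr_gram_def G_def cis_cnj cis_mult mult_ac)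
  finally show ?thesis .
qed

section \<open>An adapted kernel in the time variable\<close>

text \<open>The kernel \<open>1 / \<bar>t - t'\<bar>\<close> just fails to be bounded on \<open>L\<^sup>2\<close>. Damping it where \<open>\<bar>t - t'\<bar>\<close> is below both
  \<open>1 / H t\<close> and \<open>1 / H t'\<close> makes it bounded: where \<open>\<bar>t - t'\<bar> \<ge> 1 / H t'\<close> one has \<open>1 / \<bar>t - t'\<bar> \<le> H t'\<close>, whose
  integral is at most 1, so that no damping is needed there. The exponent is chosen so small that the loss
  \<open>(\<bar>t - t'\<bar> * time_ker d H t t') ^ (- d)\<close> stays integrable against \<open>H t * H t'\<close>.\<close>

definition time_ker :: "nat \<Rightarrow> (real \<Rightarrow> real) \<Rightarrow> real \<Rightarrow> real \<Rightarrow> real" where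
  "time_ker d H t t' = (if \<bar>t - t'\<bar> * H t < 1 \<and> \<bar>t - t'\<bar> * H t' < 1
     then (\<bar>t - t'\<bar> * H t * (\<bar>t - t'\<bar> * H t')) powr (1 / (4 * real d)) / \<bar>t - t'\<bar> else 1 / \<bar>t - t'\<bar>)"

lemma time_ker_nonneg: "0 \<le> time_ker d H t t'"
  by (simp add: time_ker_def)

lemma time_ker_pos: "t \<noteq> t' \<Longrightarrow> H t > 0 \<Longrightarrow> H t' > 0 \<Longrightarrow> 0 < time_ker d H t t'"
  by (simp add: time_ker_def)

lemma measurable_time_ker[measurable (raw)]:
  assumes [measurable]: "H \<in> borel_measurable borel" "f \<in> borel_measurable M" "g \<in> borel_measurable M"
  shows "(\<lambda>x. time_ker d H (f x) (g x)) \<in> borel_measurable M"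
  unfolding time_ker_def by measurable

section \<open>Schur's test in time\<close>

lemma nn_integral_abs_diff:
  fixes g :: "real \<Rightarrow> ennreal"
  assumes [measurable]: "g \<in> borel_measurable borel"
  shows "(\<integral>\<^sup>+ t'. g \<bar>t - t'\<bar> \<partial>lborel) = 2 * (\<integral>\<^sup>+ r. g r * indicator {0<..} r \<partial>lborel)"
proof -
  have "(\<integral>\<^sup>+ t'. g \<bar>t - t'\<bar> \<partial>lborel) = (\<integral>\<^sup>+ r. g \<bar>r\<bar> \<partial>lborel)"
    by (subst nn_integral_real_affine[of _ 1 t]) auto
  also have "\<dots> = (\<integral>\<^sup>+ r. g r * indicator {0<..} r + g (-r) * indicator {0<..} (-r) \<partial>lborel)"
    by (rule nn_integral_cong_AE, rule AE_mp[OF AE_lborel_singleton[of 0]]) (auto simp: indicator_def)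
  also have "\<dots> = (\<integral>\<^sup>+ r. g r * indicator {0<..} r \<partial>lborel) + (\<integral>\<^sup>+ r. g (-r) * indicator {0<..} (-r) \<partial>lborel)"
    by (rule nn_integral_add) auto
  also have "(\<integral>\<^sup>+ r. g (-r) * indicator {0<..} (-r) \<partial>lborel) = (\<integral>\<^sup>+ r. g r * indicator {0<..} r \<partial>lborel)"
    by (subst nn_integral_real_affine[of "\<lambda>r. g r * indicator {0<..} r" "-1" 0]) auto
  finally show ?thesis by (simp add: mult_2)
qed

lemma nn_integral_powr_0:
  fixes a c :: real
  assumes "a > -1" "c \<ge> 0"
  shows "(\<integral>\<^sup>+ r. ennreal (r powr a) * indicator {0..c} r \<partial>lborel) = ennreal (c powr (a+1) / (a+1))"
proof -
  have "(\<integral>\<^sup>+ r. ennreal (r powr a) * indicator {0..c} r \<partial>lborel) = (\<integral>\<^sup>+ r. ennreal (r powr a * indicator {0..c} r) \<partial>lborel)"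
    by (intro nn_integral_cong) (auto simp: indicator_def)
  also have "\<dots> = ennreal (c powr (a+1) / (a+1))"
  proof (rule nn_integral_has_integral_lborel)
    have "((\<lambda>x. if x \<in> {0..c} then x powr a else 0) has_integral (c powr (a+1) / (a+1))) UNIV"
      using has_integral_powr_from_0[OF assms] by (subst has_integral_restrict_UNIV)
    then show "((\<lambda>x. x powr a * indicator {0..c} x) has_integral (c powr (a+1) / (a+1))) UNIV"
      by (rule has_integral_eq[rotated]) (auto simp: indicator_def)
  qed auto
  finally show ?thesis .
qed

text \<open>One-sided weights for Schur's test. The first summand serves the damped region, the
  second the region where \<open>\<bar>t - t'\<bar> * H t' \<ge> 1\<close>, the third the one where
  \<open>\<bar>t - t'\<bar> * H t \<ge> 1\<close>. In each region \<open>time_ker\<close> is the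
  geometric mean of a summand of this weight and one of the weight with \<open>t\<close> and
  \<open>t'\<close> exchanged.\<close>

definition schur_weight :: "nat \<Rightarrow> (real \<Rightarrow> real) \<Rightarrow> real \<Rightarrow> real \<Rightarrow> real" where
  "schur_weight d H t t' =
     (if \<bar>t - t'\<bar> * H t < 1 then (\<bar>t - t'\<bar> * H t) powr (1 / (2 * real d)) / \<bar>t - t'\<bar> else 0) + H t' +
     (if \<bar>t - t'\<bar> * H t \<ge> 1 then 1 / (\<bar>t - t'\<bar>\<^sup>2 * H t) else 0)"

lemma measurable_schur_weight[measurable (raw)]:
  assumes [measurable]: "H \<in> borel_measurable borel" "f \<in> borel_measurable M" "g \<in> borel_measurable M"
  shows "(\<lambda>x. schur_weight d H (f x) (g x)) \<in> borel_measurable M"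
  unfolding schur_weight_def by measurable

lemma am_gm2: "x * y \<le> (x\<^sup>2 + y\<^sup>2) / 2" for x y :: real
  using sum_squares_bound[of x y] by simp

text \<open>The arithmetic-geometric mean, with the kernel shared out according to the region. In
  the damped region each variable keeps its own power. If
  \<open>\<bar>t - t'\<bar> * H t' \<ge> 1\<close>, the value \<open>H t'\<close> goes to the square
  belonging to \<open>t\<close>, so that it will be integrated in its own argument; the third case
  is symmetric.\<close>

lemma time_ker_le_schur_weight:
  fixes a b :: real
  assumes H: "H t > 0" "H t' > 0"
  shows "time_ker d H t t' * (a * b) \<le> (schur_weight d H t t' * a\<^sup>2 + schur_weight d H t' t * b\<^sup>2) / 2"
proof (cases "t = t'")
  case True
  \<comment> \<open>On the diagonal \<open>time_ker\<close> is 0, by division by zero.\<close>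
  then show ?thesis using H by (simp add: time_ker_def schur_weight_def)
next
  case False
  define R where "R = \<bar>t - t'\<bar>"
  have R: "R > 0" using False by (simp add: R_def)
  have R': "\<bar>t' - t\<bar> = R" by (simp add: R_def)
  have sw: "schur_weight d H t t' * a\<^sup>2 + schur_weight d H t' t * b\<^sup>2 \<ge> X"
    if "w \<le> schur_weight d H t t'" "w' \<le> schur_weight d H t' t" "X \<le> w * a\<^sup>2 + w' * b\<^sup>2" for w w' X
  proof -
    have "w * a\<^sup>2 \<le> schur_weight d H t t' * a\<^sup>2" "w' * b\<^sup>2 \<le> schur_weight d H t' t * b\<^sup>2"
      using that by (intro mult_right_mono; simp)+
    then show ?thesis using that(3) by linarith
  qed
  note unf = schur_weight_def[of d H t t', folded R_def] schur_weight_def[of d H t' t, unfolded R']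
  consider (a) "R * H t < 1" "R * H t' < 1" | (b) "R * H t' \<ge> 1" | (c) "R * H t \<ge> 1" by linarith
  then show ?thesis
  proof cases
    case a
    let ?x = "(R * H t) powr (1 / (4 * real d))" and ?y = "(R * H t') powr (1 / (4 * real d))"
    have k: "time_ker d H t t' = ?x * ?y / R"
      using a R H unfolding time_ker_def R_def[symmetric] by (simp add: powr_mult)
    have xx: "?x\<^sup>2 = (R * H t) powr (1 / (2 * real d))" "?y\<^sup>2 = (R * H t') powr (1 / (2 * real d))"
      by (simp_all add: power2_eq_square powr_add[symmetric])
    have "?x * ?y / R * (a * b) = (?x * a) * (?y * b) / R" by simp
    also have "\<dots> \<le> ((?x * a)\<^sup>2 + (?y * b)\<^sup>2) / 2 / R"
      using R by (intro divide_right_mono am_gm2) auto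
    also have "\<dots> = (((R * H t) powr (1 / (2 * real d)) / R) * a\<^sup>2 + ((R * H t') powr (1 / (2 * real d)) / R) * b\<^sup>2) / 2"
      by (simp add: power_mult_distrib xx add_divide_distrib)
    also have "\<dots> \<le> (schur_weight d H t t' * a\<^sup>2 + schur_weight d H t' t * b\<^sup>2) / 2"
      by (intro divide_right_mono sw[of "(R * H t) powr (1 / (2 * real d)) / R" "(R * H t') powr (1 / (2 * real d)) / R"])
        (use a H in \<open>auto simp: unf\<close>)
    finally show ?thesis by (simp add: k)
  next
    case b
    let ?s = "sqrt (H t')"
    have s: "?s > 0" "?s\<^sup>2 = H t'" using H by auto
    have k: "time_ker d H t t' = 1 / R" using b unfolding time_ker_def R_def[symmetric] by simp
    have "1 / R * (a * b) = (?s * a) * (b / (R * ?s))" using s R by (simp add: field_simps)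
    also have "\<dots> \<le> ((?s * a)\<^sup>2 + (b / (R * ?s))\<^sup>2) / 2" by (rule am_gm2)
    also have "\<dots> = (H t' * a\<^sup>2 + (1 / (R\<^sup>2 * H t')) * b\<^sup>2) / 2"
      by (simp add: power_mult_distrib power_divide s)
    also have "\<dots> \<le> (schur_weight d H t t' * a\<^sup>2 + schur_weight d H t' t * b\<^sup>2) / 2"
      by (intro divide_right_mono sw[of "H t'" "1 / (R\<^sup>2 * H t')"])
        (use b H R in \<open>auto simp: unf\<close>)
    finally show ?thesis by (simp add: k)
  next
    case c
    let ?s = "sqrt (H t)"
    have s: "?s > 0" "?s\<^sup>2 = H t" using H by auto
    have k: "time_ker d H t t' = 1 / R" using c unfolding time_ker_def R_def[symmetric] by simp
    have "1 / R * (a * b) = (a / (R * ?s)) * (?s * b)" using s R by (simp add: field_simps)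
    also have "\<dots> \<le> ((a / (R * ?s))\<^sup>2 + (?s * b)\<^sup>2) / 2" by (rule am_gm2)
    also have "\<dots> = ((1 / (R\<^sup>2 * H t)) * a\<^sup>2 + H t * b\<^sup>2) / 2"
      by (simp add: power_mult_distrib power_divide s)
    also have "\<dots> \<le> (schur_weight d H t t' * a\<^sup>2 + schur_weight d H t' t * b\<^sup>2) / 2"
      by (intro divide_right_mono sw[of "1 / (R\<^sup>2 * H t)" "H t"])
        (use c H R in \<open>auto simp: unf\<close>)
    finally show ?thesis by (simp add: k)
  qed
qed

text \<open>With h = \<open>H t\<close>, the first summand contributes 4d: the integral of
  h^\<epsilon> r^(\<epsilon>-1) over (0, 1/h) is 1/\<epsilon> = 2d, doubled for the two signs.
  \<open>H\<close> itself contributes 1 and the tail of 1/(r^2 h) beyond 1/h contributes 2. Without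
  damping, \<epsilon> = 0, the first integral would diverge.\<close>

lemma nn_integral_schur_weight:
  assumes [measurable]: "H \<in> borel_measurable borel" and H: "\<And>t. H t > 0"
    and H1: "(\<integral>\<^sup>+ t. ennreal (H t) \<partial>lborel) \<le> 1" and d: "d > 0"
  shows "(\<integral>\<^sup>+ t'. ennreal (schur_weight d H t t') \<partial>lborel) \<le> ennreal (4 * real d + 3)"
proof -
  define h where "h = H t"
  have h: "h > 0" using H by (simp add: h_def)
  let ?\<epsilon> = "1 / (2 * real d)"
  have \<epsilon>: "?\<epsilon> > 0" using d by simp
  define g1 where "g1 r = ennreal (if r * h < 1 then (r * h) powr ?\<epsilon> / r else 0)" for r
  define g2 where "g2 r = ennreal (if r * h \<ge> 1 then 1 / (r\<^sup>2 * h) else 0)" for r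
  have [measurable]: "g1 \<in> borel_measurable borel" "g2 \<in> borel_measurable borel"
    unfolding g1_def[abs_def] g2_def[abs_def] by measurable
  have "ennreal (schur_weight d H t t') = g1 \<bar>t - t'\<bar> + ennreal (H t') + g2 \<bar>t - t'\<bar>" for t'
    using h H[of t'] unfolding schur_weight_def g1_def g2_def h_def[symmetric]
    by (subst ennreal_plus[symmetric], simp, simp, subst ennreal_plus[symmetric]) auto
  then have "(\<integral>\<^sup>+ t'. ennreal (schur_weight d H t t') \<partial>lborel) =
      (\<integral>\<^sup>+ t'. g1 \<bar>t - t'\<bar> + ennreal (H t') + g2 \<bar>t - t'\<bar> \<partial>lborel)" by simp
  also have "\<dots> = (\<integral>\<^sup>+ t'. g1 \<bar>t - t'\<bar> \<partial>lborel) + (\<integral>\<^sup>+ t'. ennreal (H t') \<partial>lborel) + (\<integral>\<^sup>+ t'. g2 \<bar>t - t'\<bar> \<partial>lborel)"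
    by (subst nn_integral_add, measurable, subst nn_integral_add, measurable)
  also have "(\<integral>\<^sup>+ t'. g1 \<bar>t - t'\<bar> \<partial>lborel) \<le> ennreal (4 * real d)"
  proof -
    have "(\<integral>\<^sup>+ r. g1 r * indicator {0<..} r \<partial>lborel) \<le>
        (\<integral>\<^sup>+ r. ennreal (h powr ?\<epsilon>) * (ennreal (r powr (?\<epsilon> - 1)) * indicator {0..1/h} r) \<partial>lborel)"
    proof (rule nn_integral_mono)
      fix r :: real
      have "(r * h) powr ?\<epsilon> / r = h powr ?\<epsilon> * r powr (?\<epsilon> - 1)" if "r > 0"
        using that h by (simp add: powr_mult powr_diff)
      then show "g1 r * indicator {0<..} r \<le> ennreal (h powr ?\<epsilon>) * (ennreal (r powr (?\<epsilon> - 1)) * indicator {0..1/h} r)"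
        using h by (auto simp: g1_def indicator_def ennreal_mult[symmetric] field_simps)
    qed
    also have "\<dots> = ennreal (h powr ?\<epsilon>) * ennreal ((1/h) powr ?\<epsilon> / ?\<epsilon>)"
      using nn_integral_powr_0[of "?\<epsilon> - 1" "1/h"] h \<epsilon> by (subst nn_integral_cmult) auto
    also have "\<dots> = ennreal (2 * real d)"
      using h d by (simp add: ennreal_mult[symmetric] powr_divide)
    finally have "2 * (\<integral>\<^sup>+ r. g1 r * indicator {0<..} r \<partial>lborel) \<le> ennreal 2 * ennreal (2 * real d)"
      by (auto intro: mult_left_mono)
    also have "\<dots> = ennreal (4 * real d)" by (subst ennreal_mult[symmetric]) auto
    finally show ?thesis by (subst nn_integral_abs_diff) auto
  qed
  also have "(\<integral>\<^sup>+ t'. g2 \<bar>t - t'\<bar> \<partial>lborel) \<le> ennreal 2"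
  proof -
    have "(\<integral>\<^sup>+ r. g2 r * indicator {0<..} r \<partial>lborel) \<le> (\<integral>\<^sup>+ r. ennreal (1 / (r\<^sup>2 * h)) * indicator {1/h..} r \<partial>lborel)"
      using h by (intro nn_integral_mono) (auto simp: g2_def indicator_def field_simps)
    also have "\<dots> = ennreal (0 - (- 1 / (1 / h * h)))"
    proof (rule nn_integral_FTC_atLeast)
      fix r assume "1 / h \<le> r"
      moreover have "1 / h > 0" using h by simp
      ultimately have r: "r > 0" by linarith
      then show "((\<lambda>r. - 1 / (r * h)) has_real_derivative 1 / (r\<^sup>2 * h)) (at r)"
        using h by (auto intro!: derivative_eq_intros simp: field_simps power2_eq_square)
      show "0 \<le> 1 / (r\<^sup>2 * h)" using h by simp
    next
      show "((\<lambda>r. - 1 / (r * h)) \<longlongrightarrow> 0) at_top" using h by real_asymp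
    qed measurable
    also have "\<dots> = 1" using h by simp
    finally show ?thesis by (subst nn_integral_abs_diff) (auto intro: order_trans[OF mult_left_mono])
  qed
  finally have "(\<integral>\<^sup>+ t'. ennreal (schur_weight d H t t') \<partial>lborel) \<le> ennreal (4 * real d) + 1 + ennreal 2"
    using H1 by (auto intro: order_trans add_mono)
  also have "\<dots> = ennreal (4 * real d + 3)"
    by (simp only: ennreal_1[symmetric], subst ennreal_plus[symmetric], simp, simp, subst ennreal_plus[symmetric], auto)
  finally show ?thesis .
qed

lemma nn_integral2_add:
  fixes f g :: "real \<Rightarrow> real \<Rightarrow> ennreal"
  assumes [measurable]: "(\<lambda>(x, y). f x y) \<in> borel_measurable (borel \<Otimes>\<^sub>M borel)" "(\<lambda>(x, y). g x y) \<in> borel_measurable (borel \<Otimes>\<^sub>M borel)"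
  shows "(\<integral>\<^sup>+ t. \<integral>\<^sup>+ t'. f t t' + g t t' \<partial>lborel \<partial>lborel) =
     (\<integral>\<^sup>+ t. \<integral>\<^sup>+ t'. f t t' \<partial>lborel \<partial>lborel) + (\<integral>\<^sup>+ t. \<integral>\<^sup>+ t'. g t t' \<partial>lborel \<partial>lborel)"
proof -
  have "(\<integral>\<^sup>+ t'. f t t' + g t t' \<partial>lborel) = (\<integral>\<^sup>+ t'. f t t' \<partial>lborel) + (\<integral>\<^sup>+ t'. g t t' \<partial>lborel)" for t
    by (rule nn_integral_add) measurable
  then show ?thesis by (simp only:) (rule nn_integral_add, measurable)
qed

text \<open>The pointwise inequality is integrated; its two halves coincide after exchanging
  \<open>t\<close> and \<open>t'\<close>.\<close>

lemma time_ker_form_bound: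
  fixes f :: "real \<Rightarrow> real"
  assumes [measurable]: "H \<in> borel_measurable borel" "f \<in> borel_measurable borel" and H: "\<And>t. H t > 0"
    and H1: "(\<integral>\<^sup>+ t. ennreal (H t) \<partial>lborel) \<le> 1" and d: "d > 0"
  shows "(\<integral>\<^sup>+ t. \<integral>\<^sup>+ t'. ennreal (time_ker d H t t' * (f t * f t')) \<partial>lborel \<partial>lborel)
     \<le> ennreal (4 * real d + 3) * (\<integral>\<^sup>+ t. ennreal ((f t)\<^sup>2) \<partial>lborel)"
proof -
  let ?g = "\<lambda>t t'. ennreal (1/2) * (ennreal ((f t)\<^sup>2) * ennreal (schur_weight d H t t'))"
  let ?C = "ennreal (4 * real d + 3) * (\<integral>\<^sup>+ t. ennreal ((f t)\<^sup>2) \<partial>lborel)"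
  have sw0: "0 \<le> schur_weight d H t t'" for t t' using H[of t] H[of t'] by (simp add: schur_weight_def)
  have g: "(\<integral>\<^sup>+ t. \<integral>\<^sup>+ t'. ?g t t' \<partial>lborel \<partial>lborel) \<le> ennreal (1/2) * ?C"
  proof -
    have "(\<integral>\<^sup>+ t. \<integral>\<^sup>+ t'. ?g t t' \<partial>lborel \<partial>lborel) = (\<integral>\<^sup>+ t. ennreal (1/2) * (ennreal ((f t)\<^sup>2) * (\<integral>\<^sup>+ t'. ennreal (schur_weight d H t t') \<partial>lborel)) \<partial>lborel)"
      by (intro nn_integral_cong) (subst nn_integral_cmult, measurable, subst nn_integral_cmult, auto)
    also have "\<dots> \<le> (\<integral>\<^sup>+ t. ennreal (1/2) * (ennreal ((f t)\<^sup>2) * ennreal (4 * real d + 3)) \<partial>lborel)"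
      by (intro nn_integral_mono mult_left_mono nn_integral_schur_weight assms) auto
    also have "\<dots> = ennreal (1/2) * ?C"
      by (subst nn_integral_cmult, measurable, subst nn_integral_multc, auto simp: mult.commute)
    finally show ?thesis .
  qed
  have "(\<integral>\<^sup>+ t. \<integral>\<^sup>+ t'. ennreal (time_ker d H t t' * (f t * f t')) \<partial>lborel \<partial>lborel) \<le>
    (\<integral>\<^sup>+ t. \<integral>\<^sup>+ t'. ?g t t' + ?g t' t \<partial>lborel \<partial>lborel)"
  proof (intro nn_integral_mono)
    fix t t'
    have "time_ker d H t t' * (f t * f t') \<le> 1/2 * ((f t)\<^sup>2 * schur_weight d H t t') + 1/2 * ((f t')\<^sup>2 * schur_weight d H t' t)"
      using time_ker_le_schur_weight[where H=H and t=t and t'=t' and d=d and a="f t" and b="f t'", OF H H] by (simp add: mult.commute)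
    then have "ennreal (time_ker d H t t' * (f t * f t')) \<le> ennreal (1/2 * ((f t)\<^sup>2 * schur_weight d H t t') + 1/2 * ((f t')\<^sup>2 * schur_weight d H t' t))"
      by (rule ennreal_leI)
    also have "\<dots> = ?g t t' + ?g t' t"
      using sw0 by (subst ennreal_plus) (simp_all only: ennreal_mult zero_le_power2 mult_nonneg_nonneg zero_le_divide_1_iff zero_le_numeral)
    finally show "ennreal (time_ker d H t t' * (f t * f t')) \<le> ?g t t' + ?g t' t" .
  qed
  also have "\<dots> = (\<integral>\<^sup>+ t. \<integral>\<^sup>+ t'. ?g t t' \<partial>lborel \<partial>lborel) + (\<integral>\<^sup>+ t. \<integral>\<^sup>+ t'. ?g t' t \<partial>lborel \<partial>lborel)"
    by (rule nn_integral2_add) measurable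
  also have "(\<integral>\<^sup>+ t. \<integral>\<^sup>+ t'. ?g t' t \<partial>lborel \<partial>lborel) = (\<integral>\<^sup>+ t. \<integral>\<^sup>+ t'. ?g t t' \<partial>lborel \<partial>lborel)"
    by (rule lborel_pair.Fubini') measurable
  also have "(\<integral>\<^sup>+ t. \<integral>\<^sup>+ t'. ?g t t' \<partial>lborel \<partial>lborel) + (\<integral>\<^sup>+ t. \<integral>\<^sup>+ t'. ?g t t' \<partial>lborel \<partial>lborel) \<le> ennreal (1/2) * ?C + ennreal (1/2) * ?C"
    by (intro add_mono g)
  also have "\<dots> = ?C"
    by (subst distrib_right[symmetric], subst ennreal_plus[symmetric]) auto
  finally show ?thesis .
qed

section \<open>The cost of the damping\<close>

text \<open>Off the damped region \<open>R * time_ker d H t t'\<close> is 1. Inside, its d-th power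
  is (R H t R H t')^(1/4), which is the origin of the exponent 1/(4d). What remains is R^(-1/2)
  times both densities to the power 3/4, at most the larger one to the power 3/2, and R^(-1/2) is
  integrable at 0.\<close>

lemma time_ker_cost_pointwise:
  assumes H: "H t > 0" "H t' > 0" and d: "d > 0" and ne: "t \<noteq> t'"
  defines "R \<equiv> \<bar>t - t'\<bar>"
  shows "H t * H t' * (1 / (R * time_ker d H t t')) ^ d \<le> H t * H t' +
     (if R * H t < 1 then H t powr (3/2) * R powr (-1/2) else 0) + (if R * H t' < 1 then H t' powr (3/2) * R powr (-1/2) else 0)"
proof (cases "R * H t < 1 \<and> R * H t' < 1")
  case False
  have "R > 0" using ne by (simp add: R_def)
  with False show ?thesis by (auto simp: time_ker_def R_def[symmetric])
next
  case True
  have R: "R > 0" using ne by (simp add: R_def)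
  have "R * time_ker d H t t' = (R * H t * (R * H t')) powr (1 / (4 * real d))"
    using True R by (simp add: time_ker_def R_def[symmetric])
  then have "(1 / (R * time_ker d H t t')) ^ d = (1 / (R * H t * (R * H t')) powr (1 / (4 * real d))) powr real d"
    using R H by (subst powr_realpow) auto
  also have "\<dots> = (R * H t * (R * H t')) powr (-1/4)"
    using d R H by (simp add: powr_divide powr_powr powr_minus_divide)
  also have "\<dots> = R powr (-1/2) * (H t powr (-1/4) * H t' powr (-1/4))"
    using R H by (simp add: powr_mult powr_add[symmetric])
  finally have "H t * H t' * (1 / (R * time_ker d H t t')) ^ d = R powr (-1/2) * ((H t powr 1 * H t powr (-1/4)) * (H t' powr 1 * H t' powr (-1/4)))"
    using H by simp
  also have "\<dots> = R powr (-1/2) * (H t powr (3/4) * H t' powr (3/4))"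
    by (simp only: powr_add[symmetric]) simp
  also have "\<dots> \<le> R powr (-1/2) * (max (H t) (H t') powr (3/4) * max (H t) (H t') powr (3/4))"
    using H by (intro mult_left_mono mult_mono powr_mono2) auto
  also have "\<dots> = R powr (-1/2) * (max (H t) (H t') powr (3/2))" by (simp add: powr_add[symmetric])
  also have "\<dots> \<le> H t powr (3/2) * R powr (-1/2) + H t' powr (3/2) * R powr (-1/2)"
    by (cases "H t \<le> H t'") (auto simp: max_def)
  also have "\<dots> \<le> H t * H t' + H t powr (3/2) * R powr (-1/2) + H t' powr (3/2) * R powr (-1/2)"
    using H by simp
  finally show ?thesis using True by simp
qed

text \<open>The product of the densities contributes 1 and each singular term 4: the integral of
  h^(3/2) R^(-1/2) over R < 1/h is 2h, doubled for the two signs. Being linear in h, it is paid for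
  by the mass of \<open>H\<close>.\<close>

lemma time_ker_cost:
  assumes [measurable]: "H \<in> borel_measurable borel" and H: "\<And>t. H t > 0"
    and H1: "(\<integral>\<^sup>+ t. ennreal (H t) \<partial>lborel) \<le> 1" and d: "d > 0"
  shows "(\<integral>\<^sup>+ t. \<integral>\<^sup>+ t'. ennreal (H t * H t' * (1 / (\<bar>t - t'\<bar> * time_ker d H t t')) ^ d) \<partial>lborel \<partial>lborel) \<le> 9"
proof -
  let ?n = "\<lambda>t t'. ennreal (if \<bar>t - t'\<bar> * H t < 1 then H t powr (3/2) * \<bar>t - t'\<bar> powr (-1/2) else 0)"
  have n: "(\<integral>\<^sup>+ t'. ?n t t' \<partial>lborel) \<le> 4 * ennreal (H t)" for t
  proof -
    define h where "h = H t"
    have h: "h > 0" using H by (simp add: h_def)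
    define g where "g r = ennreal (if r * h < 1 then h powr (3/2) * r powr (-1/2) else 0)" for r
    have [measurable]: "g \<in> borel_measurable borel" unfolding g_def[abs_def] by measurable
    have "(\<integral>\<^sup>+ r. g r * indicator {0<..} r \<partial>lborel) \<le> (\<integral>\<^sup>+ r. ennreal (h powr (3/2)) * (ennreal (r powr (-1/2)) * indicator {0..1/h} r) \<partial>lborel)"
      using h by (intro nn_integral_mono) (auto simp: g_def indicator_def ennreal_mult[symmetric] field_simps)
    also have "\<dots> = ennreal (h powr (3/2)) * ennreal ((1/h) powr (1/2) / (1/2))"
      using nn_integral_powr_0[of "-1/2" "1/h"] h by (subst nn_integral_cmult) auto
    also have "\<dots> = ennreal (2 * h)"
    proof -
      have "h powr (3/2) = h * h powr (1/2)" using h powr_add[of h 1 "1/2"] by simp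
      then show ?thesis using h by (simp add: ennreal_mult[symmetric] powr_divide)
    qed
    finally have le: "(\<integral>\<^sup>+ r. g r * indicator {0<..} r \<partial>lborel) \<le> ennreal (2 * h)" .
    have "(\<integral>\<^sup>+ t'. ?n t t' \<partial>lborel) = 2 * (\<integral>\<^sup>+ r. g r * indicator {0<..} r \<partial>lborel)"
      using nn_integral_abs_diff[of g t] unfolding g_def h_def by measurable
    also have "\<dots> \<le> 2 * ennreal (2 * h)" by (intro mult_left_mono le) simp
    also have "\<dots> = 4 * ennreal h" by (simp add: ennreal_mult' mult.assoc[symmetric])
    finally show ?thesis by (simp add: h_def)
  qed
  have "(\<integral>\<^sup>+ t. \<integral>\<^sup>+ t'. ennreal (H t * H t' * (1 / (\<bar>t - t'\<bar> * time_ker d H t t')) ^ d) \<partial>lborel \<partial>lborel) \<le>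
     (\<integral>\<^sup>+ t. \<integral>\<^sup>+ t'. ennreal (H t) * ennreal (H t') + ?n t t' + ?n t' t \<partial>lborel \<partial>lborel)"
  proof (rule nn_integral_mono, rule nn_integral_mono_AE, rule AE_mp[OF AE_lborel_singleton], intro AE_I2 impI)
    fix t t' :: real assume "t' \<noteq> t"
    then have "ennreal (H t * H t' * (1 / (\<bar>t - t'\<bar> * time_ker d H t t')) ^ d) \<le>
       ennreal (H t * H t' + (if \<bar>t - t'\<bar> * H t < 1 then H t powr (3/2) * \<bar>t - t'\<bar> powr (-1/2) else 0) +
       (if \<bar>t - t'\<bar> * H t' < 1 then H t' powr (3/2) * \<bar>t - t'\<bar> powr (-1/2) else 0))"
      by (intro ennreal_leI time_ker_cost_pointwise H d) auto
    also have "\<dots> = ennreal (H t) * ennreal (H t') + ?n t t' + ?n t' t"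
      using H[of t] H[of t'] by (subst ennreal_plus; (subst ennreal_plus)?; simp add: ennreal_mult abs_minus_commute)
    finally show "ennreal (H t * H t' * (1 / (\<bar>t - t'\<bar> * time_ker d H t t')) ^ d) \<le> ennreal (H t) * ennreal (H t') + ?n t t' + ?n t' t" .
  qed
  also have "\<dots> = (\<integral>\<^sup>+ t. \<integral>\<^sup>+ t'. ennreal (H t) * ennreal (H t') \<partial>lborel \<partial>lborel) + (\<integral>\<^sup>+ t. \<integral>\<^sup>+ t'. ?n t t' \<partial>lborel \<partial>lborel)
       + (\<integral>\<^sup>+ t. \<integral>\<^sup>+ t'. ?n t' t \<partial>lborel \<partial>lborel)"
    by (subst nn_integral2_add, measurable, subst nn_integral2_add, measurable)
  also have "(\<integral>\<^sup>+ t. \<integral>\<^sup>+ t'. ?n t' t \<partial>lborel \<partial>lborel) = (\<integral>\<^sup>+ t. \<integral>\<^sup>+ t'. ?n t t' \<partial>lborel \<partial>lborel)"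
    by (rule lborel_pair.Fubini') measurable
  also have "(\<integral>\<^sup>+ t. \<integral>\<^sup>+ t'. ?n t t' \<partial>lborel \<partial>lborel) \<le> 4"
  proof -
    have "(\<integral>\<^sup>+ t. \<integral>\<^sup>+ t'. ?n t t' \<partial>lborel \<partial>lborel) \<le> (\<integral>\<^sup>+ t. 4 * ennreal (H t) \<partial>lborel)"
      by (intro nn_integral_mono n)
    also have "\<dots> = 4 * (\<integral>\<^sup>+ t. ennreal (H t) \<partial>lborel)" by (rule nn_integral_cmult) measurable
    also have "\<dots> \<le> 4 * 1" by (intro mult_left_mono H1) simp
    finally show ?thesis by simp
  qed
  also have "(\<integral>\<^sup>+ t. \<integral>\<^sup>+ t'. ennreal (H t) * ennreal (H t') \<partial>lborel \<partial>lborel) \<le> 1"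
  proof -
    have "(\<integral>\<^sup>+ t. \<integral>\<^sup>+ t'. ennreal (H t) * ennreal (H t') \<partial>lborel \<partial>lborel) = (\<integral>\<^sup>+ t. ennreal (H t) \<partial>lborel) * (\<integral>\<^sup>+ t. ennreal (H t) \<partial>lborel)"
      by (subst nn_integral_cmult, measurable, subst nn_integral_multc, auto)
    also have "\<dots> \<le> 1 * 1" by (intro mult_mono H1) auto
    finally show ?thesis by simp
  qed
  finally show ?thesis by (auto intro: order_trans add_mono)
qed

section \<open>The Schatten-type estimate\<close>

lemma integrable_bounded_support:
  fixes f :: "'b::euclidean_space \<Rightarrow> 'c::{banach,second_countable_topology}"
  assumes [measurable]: "f \<in> borel_measurable borel" and A: "bounded A"
    and B: "\<And>x. x \<in> A \<Longrightarrow> norm (f x) \<le> B" and out: "\<And>x. x \<notin> A \<Longrightarrow> f x = 0"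
  shows "integrable lborel f"
proof -
  obtain a where a: "A \<subseteq> cbox (-a) a" using bounded_subset_cbox_symmetric[OF A] by blast
  show ?thesis
  proof (rule Bochner_Integration.integrable_bound)
    show "integrable lborel (\<lambda>x. \<bar>B\<bar> * indicator (cbox (-a) a) x)"
      by (intro integrable_mult_right integrable_indicator_cbox)
    show "AE x in lborel. norm (f x) \<le> norm (\<bar>B\<bar> * indicator (cbox (-a) a) x)"
    proof (rule AE_I2)
      fix x show "norm (f x) \<le> norm (\<bar>B\<bar> * indicator (cbox (-a) a) x)"
        using B[of x] out[of x] a by (cases "x \<in> A") (auto simp: indicator_def)
    qed
  qed auto
qed

text \<open>A pair of times and a pair of positions become a pair of space-time points; through this
  map the form can be treated in the positions with both times frozen.\<close>

definition regroup :: "(real \<times> real) \<times> ('a \<times> 'a) \<Rightarrow> (real \<times> 'a) \<times> (real \<times> 'a)" where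
  "regroup q = ((fst (fst q), fst (snd q)), (snd (fst q), snd (snd q)))"

lemma measurable_regroup[measurable]: "regroup \<in> borel \<rightarrow>\<^sub>M (borel :: ((real \<times> 'a::euclidean_space) \<times> (real \<times> 'a)) measure)"
  unfolding regroup_def[abs_def] by (intro borel_measurable_continuous_onI continuous_intros)

lemma nn_integral_regroup:
  fixes f :: "(real \<times> 'a::euclidean_space) \<times> (real \<times> 'a) \<Rightarrow> ennreal"
  assumes [measurable]: "f \<in> borel_measurable borel"
  shows "(\<integral>\<^sup>+ q. f (regroup q) \<partial>lborel) = (\<integral>\<^sup>+ p. f p \<partial>lborel)"
proof -
  have fm: "f \<in> borel_measurable (borel \<Otimes>\<^sub>M borel)" by (simp add: borel_prod)
  have fm2: "(\<lambda>(t, x, t', x'). f ((t, x), (t', x'))) \<in> borel_measurable (borel \<Otimes>\<^sub>M borel \<Otimes>\<^sub>M borel \<Otimes>\<^sub>M borel)"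
    using assms by (simp add: borel_prod case_prod_unfold) measurable
  have [measurable]: "(\<lambda>(t, x, t', x'). f ((t, x), (t', x'))) \<in> borel_measurable (lborel \<Otimes>\<^sub>M lborel \<Otimes>\<^sub>M lborel \<Otimes>\<^sub>M lborel)"
    using fm2 by (simp cong: measurable_cong_sets sets_pair_measure_cong)
  have "(\<integral>\<^sup>+ p. f p \<partial>lborel) = (\<integral>\<^sup>+ z. \<integral>\<^sup>+ z'. f (z, z') \<partial>lborel \<partial>lborel)"
    by (subst nn_integral_lborel_pair) auto
  also have "\<dots> = (\<integral>\<^sup>+ z. \<integral>\<^sup>+ t'. \<integral>\<^sup>+ x'. f (z, (t', x')) \<partial>lborel \<partial>lborel \<partial>lborel)"
    by (intro nn_integral_cong, subst nn_integral_lborel_pair) auto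
  also have "\<dots> = (\<integral>\<^sup>+ t. \<integral>\<^sup>+ x. \<integral>\<^sup>+ t'. \<integral>\<^sup>+ x'. f ((t, x), (t', x')) \<partial>lborel \<partial>lborel \<partial>lborel \<partial>lborel)"
    by (subst nn_integral_lborel_pair) auto
  also have "\<dots> = (\<integral>\<^sup>+ t. \<integral>\<^sup>+ t'. \<integral>\<^sup>+ x. \<integral>\<^sup>+ x'. f ((t, x), (t', x')) \<partial>lborel \<partial>lborel \<partial>lborel \<partial>lborel)"
    by (intro nn_integral_cong lborel_pair.Fubini') measurable
  also have "\<dots> = (\<integral>\<^sup>+ t. \<integral>\<^sup>+ t'. \<integral>\<^sup>+ w. f ((t, fst w), (t', snd w)) \<partial>lborel \<partial>lborel \<partial>lborel)"
    by (intro nn_integral_cong, subst nn_integral_lborel_pair) auto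
  also have "\<dots> = (\<integral>\<^sup>+ s. \<integral>\<^sup>+ w. f ((fst s, fst w), (snd s, snd w)) \<partial>lborel \<partial>lborel)"
    by (subst nn_integral_lborel_pair) auto
  also have "\<dots> = (\<integral>\<^sup>+ q. f (regroup q) \<partial>lborel)"
    unfolding regroup_def
    by (subst nn_integral_lborel_pair) auto
  finally show ?thesis ..
qed

lemma distr_regroup: "distr lborel borel (regroup :: _ \<Rightarrow> (real \<times> 'a::euclidean_space) \<times> (real \<times> 'a)) = lborel"
proof (rule measure_eqI)
  fix A :: "((real \<times> 'a) \<times> (real \<times> 'a)) set"
  assume "A \<in> sets (distr lborel borel regroup)"
  then have A[measurable]: "A \<in> sets borel" by simp
  have "emeasure (distr lborel borel regroup) A = (\<integral>\<^sup>+ p. indicator A p \<partial>distr lborel borel regroup)" by simp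
  also have "\<dots> = (\<integral>\<^sup>+ q. indicator A (regroup q) \<partial>lborel)" by (subst nn_integral_distr) auto
  also have "\<dots> = (\<integral>\<^sup>+ p. indicator A p \<partial>lborel)" by (rule nn_integral_regroup) auto
  finally show "emeasure (distr lborel borel regroup) A = emeasure lborel A" by simp
qed simp

text \<open>Absolute values are taken only after integrating in the positions, where cancellation is
  needed; in the times size alone will suffice.\<close>

lemma integral_regroup_norm_le:
  fixes h :: "(real \<times> 'a::euclidean_space) \<times> (real \<times> 'a) \<Rightarrow> complex"
  assumes h: "integrable lborel h"
  shows "ennreal (norm (LBINT p. h p)) \<le>
     (\<integral>\<^sup>+ t. \<integral>\<^sup>+ t'. ennreal (norm (LBINT w. h ((t, fst w), (t', snd w)))) \<partial>lborel \<partial>lborel)"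
proof -
  have hm[measurable]: "h \<in> borel_measurable borel" using h by (auto dest: borel_measurable_integrable)
  have i: "integrable lborel (\<lambda>q. h (regroup q))"
    using h by (subst (asm) distr_regroup[symmetric], subst (asm) integrable_distr_eq) auto
  then have i': "integrable (lborel \<Otimes>\<^sub>M lborel) (\<lambda>q. h (regroup q))" by (simp add: lborel_prod)
  have "(LBINT p. h p) = (LBINT q. h (regroup q))"
    by (subst distr_regroup[symmetric], subst integral_distr) auto
  also have "\<dots> = (LBINT s. LBINT w. h (regroup (s, w)))"
    using lborel_pair.integral_fst'[OF i'] by (simp add: lborel_prod)
  finally have "ennreal (norm (LBINT p. h p)) \<le> (\<integral>\<^sup>+ s. ennreal (norm (LBINT w. h (regroup (s, w)))) \<partial>lborel)"
    using integral_norm_bound_ennreal[OF lborel_pair.integrable_fst'[OF i']] by simp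
  also have "\<dots> = (\<integral>\<^sup>+ t. \<integral>\<^sup>+ t'. ennreal (norm (LBINT w. h (regroup ((t, t'), w)))) \<partial>lborel \<partial>lborel)"
  proof (subst lborel_prod[symmetric, where 'a=real and 'b=real], subst lborel.nn_integral_fst[symmetric])
    have "(\<lambda>s. LBINT w. h (regroup (s, w))) \<in> borel_measurable borel"
      by (rule measurable_integral_lborel) (simp add: borel_prod case_prod_unfold)
    then have "(\<lambda>s. LBINT w. h (regroup (s, w))) \<in> borel_measurable (lborel \<Otimes>\<^sub>M lborel)"
      by (simp add: lborel_prod)
    then show "(\<lambda>s. ennreal (norm (LBINT w. h (regroup (s, w))))) \<in> borel_measurable (lborel \<Otimes>\<^sub>M lborel)"
      by measurable
  qed simp
  finally show ?thesis by (simp add: regroup_def)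
qed

text \<open>Once the largest exponent \<open>b\<close> is removed, the others are at most
  \<open>b - 1\<close>, so by induction they add up to at most \<open>2 powi b\<close>, as much as
  the term removed.\<close>

lemma sum_dyadic_le_Max:
  fixes A :: "int set"
  assumes "finite A" "\<And>b. b \<in> A \<Longrightarrow> b \<le> m"
  shows "(\<Sum>b\<in>A. 2 powi b :: real) \<le> 2 * 2 powi m"
  using assms
proof (induction A arbitrary: m rule: finite_linorder_max_induct)
  case empty then show ?case by simp
next
  case (insert b A)
  have "(\<Sum>b\<in>A. 2 powi b :: real) \<le> 2 * 2 powi (b - 1)" using insert by (intro insert.IH) auto
  also have "\<dots> = 2 powi b" by (simp add: power_int_diff)
  finally have "(\<Sum>b\<in>insert b A. 2 powi b :: real) \<le> 2 * 2 powi b" using insert by auto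
  also have "\<dots> \<le> 2 * 2 powi m" using insert.prems by (intro mult_left_mono power_int_increasing) auto
  finally show ?case .
qed

lemma sum_dyadic_le:
  fixes I :: "int set" and y :: real
  assumes "finite I" "y \<ge> 0"
  shows "(\<Sum>b\<in>I. if 2 powi b \<le> y then 2 powi b else 0) \<le> 2 * y"
proof -
  let ?A = "{b \<in> I. 2 powi b \<le> y}"
  have "(\<Sum>b\<in>I. if 2 powi b \<le> y then 2 powi b else 0) = (\<Sum>b\<in>?A. 2 powi b)"
    using assms by (intro sum.mono_neutral_cong_right) auto
  also have "\<dots> \<le> 2 * y"
  proof (cases "?A = {}")
    case True show ?thesis unfolding True using assms by simp
  next
    case False
    have f: "finite ?A" using assms by simp
    have "(\<Sum>b\<in>?A. 2 powi b :: real) \<le> 2 * 2 powi (Max ?A)" by (rule sum_dyadic_le_Max[OF f]) (use f in auto)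
    moreover have "Max ?A \<in> ?A" by (rule Max_in[OF f False])
    ultimately show ?thesis by (auto intro: order_trans)
  qed
  finally show ?thesis .
qed

text \<open>Schur's test for the truncated matrix \<open>2\<^sup>a 2\<^sup>b\<close>, \<open>2\<^sup>a\<^sup>+\<^sup>b \<le> \<mu>\<close> (the mechanism behind Cwikel's estimate).\<close>

lemma dyadic_schur:
  fixes I :: "int set" and G G' :: "int \<Rightarrow> real" and \<mu> :: real
  assumes I: "finite I" and \<mu>: "\<mu> \<ge> 0" and G: "\<And>a. G a \<ge> 0" "\<And>a. G' a \<ge> 0"
  shows "(\<Sum>a\<in>I. \<Sum>b\<in>I. (if 2 powi a * 2 powi b \<le> \<mu> then 2 powi a * 2 powi b else 0) * (G a * G' b))
     \<le> 2 * \<mu> * (sqrt (\<Sum>a\<in>I. (G a)\<^sup>2) * sqrt (\<Sum>b\<in>I. (G' b)\<^sup>2))"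
proof -
  define w where "w a b = (if 2 powi a * 2 powi b \<le> \<mu> then 2 powi a * 2 powi b else 0 :: real)" for a b :: int
  have w0: "w a b \<ge> 0" for a b by (simp add: w_def)
  have row: "(\<Sum>b\<in>I. w a b) \<le> 2 * \<mu>" for a
  proof -
    have p: "(2::real) powi a > 0" by simp
    have "w a b = 2 powi a * (if 2 powi b \<le> \<mu> / 2 powi a then 2 powi b else 0)" for b
      using p by (simp add: w_def field_simps)
    then have "(\<Sum>b\<in>I. w a b) = 2 powi a * (\<Sum>b\<in>I. if 2 powi b \<le> \<mu> / 2 powi a then 2 powi b else 0)"
      by (simp add: sum_distrib_left)
    also have "\<dots> \<le> 2 powi a * (2 * (\<mu> / 2 powi a))"
      using \<mu> p by (intro mult_left_mono sum_dyadic_le I) auto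
    finally show ?thesis by simp
  qed
  have sym: "w a b = w b a" for a b by (simp add: w_def mult.commute)
  let ?P = "I \<times> I"
  have split: "w a b * (G a * G' b) = (sqrt (w a b) * G a) * (sqrt (w a b) * G' b)" for a b
  proof -
    have "(sqrt (w a b) * G a) * (sqrt (w a b) * G' b) = (sqrt (w a b) * sqrt (w a b)) * (G a * G' b)" by (simp only: mult_ac)
    then show ?thesis by (simp add: w0)
  qed
  have "(\<Sum>a\<in>I. \<Sum>b\<in>I. w a b * (G a * G' b)) = (\<Sum>p\<in>?P. (sqrt (w (fst p) (snd p)) * G (fst p)) * (sqrt (w (fst p) (snd p)) * G' (snd p)))"
    unfolding sum.cartesian_product by (intro sum.cong refl) (auto simp: split)
  also have "\<dots> \<le> sqrt ((\<Sum>p\<in>?P. (sqrt (w (fst p) (snd p)) * G (fst p))\<^sup>2) * (\<Sum>p\<in>?P. (sqrt (w (fst p) (snd p)) * G' (snd p))\<^sup>2))"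
    by (intro real_le_rsqrt Cauchy_Schwarz_ineq_sum)
  also have "\<dots> \<le> sqrt ((2 * \<mu> * (\<Sum>a\<in>I. (G a)\<^sup>2)) * (2 * \<mu> * (\<Sum>b\<in>I. (G' b)\<^sup>2)))"
  proof (intro real_sqrt_le_mono mult_mono)
    have "(\<Sum>p\<in>?P. (sqrt (w (fst p) (snd p)) * G (fst p))\<^sup>2) = (\<Sum>a\<in>I. (\<Sum>b\<in>I. w a b) * (G a)\<^sup>2)"
      by (simp add: sum.cartesian_product' power_mult_distrib w0 sum_distrib_right)
    also have "\<dots> \<le> (\<Sum>a\<in>I. 2 * \<mu> * (G a)\<^sup>2)" by (intro sum_mono mult_right_mono row) auto
    finally show "(\<Sum>p\<in>?P. (sqrt (w (fst p) (snd p)) * G (fst p))\<^sup>2) \<le> 2 * \<mu> * (\<Sum>a\<in>I. (G a)\<^sup>2)" by (simp add: sum_distrib_left)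
    have "(\<Sum>p\<in>?P. (sqrt (w (fst p) (snd p)) * G' (snd p))\<^sup>2) = (\<Sum>b\<in>I. (\<Sum>a\<in>I. w b a) * (G' b)\<^sup>2)"
      by (simp add: sum.cartesian_product' power_mult_distrib w0 sum_distrib_right) (subst sum.swap, intro sum.cong refl, simp add: sym)
    also have "\<dots> \<le> (\<Sum>b\<in>I. 2 * \<mu> * (G' b)\<^sup>2)" by (intro sum_mono mult_right_mono row) auto
    finally show "(\<Sum>p\<in>?P. (sqrt (w (fst p) (snd p)) * G' (snd p))\<^sup>2) \<le> 2 * \<mu> * (\<Sum>b\<in>I. (G' b)\<^sup>2)" by (simp add: sum_distrib_left)
  qed (use \<mu> in \<open>auto intro!: sum_nonneg mult_nonneg_nonneg\<close>)
  also have "\<dots> = 2 * \<mu> * (sqrt (\<Sum>a\<in>I. (G a)\<^sup>2) * sqrt (\<Sum>b\<in>I. (G' b)\<^sup>2))"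
    using \<mu> by (simp add: real_sqrt_mult algebra_simps)
  finally show ?thesis by (simp add: w_def)
qed

text \<open>\<open>k\<close> is the kernel of \<open>T T\<^sup>*\<close> without the weight, \<open>e j\<close> the evolved functions. The assumption \<open>gram\<close> is
  Bessel's inequality for the vector \<open>T\<^sup>* (W e\<^sub>j)\<close>, and \<open>k_form\<close> says that \<open>k\<close> is a contraction for fixed times.\<close>

locale strichartz_core =
  fixes S :: "(real \<times> 'a::euclidean_space) set" and W :: "real \<times> 'a \<Rightarrow> real"
    and e :: "nat \<Rightarrow> real \<times> 'a \<Rightarrow> complex" and k :: "real \<times> 'a \<Rightarrow> real \<times> 'a \<Rightarrow> complex"
    and J :: "nat set" and N :: int and B :: real
  assumes finJ: "finite J" and bdS: "bounded S" and S_nz: "\<And>z. z \<in> S \<Longrightarrow> fst z \<noteq> 0"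
    and W_meas[measurable]: "W \<in> borel_measurable borel"
    and W_dyadic: "\<And>z. z \<in> S \<Longrightarrow> \<exists>i\<in>{-N..N}. W z = 2 powi i" and W_out: "\<And>z. z \<notin> S \<Longrightarrow> W z = 0"
    and e_meas[measurable]: "\<And>j. e j \<in> borel_measurable borel" and B: "B \<ge> 0"
    and e_bd: "\<And>j z. j \<in> J \<Longrightarrow> z \<in> S \<Longrightarrow> norm (e j z) \<le> B"
    and k_meas: "(\<lambda>p. k (fst p) (snd p)) \<in> borel_measurable borel"
    and k_bd: "\<And>z z'. z \<in> S \<Longrightarrow> z' \<in> S \<Longrightarrow> norm (k z z') \<le> B"
    and gram: "\<And>j. j \<in> J \<Longrightarrow>
      (\<Sum>i\<in>J. (norm (LBINT z. cnj (W z * e i z) * (W z * e j z)))\<^sup>2) \<le>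
      Re (LBINT p. cnj (W (fst p) * (W (fst p) * e j (fst p))) * (W (snd p) * (W (snd p) * e j (snd p))) * k (fst p) (snd p))"
    and k_decay: "\<And>z z'. z \<in> S \<Longrightarrow> z' \<in> S \<Longrightarrow> fst z \<noteq> fst z' \<Longrightarrow> norm (k z z') \<le> (1 / sqrt \<bar>fst z - fst z'\<bar>) ^ DIM('a)"
    and k_form: "\<And>t t' \<phi> \<psi>. t \<noteq> 0 \<Longrightarrow> t' \<noteq> 0 \<Longrightarrow> integrable lborel \<phi> \<Longrightarrow> integrable lborel \<psi> \<Longrightarrow>
      integrable lborel (\<lambda>x. (norm (\<phi> x))\<^sup>2) \<Longrightarrow> integrable lborel (\<lambda>x. (norm (\<psi> x))\<^sup>2) \<Longrightarrow>
      norm (LBINT p. cnj (\<phi> (fst p)) * \<psi> (snd p) * k (t, fst p) (t', snd p))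
     \<le> sqrt (LBINT x. (norm (\<phi> x))\<^sup>2) * sqrt (LBINT x. (norm (\<psi> x))\<^sup>2)"
begin

definition g :: "nat \<Rightarrow> real \<times> 'a \<Rightarrow> complex" where "g j z = W z * e j z"

text \<open>Integrand of the quadratic form of the weighted kernel at \<open>g j\<close>; the real
  part of its integral is the right-hand side of \<open>gram\<close>.\<close>

definition h :: "nat \<Rightarrow> (real \<times> 'a) \<times> (real \<times> 'a) \<Rightarrow> complex" where
  "h j p = cnj (W (fst p) * g j (fst p)) * (W (snd p) * g j (snd p)) * k (fst p) (snd p)"

definition c :: "nat \<Rightarrow> nat \<Rightarrow> complex" where "c i j = (LBINT z. cnj (g i z) * g j z)"

text \<open>With \<open>A = T\<^sup>* T\<close>, \<open>c i j = \<langle>u\<^sub>i, A u\<^sub>j\<rangle>\<close> and \<open>\<beta>2 j\<close> is the squared norm of the part of \<open>A u\<^sub>j\<close> seen by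
  the system. It dominates \<open>(nrm j)\<^sup>2 = \<langle>u\<^sub>j, A u\<^sub>j\<rangle>\<^sup>2\<close>, and working with it instead of the latter replaces a
  diagonalisation of \<open>A\<close>.\<close>

definition \<beta>2 :: "nat \<Rightarrow> real" where "\<beta>2 j = (\<Sum>i\<in>J. (norm (c i j))\<^sup>2)"

definition nrm :: "nat \<Rightarrow> real" where "nrm j = (LBINT z. (norm (g j z))\<^sup>2)"

text \<open>Norm in the positions at a frozen time: the function of time on which Schur's test
  acts.\<close>

definition slice :: "nat \<Rightarrow> real \<Rightarrow> real" where "slice j t = sqrt (LBINT x. (norm (g j (t, x)))\<^sup>2)"

section \<open>Boundedness, measurability and integrability\<close>

lemma W_nonneg: "0 \<le> W z"
  using W_dyadic[of z] W_out[of z] by (cases "z \<in> S") auto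

lemma W_le: "W z \<le> 2 powi N"
proof (cases "z \<in> S")
  case True
  then obtain i where "i \<le> N" "W z = 2 powi i" using W_dyadic[OF True] by auto
  then show ?thesis by (simp add: power_int_increasing)
qed (simp add: W_out)

lemma k_measurable[measurable (raw)]:
  assumes [measurable]: "f1 \<in> borel_measurable M" "f2 \<in> borel_measurable M"
  shows "(\<lambda>x. k (f1 x) (f2 x)) \<in> borel_measurable M"
  using measurable_compose[OF borel_measurable_Pair[OF assms] k_meas] by simp

lemma g_meas[measurable]: "g j \<in> borel_measurable borel"
  unfolding g_def[abs_def] by measurable

lemma g_out: "z \<notin> S \<Longrightarrow> g j z = 0" by (simp add: g_def W_out)

lemma g_bd: "j \<in> J \<Longrightarrow> norm (g j z) \<le> 2 powi N * B"
  using e_bd[of j z] B W_le[of z] W_nonneg[of z]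
  by (cases "z \<in> S") (auto simp: g_def norm_mult W_out intro!: mult_mono)

lemma bdS2: "bounded (S \<times> S)" by (intro bounded_Times bdS)

lemma bd_snd: "bounded (snd ` S)" by (rule bounded_snd[OF bdS])

lemma h_meas[measurable]: "h j \<in> borel_measurable borel"
  unfolding h_def[abs_def] by measurable

lemma h_out: "p \<notin> S \<times> S \<Longrightarrow> h j p = 0"
  by (cases p) (auto simp: h_def W_out)

lemma h_bd: assumes "j \<in> J" "p \<in> S \<times> S"
  shows "norm (h j p) \<le> (2 powi N * (2 powi N * B)) * (2 powi N * (2 powi N * B)) * B"
  using assms unfolding h_def norm_mult complex_mod_cnj norm_of_real
  by (intro mult_mono) (auto intro!: W_le g_bd k_bd simp: W_nonneg B)

lemma h_indicator_integrable:
  assumes j: "j \<in> J" and [measurable]: "Measurable.pred borel P"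
  shows "integrable lborel (\<lambda>p. h j p * of_bool (P p))"
proof (rule integrable_bounded_support[OF _ bdS2])
  fix p assume "p \<in> S \<times> S"
  with h_bd[OF j this] show "norm (h j p * of_bool (P p)) \<le> (2 powi N * (2 powi N * B)) * (2 powi N * (2 powi N * B)) * B"
    using B by (auto simp: norm_mult)
qed (auto simp: h_out)

lemma slice_integrable:
  assumes "j \<in> J"
  shows "integrable lborel (\<lambda>x. (norm (g j (t, x)))\<^sup>2)"
proof (rule integrable_bounded_support[OF _ bd_snd])
  show "(\<lambda>x. (norm (g j (t, x)))\<^sup>2) \<in> borel_measurable borel" by measurable
  show "norm ((norm (g j (t, x)))\<^sup>2) \<le> (2 powi N * B)\<^sup>2" for x
    using g_bd[OF assms, of "(t, x)"] by (auto intro!: power_mono)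
  show "(norm (g j (t, x)))\<^sup>2 = 0" if "x \<notin> snd ` S" for x
    using that g_out[of "(t, x)"] by force
qed

lemma level_unique: "z \<in> S \<Longrightarrow> \<exists>!a. a \<in> {-N..N} \<and> W z = 2 powi a"
proof -
  assume z: "z \<in> S"
  obtain i where "i \<in> {-N..N}" "W z = 2 powi i" using W_dyadic[OF z] by blast
  moreover have "a = b" if "(2::real) powi a = 2 powi b" for a b :: int
    using that power_int_strict_increasing[of a b "2::real"] power_int_strict_increasing[of b a "2::real"] by (cases a b rule: linorder_cases) auto
  ultimately show ?thesis by metis
qed

lemma level_sum:
  fixes f :: "int \<Rightarrow> 'b::comm_monoid_add"
  assumes "z \<in> S" "i \<in> {-N..N}" "W z = 2 powi i"
  shows "(\<Sum>a\<in>{-N..N}. if W z = 2 powi a then f a else 0) = f i"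
proof -
  have "W z = 2 powi a \<longleftrightarrow> a = i" if "a \<in> {-N..N}" for a using level_unique[OF assms(1)] assms that by metis
  then have "(\<Sum>a\<in>{-N..N}. if W z = 2 powi a then f a else 0) = (\<Sum>a\<in>{-N..N}. if a = i then f a else 0)"
    by (intro sum.cong refl) auto
  then show ?thesis using assms by simp
qed

text \<open>Cutting both arguments along the levels W = 2^a turns the condition on the product of
  the two values of \<open>W\<close> into one on the pair of exponents. The truncated form is thus a
  finite sum of untruncated ones; each is controlled by the contraction \<open>k_form\<close>, and
  the bounds form the matrix of \<open>dyadic_schur\<close>. This is why \<open>W\<close> is taken
  dyadic: a sharp truncation of an oscillating kernel need not preserve boundedness.\<close>

lemma slice_form_bound:
  assumes j: "j \<in> J" and \<mu>: "\<mu> \<ge> 0"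
  shows "norm (LBINT w. h j ((t, fst w), (t', snd w)) * of_bool (W (t, fst w) * W (t', snd w) \<le> \<mu>))
    \<le> 2 * \<mu> * (slice j t * slice j t')"
proof (cases "t = 0 \<or> t' = 0")
  case True
  \<comment> \<open>\<open>k_form\<close> excludes time 0, but so does \<open>S\<close>, and
    \<open>g j\<close> vanishes outside \<open>S\<close>.\<close>
  have "g j (0, x) = 0" for x using S_nz[of "(0, x)"] g_out[of "(0,x)"] by auto
  with True have "h j ((t, x), (t', x')) = 0" for x x' by (auto simp: h_def)
  then show ?thesis using \<mu> by (simp add: slice_def)
next
  case False
  let ?I = "{-N..N}"
  define \<phi> where "\<phi> s a x = (if W (s, x) = 2 powi a then of_real (2 powi a) * g j (s, x) else 0)" for s a x
  define G where "G s a = sqrt (LBINT x. (norm (g j (s, x)))\<^sup>2 * of_bool (W (s, x) = 2 powi a))" for s a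
  have [measurable]: "\<phi> s a \<in> borel_measurable borel" for s a unfolding \<phi>_def[abs_def] by measurable
  have \<phi>_out: "\<phi> s a x = 0" if "(s, x) \<notin> S" for s a x using that by (simp add: \<phi>_def g_out)
  have \<phi>_bd: "norm (\<phi> s a x) \<le> 2 powi N * (2 powi N * B)" for s a x
    using g_bd[OF j, of "(s, x)"] W_le[of "(s, x)"] B W_nonneg[of "(s,x)"] by (auto simp: \<phi>_def norm_mult norm_power_int intro!: mult_mono)
  have \<phi>_int: "integrable lborel (\<phi> s a)" for s a
    by (rule integrable_bounded_support[OF _ bd_snd \<phi>_bd]) (auto intro!: \<phi>_out simp: image_iff)
  have sq_int: "integrable lborel (\<lambda>x. (norm (g j (s, x)))\<^sup>2 * of_bool (W (s, x) = 2 powi a))" for s a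
    by (rule Bochner_Integration.integrable_bound[OF slice_integrable[OF j, of s]]) auto
  have \<phi>_sq: "(norm (\<phi> s a x))\<^sup>2 = (2 powi a)\<^sup>2 * ((norm (g j (s, x)))\<^sup>2 * of_bool (W (s, x) = 2 powi a))" for s a x
    by (simp add: \<phi>_def norm_mult norm_power_int power_mult_distrib)
  have \<phi>_sqint: "integrable lborel (\<lambda>x. (norm (\<phi> s a x))\<^sup>2)" for s a
    unfolding \<phi>_sq by (intro integrable_mult_right sq_int)
  have \<phi>_nrm: "sqrt (LBINT x. (norm (\<phi> s a x))\<^sup>2) = 2 powi a * G s a" for s a
    unfolding \<phi>_sq integral_mult_right_zero by (simp add: real_sqrt_mult G_def)
  have G0: "G s a \<ge> 0" for s a by (auto simp: G_def intro!: Bochner_Integration.integral_nonneg)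
  have Gsum: "sqrt (\<Sum>a\<in>?I. (G s a)\<^sup>2) = slice j s" for s
  proof -
    have "(\<Sum>a\<in>?I. (G s a)\<^sup>2) = (\<Sum>a\<in>?I. LBINT x. (norm (g j (s, x)))\<^sup>2 * of_bool (W (s, x) = 2 powi a))"
      by (simp add: G_def Bochner_Integration.integral_nonneg)
    also have "\<dots> = (LBINT x. (\<Sum>a\<in>?I. (norm (g j (s, x)))\<^sup>2 * of_bool (W (s, x) = 2 powi a)))"
      by (rule Bochner_Integration.integral_sum[symmetric, OF sq_int])
    also have "\<dots> = (LBINT x. (norm (g j (s, x)))\<^sup>2)"
    proof (intro Bochner_Integration.integral_cong refl)
      fix x
      show "(\<Sum>a\<in>?I. (norm (g j (s, x)))\<^sup>2 * of_bool (W (s, x) = 2 powi a)) = (norm (g j (s, x)))\<^sup>2"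
      proof (cases "(s, x) \<in> S")
        case True
        then obtain i where "i \<in> ?I" "W (s, x) = 2 powi i" using W_dyadic by blast
        from level_sum[OF True this, of "\<lambda>_. (norm (g j (s, x)))\<^sup>2"] show ?thesis
          by (simp add: of_bool_def if_distrib cong: if_cong)
      qed (simp add: g_out)
    qed
    finally show ?thesis by (simp add: slice_def)
  qed
  \<comment> \<open>The truncation is constant on each block of levels, hence a mere factor 0 or 1
    of the block.\<close>
  define w where "w a b = (of_bool (2 powi a * 2 powi b \<le> \<mu>) :: complex)" for a b :: int
  have eq: "h j ((t, x), (t', x')) * of_bool (W (t, x) * W (t', x') \<le> \<mu>) =
     (\<Sum>a\<in>?I. \<Sum>b\<in>?I. w a b * (cnj (\<phi> t a x) * \<phi> t' b x' * k (t, x) (t', x')))" for x x'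
  proof (cases "(t, x) \<in> S \<and> (t', x') \<in> S")
    case True
    then obtain i where i: "i \<in> ?I" "W (t, x) = 2 powi i" using W_dyadic by blast
    from True obtain i' where i': "i' \<in> ?I" "W (t', x') = 2 powi i'" using W_dyadic by blast
    let ?K = "cnj (g j (t, x)) * g j (t', x') * k (t, x) (t', x')"
    have "(\<Sum>a\<in>?I. \<Sum>b\<in>?I. w a b * (cnj (\<phi> t a x) * \<phi> t' b x' * k (t, x) (t', x'))) =
      (\<Sum>a\<in>?I. if W (t, x) = 2 powi a then (\<Sum>b\<in>?I. if W (t', x') = 2 powi b then w a b * (of_real (2 powi a) * of_real (2 powi b) * ?K) else 0) else 0)"
      by (intro sum.cong refl) (auto simp: \<phi>_def intro!: sum.cong)
    also have "\<dots> = w i i' * (of_real (2 powi i) * of_real (2 powi i') * ?K)"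
      using level_sum[OF _ i, of "\<lambda>a. (\<Sum>b\<in>?I. if W (t', x') = 2 powi b then w a b * (of_real (2 powi a) * of_real (2 powi b) * ?K) else 0)"]
        level_sum[OF _ i', of "\<lambda>b. w i b * (of_real (2 powi i) * of_real (2 powi b) * ?K)"] True by simp
    finally show ?thesis by (simp add: h_def i(2) i'(2) w_def mult_ac)
  next
    case False
    then show ?thesis using h_out[of "((t, x), (t', x'))" j] by (auto simp: \<phi>_out)
  qed
  have int: "integrable lborel (\<lambda>v. w a b * (cnj (\<phi> t a (fst v)) * \<phi> t' b (snd v) * k (t, fst v) (t', snd v)))" for a b
  proof (rule integrable_mult_right, rule integrable_bounded_support[OF _ bounded_Times[OF bd_snd bd_snd]])
    fix v :: "'a \<times> 'a"
    show "norm (cnj (\<phi> t a (fst v)) * \<phi> t' b (snd v) * k (t, fst v) (t', snd v)) \<le> (2 powi N * (2 powi N * B)) * (2 powi N * (2 powi N * B)) * B"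
    proof (cases "(t, fst v) \<in> S \<and> (t', snd v) \<in> S")
      case True then show ?thesis unfolding norm_mult complex_mod_cnj
        by (intro mult_mono) (auto intro!: \<phi>_bd k_bd simp: B)
    qed (auto simp: \<phi>_out B)
    show "cnj (\<phi> t a (fst v)) * \<phi> t' b (snd v) * k (t, fst v) (t', snd v) = 0" if "v \<notin> snd ` S \<times> snd ` S"
      using that \<phi>_out[of t "fst v" a] \<phi>_out[of t' "snd v" b] by (cases v) force
  qed measurable
  have "(LBINT v. h j ((t, fst v), (t', snd v)) * of_bool (W (t, fst v) * W (t', snd v) \<le> \<mu>)) =
     (\<Sum>a\<in>?I. \<Sum>b\<in>?I. LBINT v. w a b * (cnj (\<phi> t a (fst v)) * \<phi> t' b (snd v) * k (t, fst v) (t', snd v)))"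
    unfolding eq by (subst Bochner_Integration.integral_sum, intro Bochner_Integration.integrable_sum int,
      intro sum.cong refl Bochner_Integration.integral_sum int)
  also have "norm \<dots> \<le> (\<Sum>a\<in>?I. \<Sum>b\<in>?I. norm (LBINT v. w a b * (cnj (\<phi> t a (fst v)) * \<phi> t' b (snd v) * k (t, fst v) (t', snd v))))"
    by (intro order_trans[OF norm_sum] sum_mono norm_sum)
  also have "\<dots> \<le> (\<Sum>a\<in>?I. \<Sum>b\<in>?I. (if 2 powi a * 2 powi b \<le> \<mu> then 2 powi a * 2 powi b else 0) * (G t a * G t' b))"
  proof (intro sum_mono)
    fix a b
    have "norm (LBINT v. w a b * (cnj (\<phi> t a (fst v)) * \<phi> t' b (snd v) * k (t, fst v) (t', snd v))) =
       norm (w a b) * norm (LBINT v. cnj (\<phi> t a (fst v)) * \<phi> t' b (snd v) * k (t, fst v) (t', snd v))"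
      unfolding integral_mult_right_zero norm_mult by (rule refl)
    also have "\<dots> \<le> norm (w a b) * ((2 powi a * G t a) * (2 powi b * G t' b))"
      using k_form[of t t' "\<phi> t a" "\<phi> t' b"] False \<phi>_int \<phi>_sqint unfolding \<phi>_nrm by (intro mult_left_mono) auto
    also have "\<dots> = (if 2 powi a * 2 powi b \<le> \<mu> then 2 powi a * 2 powi b else 0) * (G t a * G t' b)"
      by (simp add: w_def)
    finally show "norm (LBINT v. w a b * (cnj (\<phi> t a (fst v)) * \<phi> t' b (snd v) * k (t, fst v) (t', snd v))) \<le>
      (if 2 powi a * 2 powi b \<le> \<mu> then 2 powi a * 2 powi b else 0) * (G t a * G t' b)" .
  qed
  also have "\<dots> \<le> 2 * \<mu> * (sqrt (\<Sum>a\<in>?I. (G t a)\<^sup>2) * sqrt (\<Sum>b\<in>?I. (G t' b)\<^sup>2))"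
    by (rule dyadic_schur[OF _ \<mu> G0 G0]) simp
  finally show ?thesis by (simp add: Gsum)
qed

lemma slice_meas[measurable]: "slice j \<in> borel_measurable borel"
  unfolding slice_def[abs_def] by measurable

lemma gg_integrable: assumes "i \<in> J" "j \<in> J" shows "integrable lborel (\<lambda>z. cnj (g i z) * g j z)"
proof (rule integrable_bounded_support[OF _ bdS])
  show "norm (cnj (g i z) * g j z) \<le> (2 powi N * B) * (2 powi N * B)" for z
    unfolding norm_mult complex_mod_cnj using assms B by (intro mult_mono g_bd) auto
qed (auto simp: g_out)

lemma g_sq_integrable: assumes "j \<in> J" shows "integrable lborel (\<lambda>z. (norm (g j z))\<^sup>2)"
  using integrable_norm[OF gg_integrable[OF assms assms]] by (simp add: norm_mult power2_eq_square)

lemma nrm_nonneg: "0 \<le> nrm j" by (simp add: nrm_def Bochner_Integration.integral_nonneg)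

lemma c_diag: assumes "j \<in> J" shows "c j j = of_real (nrm j)"
proof -
  have "c j j = (LBINT z. complex_of_real ((norm (g j z))\<^sup>2))"
    unfolding c_def by (intro Bochner_Integration.integral_cong refl) (simp only: complex_norm_square mult.commute)
  then show ?thesis unfolding nrm_def by (subst (asm) integral_of_real[OF g_sq_integrable[OF assms]])
qed

lemma nrm_le: assumes "j \<in> J" shows "nrm j \<le> sqrt (\<beta>2 j)"
proof (rule real_le_rsqrt)
  have "(nrm j)\<^sup>2 = (norm (c j j))\<^sup>2" by (simp add: c_diag assms)
  also have "\<dots> \<le> \<beta>2 j" unfolding \<beta>2_def by (rule member_le_sum) (auto simp: assms finJ)
  finally show "(nrm j)\<^sup>2 \<le> \<beta>2 j" .
qed

lemma \<beta>2_nonneg: "0 \<le> \<beta>2 j" by (simp add: \<beta>2_def sum_nonneg)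

lemma nn_integral_slice_sq:
  assumes j: "j \<in> J"
  shows "(\<integral>\<^sup>+ t. ennreal ((slice j t)\<^sup>2) \<partial>lborel) = ennreal (nrm j)"
proof -
  have "(slice j t)\<^sup>2 = (LBINT x. (norm (g j (t, x)))\<^sup>2)" for t
    by (simp add: slice_def Bochner_Integration.integral_nonneg)
  then have "(\<integral>\<^sup>+ t. ennreal ((slice j t)\<^sup>2) \<partial>lborel) = (\<integral>\<^sup>+ t. \<integral>\<^sup>+ x. ennreal ((norm (g j (t, x)))\<^sup>2) \<partial>lborel \<partial>lborel)"
    by (simp add: nn_integral_eq_integral[OF slice_integrable[OF j]])
  also have "\<dots> = L2_mass (g j)"
    by (subst nn_integral_lborel_pair) auto
  also have "\<dots> = ennreal (nrm j)"
    unfolding nrm_def by (rule nn_integral_eq_integral[OF g_sq_integrable[OF j]]) simp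
  finally show ?thesis .
qed

text \<open>Chosen so that \<open>near_bound\<close> at height \<open>cc * l\<close> gives
  \<open>l * nrm j / 2\<close>, which can be absorbed into \<open>\<beta>2 j\<close>.\<close>

definition cc :: real where "cc = 1 / (4 * (4 * real DIM('a) + 3))"

lemma cc_pos: "cc > 0" by (simp add: cc_def)

section \<open>Splitting the kernel at a given height\<close>

context
  fixes H :: "real \<Rightarrow> real"
  assumes H_meas[measurable]: "H \<in> borel_measurable borel" and H_pos: "\<And>t. H t > 0"
    and H_int: "(\<integral>\<^sup>+ t. ennreal (H t) \<partial>lborel) \<le> 1"
begin

text \<open>At height \<open>l\<close> the kernel of \<open>T T\<^sup>*\<close> is split into a part of small operator norm (\<open>near\<close>) and a
  Hilbert-Schmidt part, as in real interpolation.\<close>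

definition near :: "real \<Rightarrow> (real \<times> 'a) \<times> (real \<times> 'a) \<Rightarrow> bool" where
  "near l p \<longleftrightarrow> W (fst p) * W (snd p) \<le> l * time_ker DIM('a) H (fst (fst p)) (fst (snd p))"

lemma near_meas[measurable]: "Measurable.pred borel (near l)"
  unfolding near_def[abs_def] by measurable

text \<open>With both times frozen, \<open>near\<close> is the truncation of
  \<open>slice_form_bound\<close> at the threshold \<open>l * time_ker\<close>. The time kernel that
  results is bounded by Schur's test, and the squared slices integrate to
  \<open>nrm j\<close>.\<close>

lemma near_bound:
  assumes j: "j \<in> J" and l: "l \<ge> 0"
  shows "norm (LBINT p. h j p * of_bool (near l p)) \<le> 2 * l * (4 * real DIM('a) + 3) * nrm j"
proof -
  let ?K = "time_ker DIM('a) H"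
  have "ennreal (norm (LBINT p. h j p * of_bool (near l p))) \<le>
    (\<integral>\<^sup>+ t. \<integral>\<^sup>+ t'. ennreal (norm (LBINT w. h j ((t, fst w), (t', snd w)) * of_bool (near l ((t, fst w), (t', snd w))))) \<partial>lborel \<partial>lborel)"
    by (rule integral_regroup_norm_le[OF h_indicator_integrable[OF j]]) measurable
  also have "\<dots> \<le> (\<integral>\<^sup>+ t. \<integral>\<^sup>+ t'. ennreal (2 * l) * ennreal (?K t t' * (slice j t * slice j t')) \<partial>lborel \<partial>lborel)"
  proof (intro nn_integral_mono)
    fix t t'
    have K0: "?K t t' \<ge> 0" by (rule time_ker_nonneg)
    have s0: "slice j s \<ge> 0" for s by (simp add: slice_def Bochner_Integration.integral_nonneg)
    have "norm (LBINT w. h j ((t, fst w), (t', snd w)) * of_bool (near l ((t, fst w), (t', snd w)))) \<le> 2 * (l * ?K t t') * (slice j t * slice j t')"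
      unfolding near_def fst_conv snd_conv by (rule slice_form_bound[OF j]) (use l K0 in simp)
    also have "\<dots> = (2 * l) * (?K t t' * (slice j t * slice j t'))" by simp
    finally show "ennreal (norm (LBINT w. h j ((t, fst w), (t', snd w)) * of_bool (near l ((t, fst w), (t', snd w))))) \<le>
        ennreal (2 * l) * ennreal (?K t t' * (slice j t * slice j t'))"
      using l K0 s0 by (subst ennreal_mult[symmetric]) (auto intro!: ennreal_leI)
  qed
  also have "\<dots> = ennreal (2 * l) * (\<integral>\<^sup>+ t. \<integral>\<^sup>+ t'. ennreal (?K t t' * (slice j t * slice j t')) \<partial>lborel \<partial>lborel)"
  proof -
    have "(\<integral>\<^sup>+ t'. ennreal (2 * l) * ennreal (?K t t' * (slice j t * slice j t')) \<partial>lborel) =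
       ennreal (2 * l) * (\<integral>\<^sup>+ t'. ennreal (?K t t' * (slice j t * slice j t')) \<partial>lborel)" for t
      by (rule nn_integral_cmult) measurable
    then show ?thesis by (simp only:) (rule nn_integral_cmult, measurable)
  qed
  also have "\<dots> \<le> ennreal (2 * l) * (ennreal (4 * real DIM('a) + 3) * (\<integral>\<^sup>+ t. ennreal ((slice j t)\<^sup>2) \<partial>lborel))"
    by (intro mult_left_mono time_ker_form_bound H_pos H_int) (auto simp: DIM_positive)
  also have "\<dots> = ennreal (2 * l * (4 * real DIM('a) + 3) * nrm j)"
    using l nrm_nonneg[of j] unfolding nn_integral_slice_sq[OF j] by (simp only: ennreal_mult[symmetric] mult.assoc) (subst ennreal_mult[symmetric], auto simp: ennreal_mult[symmetric])
  finally show ?thesis using l nrm_nonneg[of j] by (subst (asm) ennreal_le_iff) auto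
qed

text \<open>\<open>gram\<close> bounds \<open>\<beta>2 j\<close> by the full form. The near part is
  at most \<open>l * nrm j / 2\<close>; as \<open>l\<close> and \<open>nrm j\<close> are both at
  most \<open>sqrt (\<beta>2 j)\<close>, this is at most half of \<open>\<beta>2 j\<close> and is
  absorbed on the left.\<close>

lemma far_lower:
  assumes j: "j \<in> J" and l: "l > 0" "l \<le> sqrt (\<beta>2 j)"
  shows "\<beta>2 j \<le> 2 * Re (LBINT p. h j p * of_bool (\<not> near (cc * l) p))"
proof -
  have i1: "integrable lborel (\<lambda>p. h j p * of_bool (near (cc * l) p))" by (rule h_indicator_integrable[OF j]) measurable
  have i2: "integrable lborel (\<lambda>p. h j p * of_bool (\<not> near (cc * l) p))" by (rule h_indicator_integrable[OF j]) measurable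
  have "\<beta>2 j \<le> Re (LBINT p. h j p)"
    using gram[OF j] unfolding \<beta>2_def c_def h_def g_def by simp
  also have "(LBINT p. h j p) = (LBINT p. h j p * of_bool (near (cc * l) p) + h j p * of_bool (\<not> near (cc * l) p))"
    by (intro Bochner_Integration.integral_cong refl) auto
  also have "\<dots> = (LBINT p. h j p * of_bool (near (cc * l) p)) + (LBINT p. h j p * of_bool (\<not> near (cc * l) p))"
    by (rule Bochner_Integration.integral_add[OF i1 i2])
  finally have b: "\<beta>2 j \<le> Re (LBINT p. h j p * of_bool (near (cc * l) p)) + Re (LBINT p. h j p * of_bool (\<not> near (cc * l) p))" by simp
  have "Re (LBINT p. h j p * of_bool (near (cc * l) p)) \<le> norm (LBINT p. h j p * of_bool (near (cc * l) p))" by (rule complex_Re_le_cmod)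
  also have "\<dots> \<le> 2 * (cc * l) * (4 * real DIM('a) + 3) * nrm j" by (rule near_bound[OF j]) (use l cc_pos in simp)
  also have "\<dots> = (1/2) * (l * nrm j)"
  proof -
    have "cc * (4 * real DIM('a) + 3) = 1/4" by (simp add: cc_def field_simps)
    then have "2 * (cc * l) * (4 * real DIM('a) + 3) * nrm j = 2 * (1/4) * (l * nrm j)" by (metis mult.assoc mult.commute)
    then show ?thesis by simp
  qed
  also have "\<dots> \<le> (1/2) * (sqrt (\<beta>2 j) * sqrt (\<beta>2 j))"
    using l nrm_le[OF j] nrm_nonneg[of j] \<beta>2_nonneg[of j] by (intro mult_left_mono mult_mono) auto
  also have "\<dots> = \<beta>2 j / 2" using \<beta>2_nonneg[of j] by simp
  finally show ?thesis using b by simp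
qed

text \<open>The complementary part of the weighted kernel. Being bounded with bounded support it is
  Hilbert-Schmidt, and from here on only its size matters.\<close>

definition bk :: "real \<Rightarrow> (real \<times> 'a) \<times> (real \<times> 'a) \<Rightarrow> complex" where
  "bk l p = (W (fst p) * W (snd p)) * k (fst p) (snd p) * of_bool (\<not> near l p)"

lemma bk_meas[measurable]: "bk l \<in> borel_measurable borel"
  unfolding bk_def[abs_def] by measurable

lemma bk_sq_integrable: "integrable lborel (\<lambda>p. (norm (bk l p))\<^sup>2)"
proof (rule integrable_bounded_support[OF _ bdS2])
  fix p assume p: "p \<in> S \<times> S"
  have "norm (bk l p) \<le> (2 powi N * 2 powi N) * B * 1"
    unfolding bk_def norm_mult norm_of_real using p B
    by (intro mult_mono) (auto simp: W_nonneg abs_mult intro!: W_le k_bd mult_mono)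
  then show "norm ((norm (bk l p))\<^sup>2) \<le> ((2 powi N * 2 powi N) * B * 1)\<^sup>2" by (auto intro!: power_mono)
next
  show "(norm (bk l p))\<^sup>2 = 0" if "p \<notin> S \<times> S" for p using that by (cases p) (auto simp: bk_def W_out)
qed measurable

text \<open>Summing \<open>far_lower\<close> over the level set pairs \<open>bk\<close> with
  \<open>G\<close>, whose squared L2 norm is the sum of |<u_i, A u_j>|^2 over pairs in the level
  set, hence at most the left-hand side. The arithmetic-geometric mean with weights 2 and 1/2 allows
  half of the left-hand side to be absorbed, which gives the factor 4.\<close>

lemma level_set_bound:
  assumes l: "l > 0"
  shows "(\<Sum>j | j \<in> J \<and> l < sqrt (\<beta>2 j). \<beta>2 j) \<le> 4 * (LBINT p. (norm (bk (cc * l) p))\<^sup>2)"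
proof -
  let ?L = "{j \<in> J. l < sqrt (\<beta>2 j)}"
  have fL: "finite ?L" using finJ by simp
  define G where "G p = (\<Sum>j\<in>?L. cnj (g j (fst p)) * g j (snd p))" for p
  have [measurable]: "G \<in> borel_measurable borel" unfolding G_def[abs_def] by measurable
  have gi: "integrable lborel (\<lambda>z. cnj (g i z) * g j z)" if "i \<in> ?L" "j \<in> ?L" for i j using that by (intro gg_integrable) auto
  have pint: "integrable lborel (\<lambda>p. (cnj (g i (fst p)) * g j (fst p)) * (cnj (g j (snd p)) * g i (snd p)))"
    if "i \<in> ?L" "j \<in> ?L" for i j
    using integrable_lborel_pair_mult[OF gi[OF that] gi[OF that(2) that(1)]] by (simp add: lborel_prod)
  have Gsq: "of_real ((norm (G p))\<^sup>2) = (\<Sum>i\<in>?L. \<Sum>j\<in>?L. (cnj (g i (fst p)) * g j (fst p)) * (cnj (g j (snd p)) * g i (snd p)))" for p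
    unfolding complex_norm_square G_def cnj_sum sum_product by (simp add: mult_ac)
  have "integrable lborel (\<lambda>p. complex_of_real ((norm (G p))\<^sup>2))"
    unfolding Gsq by (intro Bochner_Integration.integrable_sum pint) auto
  from integrable_Re[OF this] have Gint: "integrable lborel (\<lambda>p. (norm (G p))\<^sup>2)" by (simp only: Re_complex_of_real)
  have "complex_of_real (LBINT p. (norm (G p))\<^sup>2) = (LBINT p. complex_of_real ((norm (G p))\<^sup>2))"
    by (rule integral_of_real[OF Gint, symmetric])
  also have "\<dots> = (\<Sum>i\<in>?L. \<Sum>j\<in>?L. LBINT p. (cnj (g i (fst p)) * g j (fst p)) * (cnj (g j (snd p)) * g i (snd p)))"
    unfolding Gsq by (subst Bochner_Integration.integral_sum, intro Bochner_Integration.integrable_sum pint, simp, simp,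
      intro sum.cong refl Bochner_Integration.integral_sum pint)
  also have "\<dots> = (\<Sum>i\<in>?L. \<Sum>j\<in>?L. of_real ((norm (c i j))\<^sup>2))"
  proof (intro sum.cong refl)
    fix i j assume ij: "i \<in> ?L" "j \<in> ?L"
    have "cnj (c i j) = c j i" unfolding c_def Bochner_Integration.integral_cnj[symmetric] by (simp add: mult.commute)
    then show "(LBINT p. (cnj (g i (fst p)) * g j (fst p)) * (cnj (g j (snd p)) * g i (snd p))) = of_real ((norm (c i j))\<^sup>2)"
      unfolding complex_norm_square by (subst integral_lborel_pair_mult[OF gi[OF ij] gi[OF ij(2) ij(1)]]) (simp add: c_def)
  qed
  also have "\<dots> = complex_of_real (\<Sum>j\<in>?L. \<Sum>i\<in>?L. (norm (c i j))\<^sup>2)" by (subst sum.swap) simp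
  finally have "(LBINT p. (norm (G p))\<^sup>2) = (\<Sum>j\<in>?L. \<Sum>i\<in>?L. (norm (c i j))\<^sup>2)" by (simp only: of_real_eq_iff)
  \<comment> \<open>In \<open>\<beta>2\<close> the index \<open>i\<close> runs over all of
    \<open>J\<close>, here only over the level set.\<close>
  also have "\<dots> \<le> (\<Sum>j\<in>?L. \<beta>2 j)"
    unfolding \<beta>2_def using finJ by (intro sum_mono sum_mono2) auto
  finally have Gle: "(LBINT p. (norm (G p))\<^sup>2) \<le> (\<Sum>j\<in>?L. \<beta>2 j)" .
  have hi: "integrable lborel (\<lambda>p. h j p * of_bool (\<not> near (cc * l) p))" if "j \<in> ?L" for j
    using that by (intro h_indicator_integrable) auto
  have "(\<Sum>j\<in>?L. \<beta>2 j) \<le> (\<Sum>j\<in>?L. 2 * Re (LBINT p. h j p * of_bool (\<not> near (cc * l) p)))"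
    using l by (intro sum_mono far_lower) auto
  also have "\<dots> = 2 * Re (\<Sum>j\<in>?L. LBINT p. h j p * of_bool (\<not> near (cc * l) p))" by (simp add: sum_distrib_left)
  also have "(\<Sum>j\<in>?L. LBINT p. h j p * of_bool (\<not> near (cc * l) p)) = (LBINT p. (\<Sum>j\<in>?L. h j p * of_bool (\<not> near (cc * l) p)))"
    by (rule Bochner_Integration.integral_sum[symmetric, OF hi])
  also have "\<dots> = (LBINT p. bk (cc * l) p * G p)"
    by (intro Bochner_Integration.integral_cong refl) (simp add: bk_def G_def h_def sum_distrib_left mult_ac)
  also have "2 * Re (LBINT p. bk (cc * l) p * G p) \<le> 2 * norm (LBINT p. bk (cc * l) p * G p)"
    by (intro mult_left_mono complex_Re_le_cmod) simp
  also have "\<dots> = norm (LBINT p. 2 * (bk (cc * l) p * G p))" by (simp add: norm_mult)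
  also have "\<dots> \<le> (LBINT p. 2 * (norm (bk (cc * l) p))\<^sup>2 + (1/2) * (norm (G p))\<^sup>2)"
  proof (rule Bochner_Integration.integral_norm_bound_integral)
    show "integrable lborel (\<lambda>p. 2 * (norm (bk (cc * l) p))\<^sup>2 + (1/2) * (norm (G p))\<^sup>2)"
      by (intro Bochner_Integration.integrable_add integrable_mult_right bk_sq_integrable Gint)
    show bd: "norm (2 * (bk (cc * l) p * G p)) \<le> 2 * (norm (bk (cc * l) p))\<^sup>2 + (1/2) * (norm (G p))\<^sup>2" for p
      using am_gm2[of "2 * norm (bk (cc * l) p)" "norm (G p)"] by (simp add: norm_mult power_mult_distrib)
    show "integrable lborel (\<lambda>p. 2 * (bk (cc * l) p * G p))"
    proof (rule Bochner_Integration.integrable_bound)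
      show "integrable lborel (\<lambda>p. 2 * (norm (bk (cc * l) p))\<^sup>2 + (1/2) * (norm (G p))\<^sup>2)"
        by (intro Bochner_Integration.integrable_add integrable_mult_right bk_sq_integrable Gint)
      show "AE p in lborel. norm (2 * (bk (cc * l) p * G p)) \<le> norm (2 * (norm (bk (cc * l) p))\<^sup>2 + (1/2) * (norm (G p))\<^sup>2)"
        by (rule AE_I2, rule order_trans[OF bd]) simp
    qed measurable
  qed
  also have "\<dots> = 2 * (LBINT p. (norm (bk (cc * l) p))\<^sup>2) + (1/2) * (LBINT p. (norm (G p))\<^sup>2)"
    using bk_sq_integrable Gint by simp
  finally show ?thesis using Gle by simp
qed

lemma nn_integral_layer_pow:
  fixes x :: real
  assumes "x \<ge> 0" "d > 0"
  shows "(\<integral>\<^sup>+ l. ennreal (real d * l ^ (d - 1)) * of_bool (0 < l \<and> l < x) \<partial>lborel) = ennreal (x ^ d)"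
proof -
  have "(\<integral>\<^sup>+ l. ennreal (real d * l ^ (d - 1)) * of_bool (0 < l \<and> l < x) \<partial>lborel) =
     (\<integral>\<^sup>+ l. ennreal (real d * l ^ (d - 1)) * indicator {0..x} l \<partial>lborel)"
    by (rule nn_integral_cong_AE, rule AE_mp[OF AE_lborel_singleton[of 0]], rule AE_mp[OF AE_lborel_singleton[of x]])
      (auto simp: indicator_def)
  also have "\<dots> = ennreal (x ^ d - 0 ^ d)"
    by (rule nn_integral_FTC_Icc) (use assms in \<open>auto intro!: derivative_eq_intros\<close>)
  finally show ?thesis using assms by simp
qed

text \<open>Layer cake: the d-th power of \<open>sqrt (\<beta>2 j)\<close> is the integral of d
  l^(d-1) over the heights below it, and \<open>level_set_bound\<close> applies at each height.
  After exchanging integrals, a fixed pair of points is far exactly for the heights below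
  \<open>V / (cc * K)\<close>, where \<open>V\<close> is the product of the two values of
  \<open>W\<close>, so it contributes \<open>V\<close> to the power 2 + d. The decay of
  \<open>k\<close> leaves the loss (|t-t'| K)^(-d), and \<open>WA\<close> turns the position
  integrals into \<open>A * H t\<close> and \<open>A * H t'\<close>.\<close>

lemma core_bound_weighted:
  assumes A: "A \<ge> 0" and WA: "\<And>t. (\<integral>\<^sup>+ x. ennreal (W (t, x) ^ (DIM('a) + 2)) \<partial>lborel) \<le> ennreal (A * H t)"
  shows "ennreal (\<Sum>j\<in>J. sqrt (\<beta>2 j) ^ (DIM('a) + 2)) \<le> ennreal (36 / cc ^ DIM('a) * A\<^sup>2)"
proof -
  let ?d = "DIM('a)"
  let ?K = "time_ker ?d H"
  have d: "?d > 0" by simp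
  let ?b = "\<lambda>p. (W (fst p) * W (snd p) * norm (k (fst p) (snd p)))\<^sup>2"
  let ?\<kappa> = "\<lambda>p. ?K (fst (fst p)) (fst (snd p))"
  let ?ly = "\<lambda>l. ennreal (real ?d * l ^ (?d - 1))"
  let ?f = "\<lambda>p l. 4 * (?ly l * (ennreal (?b p) * of_bool (0 < l \<and> cc * l * ?\<kappa> p < W (fst p) * W (snd p))))"
  have "ennreal (\<Sum>j\<in>J. sqrt (\<beta>2 j) ^ (?d + 2)) = (\<Sum>j\<in>J. ennreal (\<beta>2 j) * ennreal (sqrt (\<beta>2 j) ^ ?d))"
  proof -
    have "sqrt (\<beta>2 j) ^ (?d + 2) = \<beta>2 j * sqrt (\<beta>2 j) ^ ?d" for j
      using \<beta>2_nonneg[of j] by (simp only: power_add real_sqrt_pow2 mult.commute)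
    then show ?thesis by (simp only:) (subst sum_ennreal[symmetric], auto simp: \<beta>2_nonneg ennreal_mult)
  qed
  also have "\<dots> = (\<Sum>j\<in>J. ennreal (\<beta>2 j) * (\<integral>\<^sup>+ l. ?ly l * of_bool (0 < l \<and> l < sqrt (\<beta>2 j)) \<partial>lborel))"
    by (subst nn_integral_layer_pow[OF _ d]) (auto simp: \<beta>2_nonneg)
  also have "\<dots> = (\<integral>\<^sup>+ l. (\<Sum>j\<in>J. ennreal (\<beta>2 j) * (?ly l * of_bool (0 < l \<and> l < sqrt (\<beta>2 j)))) \<partial>lborel)"
    by (subst nn_integral_sum, measurable, intro sum.cong refl nn_integral_cmult[symmetric], measurable)
  also have "\<dots> \<le> (\<integral>\<^sup>+ l. \<integral>\<^sup>+ p. ?f p l \<partial>lborel \<partial>lborel)"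
  proof (intro nn_integral_mono)
    fix l :: real
    show "(\<Sum>j\<in>J. ennreal (\<beta>2 j) * (?ly l * of_bool (0 < l \<and> l < sqrt (\<beta>2 j)))) \<le>
      (\<integral>\<^sup>+ p. ?f p l \<partial>lborel)"
    proof (cases "l > 0")
      case True
      have bkn: "ennreal ((norm (bk (cc * l) p))\<^sup>2) = ennreal (?b p) * of_bool (0 < l \<and> cc * l * ?\<kappa> p < W (fst p) * W (snd p))" for p
        using True by (auto simp: bk_def near_def norm_mult power_mult_distrib)
      have "(\<Sum>j\<in>J. ennreal (\<beta>2 j) * (?ly l * of_bool (0 < l \<and> l < sqrt (\<beta>2 j)))) = (\<Sum>j | j \<in> J \<and> l < sqrt (\<beta>2 j). ?ly l * ennreal (\<beta>2 j))"
        using finJ True by (intro sum.mono_neutral_cong_right) (auto simp: mult.commute)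
      also have "\<dots> = ?ly l * ennreal (\<Sum>j | j \<in> J \<and> l < sqrt (\<beta>2 j). \<beta>2 j)"
        by (simp add: sum_distrib_left[symmetric] \<beta>2_nonneg)
      also have "\<dots> \<le> ?ly l * ennreal (4 * (LBINT p. (norm (bk (cc * l) p))\<^sup>2))"
        by (intro mult_left_mono ennreal_leI level_set_bound True) simp
      also have "\<dots> = ?ly l * (4 * ennreal (LBINT p. (norm (bk (cc * l) p))\<^sup>2))"
        by (simp add: ennreal_mult Bochner_Integration.integral_nonneg)
      also have "ennreal (LBINT p. (norm (bk (cc * l) p))\<^sup>2) = L2_mass (\<lambda>p. bk (cc * l) p)"
        by (rule nn_integral_eq_integral[symmetric, OF bk_sq_integrable]) simp
      also have "?ly l * (4 * \<dots>) = (\<integral>\<^sup>+ p. ?f p l \<partial>lborel)"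
        unfolding bkn by (subst nn_integral_cmult, measurable, subst nn_integral_cmult, measurable) (simp add: mult_ac)
      finally show ?thesis .
    qed simp
  qed
  also have "\<dots> = (\<integral>\<^sup>+ p. \<integral>\<^sup>+ l. ?f p l \<partial>lborel \<partial>lborel)"
    by (rule lborel_pair.Fubini') measurable
  also have "\<dots> = (\<integral>\<^sup>+ q. \<integral>\<^sup>+ l. ?f (regroup q) l \<partial>lborel \<partial>lborel)"
    by (rule nn_integral_regroup[symmetric]) measurable
  also have "\<dots> = (\<integral>\<^sup>+ s. \<integral>\<^sup>+ w. \<integral>\<^sup>+ l. ?f (regroup (s, w)) l \<partial>lborel \<partial>lborel \<partial>lborel)"
    by (subst nn_integral_lborel_pair) auto
  also have "\<dots> = (\<integral>\<^sup>+ t. \<integral>\<^sup>+ t'. \<integral>\<^sup>+ w. \<integral>\<^sup>+ l. ?f (regroup ((t, t'), w)) l \<partial>lborel \<partial>lborel \<partial>lborel \<partial>lborel)"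
    by (subst nn_integral_lborel_pair) auto
  also have "\<dots> \<le> (\<integral>\<^sup>+ t. \<integral>\<^sup>+ t'. ennreal (4 / cc ^ ?d * A\<^sup>2) * ennreal (H t * H t' * (1 / (\<bar>t - t'\<bar> * ?K t t')) ^ ?d) \<partial>lborel \<partial>lborel)"
  \<comment> \<open>The diagonal in time is discarded as a null set, since \<open>k_decay\<close>
    says nothing there.\<close>
  proof (rule nn_integral_mono, rule nn_integral_mono_AE, rule AE_mp[OF AE_lborel_singleton], intro AE_I2 impI)
    fix t t' :: real assume ne: "t' \<noteq> t"
    define K where "K = ?K t t'"
    define R where "R = \<bar>t - t'\<bar>"
    have K: "K > 0" unfolding K_def using ne H_pos by (intro time_ker_pos) auto
    have R: "R > 0" using ne by (simp add: R_def)
    let ?X = "4 / cc ^ ?d * (1 / (R * K)) ^ ?d"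
    have X0: "?X \<ge> 0" using cc_pos K R by simp
    have "(\<integral>\<^sup>+ w. \<integral>\<^sup>+ l. ?f (regroup ((t, t'), w)) l \<partial>lborel \<partial>lborel)
      \<le> (\<integral>\<^sup>+ w. ennreal ?X * (ennreal (W (t, fst w) ^ (?d + 2)) * ennreal (W (t', snd w) ^ (?d + 2))) \<partial>lborel)"
    proof (rule nn_integral_mono)
      fix w :: "'a \<times> 'a"
      define V where "V = W (t, fst w) * W (t', snd w)"
      have V: "V \<ge> 0" by (simp add: V_def W_nonneg)
      have bb: "?b (regroup ((t, t'), w)) \<le> V\<^sup>2 * (1 / R) ^ ?d"
      proof (cases "(t, fst w) \<in> S \<and> (t', snd w) \<in> S")
        case True
        have "(norm (k (t, fst w) (t', snd w)))\<^sup>2 \<le> ((1 / sqrt R) ^ ?d)\<^sup>2"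
          using k_decay[of "(t, fst w)" "(t', snd w)"] True ne by (intro power_mono) (auto simp: R_def)
        also have "\<dots> = (1 / R) ^ ?d" using R by (simp add: power_mult[symmetric] mult.commute[of ?d] power_mult power_divide)
        finally show ?thesis by (simp add: regroup_def power_mult_distrib V_def mult_left_mono)
      next
        case False
        then have "W (t, fst w) = 0 \<or> W (t', snd w) = 0" by (auto simp: W_out)
        then show ?thesis by (auto simp: regroup_def V_def)
      qed
      have cond: "(0 < l \<and> cc * l * ?\<kappa> (regroup ((t, t'), w)) < W (fst (regroup ((t, t'), w))) * W (snd (regroup ((t, t'), w)))) \<longleftrightarrow> (0 < l \<and> l < V / (cc * K))" for l
        using K cc_pos by (simp add: regroup_def V_def K_def field_simps)
      have "(\<integral>\<^sup>+ l. ?f (regroup ((t, t'), w)) l \<partial>lborel)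
        = (\<integral>\<^sup>+ l. (4 * ennreal (?b (regroup ((t, t'), w)))) * (?ly l * of_bool (0 < l \<and> l < V / (cc * K))) \<partial>lborel)"
        unfolding cond by (simp add: mult_ac)
      also have "\<dots> = (4 * ennreal (?b (regroup ((t, t'), w)))) * ennreal ((V / (cc * K)) ^ ?d)"
        by (subst nn_integral_cmult, measurable, subst nn_integral_layer_pow[OF _ d]) (use V K cc_pos in auto)
      also have "\<dots> \<le> (4 * ennreal (V\<^sup>2 * (1 / R) ^ ?d)) * ennreal ((V / (cc * K)) ^ ?d)"
        by (intro mult_right_mono mult_left_mono ennreal_leI bb) auto
      also have "\<dots> = ennreal (4 * (V\<^sup>2 * (1 / R) ^ ?d) * (V / (cc * K)) ^ ?d)"
        using V K cc_pos R by (simp add: ennreal_mult)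
      also have "4 * (V\<^sup>2 * (1 / R) ^ ?d) * (V / (cc * K)) ^ ?d = ?X * (W (t, fst w) ^ (?d + 2) * W (t', snd w) ^ (?d + 2))"
        by (simp add: V_def power_add power_divide power_mult_distrib field_simps) (simp add: power2_eq_square)
      also have "ennreal \<dots> = ennreal ?X * (ennreal (W (t, fst w) ^ (?d + 2)) * ennreal (W (t', snd w) ^ (?d + 2)))"
        using X0 by (simp only: ennreal_mult W_nonneg zero_le_power mult_nonneg_nonneg)
      finally show "(\<integral>\<^sup>+ l. ?f (regroup ((t, t'), w)) l \<partial>lborel)
        \<le> ennreal ?X * (ennreal (W (t, fst w) ^ (?d + 2)) * ennreal (W (t', snd w) ^ (?d + 2)))" .
    qed
    also have "\<dots> = ennreal ?X * ((\<integral>\<^sup>+ x. ennreal (W (t, x) ^ (?d + 2)) \<partial>lborel) * (\<integral>\<^sup>+ x. ennreal (W (t', x) ^ (?d + 2)) \<partial>lborel))"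
    proof -
      have mW: "(\<lambda>x. W (s, f x)) \<in> borel_measurable borel" if "f \<in> borel_measurable borel" for s and f :: "'a \<times> 'a \<Rightarrow> 'a"
        using measurable_compose[OF borel_measurable_Pair[OF borel_measurable_const that] W_meas] by simp
      have [measurable]: "(\<lambda>w::'a \<times> 'a. W (t, fst w)) \<in> borel_measurable borel" "(\<lambda>w::'a \<times> 'a. W (t', snd w)) \<in> borel_measurable borel"
        by (rule mW, measurable)+
      have mm: "(\<lambda>w. ennreal (W (t, fst w) ^ (?d + 2)) * ennreal (W (t', snd w) ^ (?d + 2))) \<in> borel_measurable lborel"
        by measurable
      have "(\<integral>\<^sup>+ w. ennreal (W (t, fst w) ^ (?d + 2)) * ennreal (W (t', snd w) ^ (?d + 2)) \<partial>lborel) =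
        (\<integral>\<^sup>+ x. \<integral>\<^sup>+ x'. ennreal (W (t, x) ^ (?d + 2)) * ennreal (W (t', x') ^ (?d + 2)) \<partial>lborel \<partial>lborel)"
        by (subst nn_integral_lborel_pair) auto
      also have "\<dots> = (\<integral>\<^sup>+ x. ennreal (W (t, x) ^ (?d + 2)) \<partial>lborel) * (\<integral>\<^sup>+ x. ennreal (W (t', x) ^ (?d + 2)) \<partial>lborel)"
        by (subst nn_integral_cmult, measurable, subst nn_integral_multc, auto)
      finally show ?thesis unfolding nn_integral_cmult[OF mm] by simp
    qed
    also have "\<dots> \<le> ennreal ?X * (ennreal (A * H t) * ennreal (A * H t'))"
      by (intro mult_left_mono mult_mono WA) auto
    also have "\<dots> = ennreal (4 / cc ^ ?d * A\<^sup>2) * ennreal (H t * H t' * (1 / (R * K)) ^ ?d)"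
      using X0 A H_pos[of t] H_pos[of t'] K R cc_pos
      by (simp add: ennreal_mult[symmetric] power2_eq_square mult_ac)
    finally show "(\<integral>\<^sup>+ w. \<integral>\<^sup>+ l. ?f (regroup ((t, t'), w)) l \<partial>lborel \<partial>lborel)
      \<le> ennreal (4 / cc ^ ?d * A\<^sup>2) * ennreal (H t * H t' * (1 / (\<bar>t - t'\<bar> * ?K t t')) ^ ?d)"
      unfolding K_def R_def .
  qed
  also have "\<dots> = ennreal (4 / cc ^ ?d * A\<^sup>2) * (\<integral>\<^sup>+ t. \<integral>\<^sup>+ t'. ennreal (H t * H t' * (1 / (\<bar>t - t'\<bar> * ?K t t')) ^ ?d) \<partial>lborel \<partial>lborel)"
  proof -
    have "(\<integral>\<^sup>+ t'. ennreal (4 / cc ^ ?d * A\<^sup>2) * ennreal (H t * H t' * (1 / (\<bar>t - t'\<bar> * ?K t t')) ^ ?d) \<partial>lborel) =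
       ennreal (4 / cc ^ ?d * A\<^sup>2) * (\<integral>\<^sup>+ t'. ennreal (H t * H t' * (1 / (\<bar>t - t'\<bar> * ?K t t')) ^ ?d) \<partial>lborel)" for t
      by (rule nn_integral_cmult) measurable
    then show ?thesis by (simp only:) (rule nn_integral_cmult, measurable)
  qed
  also have "\<dots> \<le> ennreal (4 / cc ^ ?d * A\<^sup>2) * 9"
    by (intro mult_left_mono time_ker_cost H_pos H_int d) auto
  also have "\<dots> = ennreal (36 / cc ^ ?d * A\<^sup>2)"
    using cc_pos by (subst ennreal_numeral[symmetric], subst ennreal_mult[symmetric]) auto
  finally show ?thesis .
qed

end

end

section \<open>Powers on the extended half-line and Hoelder's inequality\<close>

lemma enn_powr_ennreal: "0 \<le> r \<Longrightarrow> enn_powr (ennreal r) s = ennreal (r powr s)"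
  by (simp add: enn_powr_def)

lemma enn_powr_top[simp]: "enn_powr \<infinity> s = \<infinity>" "enn_powr top s = top"
  by (simp_all add: enn_powr_def)

lemma enn_powr_zero[simp]: "enn_powr 0 s = 0"
  by (simp add: enn_powr_def)

lemma enn_powr_eq_0_iff: "enn_powr a s = 0 \<longleftrightarrow> a = 0"
  by (cases a) (auto simp: enn_powr_def)

lemma enn_powr_mono: "a \<le> b \<Longrightarrow> 0 \<le> s \<Longrightarrow> enn_powr a s \<le> enn_powr b s"
  by (cases a; cases b) (auto simp: enn_powr_def powr_mono2 top_unique intro!: ennreal_leI)

lemma enn_powr_enn_powr: "enn_powr (enn_powr a r) s = enn_powr a (r * s)"
  by (cases a) (auto simp: enn_powr_def powr_powr)

lemma enn_powr_one[simp]: "enn_powr a 1 = a"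
  by (cases a) (auto simp: enn_powr_def)

lemma enn_powr_mult:
  assumes "s > 0" shows "enn_powr (a * b) s = enn_powr a s * enn_powr b s"
proof (cases "a = \<infinity> \<or> b = \<infinity>")
  case False
  then obtain x y where "a = ennreal x" "b = ennreal y" "x \<ge> 0" "y \<ge> 0" by (cases a; cases b) auto
  then show ?thesis by (simp add: enn_powr_ennreal ennreal_mult[symmetric] powr_mult)
next
  case True
  then show ?thesis by (cases "a = 0 \<or> b = 0") (auto simp: ennreal_mult_top ennreal_top_mult enn_powr_eq_0_iff)
qed

text \<open>A monotone map with open range is continuous for the order topology, and the power
  \<open>1 / s\<close> shows that the range is everything.\<close>

lemma continuous_enn_powr:
  assumes "s > 0" shows "continuous_on UNIV (\<lambda>a. enn_powr a s)"
proof (rule continuous_onI_mono)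
  have "b = enn_powr (enn_powr b (1/s)) s" for b using assms by (simp add: enn_powr_enn_powr)
  then have "range (\<lambda>a. enn_powr a s) = UNIV" by (metis surjI)
  then show "open (range (\<lambda>a. enn_powr a s))" by simp
qed (use assms in \<open>auto intro: enn_powr_mono\<close>)

lemma borel_measurable_enn_powr:
  assumes "s > 0" "f \<in> borel_measurable M" shows "(\<lambda>x. enn_powr (f x) s) \<in> borel_measurable M"
  using measurable_compose[OF assms(2) borel_measurable_continuous_onI[OF continuous_enn_powr[OF assms(1)]]] by simp

text \<open>Young's inequality for the functions normalised to integral 1. If one integral vanishes,
  so does the left-hand side; if one is infinite and none vanishes, the right-hand side is
  infinite.\<close>

lemma Holder_nn_integral:
  fixes a b :: "'a \<Rightarrow> real"
  assumes [measurable]: "a \<in> borel_measurable M" "b \<in> borel_measurable M"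
    and nn: "\<And>x. a x \<ge> 0" "\<And>x. b x \<ge> 0" and xy: "x > 0" "y > 0" "x + y = 1"
  shows "(\<integral>\<^sup>+ w. ennreal (a w powr x * b w powr y) \<partial>M) \<le> enn_powr (\<integral>\<^sup>+ w. ennreal (a w) \<partial>M) x * enn_powr (\<integral>\<^sup>+ w. ennreal (b w) \<partial>M) y"
    (is "_ \<le> enn_powr ?A x * enn_powr ?B y")
proof (cases "?A = 0 \<or> ?B = 0")
  case True
  then have "AE w in M. a w = 0 \<or> b w = 0"
    by (auto simp: nn_integral_0_iff_AE elim!: eventually_mono) (use nn in \<open>auto simp: order_antisym\<close>)
  then have "(\<integral>\<^sup>+ w. ennreal (a w powr x * b w powr y) \<partial>M) = 0"
    by (subst nn_integral_0_iff_AE) (auto elim!: eventually_mono)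
  then show ?thesis by simp
next
  case False
  show ?thesis
  proof (cases "?A = \<infinity> \<or> ?B = \<infinity>")
    case True
    then show ?thesis using False by (auto simp: ennreal_mult_top ennreal_top_mult enn_powr_eq_0_iff)
  next
    case fin: False
    obtain \<alpha> where \<alpha>: "?A = ennreal \<alpha>" "\<alpha> \<ge> 0" using fin by (cases ?A) auto
    obtain \<beta> where \<beta>: "?B = ennreal \<beta>" "\<beta> \<ge> 0" using fin by (cases ?B) auto
    have pos: "\<alpha> > 0" "\<beta> > 0" using False \<alpha> \<beta> by (auto simp: less_le)
    let ?c = "\<alpha> powr x * \<beta> powr y"
    have pw: "a w powr x * b w powr y \<le> ?c * (x / \<alpha>) * a w + ?c * (y / \<beta>) * b w" for w
    proof (cases "a w = 0 \<or> b w = 0")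
      case True then show ?thesis using nn pos xy by auto
    next
      case False
      then have p: "a w / \<alpha> > 0" "b w / \<beta> > 0" using nn[of w] pos by (auto simp: less_le)
      have "a w powr x * b w powr y = ?c * ((a w / \<alpha>) powr x * (b w / \<beta>) powr y)"
        using pos nn[of w] by (simp add: powr_divide)
      also have "\<dots> \<le> ?c * (x * (a w / \<alpha>) + y * (b w / \<beta>))"
        using Youngs_inequality_0[of x y, OF _ _ xy(3) p] xy by (intro mult_left_mono) auto
      finally show ?thesis by (simp add: algebra_simps)
    qed
    have "(\<integral>\<^sup>+ w. ennreal (a w powr x * b w powr y) \<partial>M) \<le> (\<integral>\<^sup>+ w. ennreal (?c * (x / \<alpha>)) * ennreal (a w) + ennreal (?c * (y / \<beta>)) * ennreal (b w) \<partial>M)"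
      using pw nn pos xy by (intro nn_integral_mono) (auto simp: ennreal_mult[symmetric] ennreal_plus[symmetric] simp del: ennreal_plus intro!: ennreal_leI)
    also have "\<dots> = ennreal (?c * (x / \<alpha>)) * ?A + ennreal (?c * (y / \<beta>)) * ?B"
      by (subst nn_integral_add, measurable, subst nn_integral_cmult, measurable, subst nn_integral_cmult, measurable)
    also have "\<dots> = ennreal (?c * (x / \<alpha>) * \<alpha> + ?c * (y / \<beta>) * \<beta>)"
      unfolding \<alpha> \<beta> using pos xy by (simp add: ennreal_mult[symmetric] ennreal_plus[symmetric] del: ennreal_plus)
    also have "?c * (x / \<alpha>) * \<alpha> + ?c * (y / \<beta>) * \<beta> = ?c * (x + y)" using pos by (simp add: field_simps)
    finally show ?thesis unfolding \<alpha> \<beta> using pos xy by (simp add: enn_powr_ennreal ennreal_mult[symmetric])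
  qed
qed

lemma Holder_sum:
  fixes a b :: "'a \<Rightarrow> real"
  assumes fin: "finite J" and nn: "\<And>x. a x \<ge> 0" "\<And>x. b x \<ge> 0" and xy: "x > 0" "y > 0" "x + y = 1"
  shows "(\<Sum>w\<in>J. a w powr x * b w powr y) \<le> (\<Sum>w\<in>J. a w) powr x * (\<Sum>w\<in>J. b w) powr y"
proof -
  have "ennreal (\<Sum>w\<in>J. a w powr x * b w powr y) = (\<integral>\<^sup>+ w. ennreal (a w powr x * b w powr y) \<partial>count_space J)"
    using nn by (subst nn_integral_count_space_finite[OF fin]) (simp add: sum_ennreal)
  also have "\<dots> \<le> enn_powr (\<integral>\<^sup>+ w. ennreal (a w) \<partial>count_space J) x * enn_powr (\<integral>\<^sup>+ w. ennreal (b w) \<partial>count_space J) y"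
    by (rule Holder_nn_integral[OF _ _ nn xy]) auto
  also have "\<dots> = ennreal ((\<Sum>w\<in>J. a w) powr x * (\<Sum>w\<in>J. b w) powr y)"
    using nn by (simp add: nn_integral_count_space_finite[OF fin] sum_ennreal sum_nonneg enn_powr_ennreal ennreal_mult[symmetric])
  finally show ?thesis using nn by (simp add: sum_nonneg)
qed

text \<open>\<open>36\<close> is \<open>4\<close> from \<open>level_set_bound\<close> times \<open>9\<close> from \<open>time_ker_cost\<close>; the power is \<open>(1 / cc) ^ d\<close>.\<close>

definition core_const :: "nat \<Rightarrow> real" where "core_const d = 36 * (4 * (4 * real d + 3)) ^ d"

lemma core_const_pos: "core_const d > 0"
  unfolding core_const_def by (intro mult_pos_pos zero_less_power) auto

section \<open>Choice of the density in time\<close>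

context strichartz_core
begin

text \<open>\<open>H\<close> is essentially the time density of the power d+2 of \<open>W\<close>,
  divided by \<open>A\<close>. The strict inequality in the assumption leaves the mass
  \<open>1 - w / A\<close> for a positive summand.\<close>

lemma core_bound:
  assumes A: "(\<integral>\<^sup>+ z. ennreal (W z ^ (DIM('a) + 2)) \<partial>lborel) < ennreal A"
  shows "(\<Sum>j\<in>J. sqrt (\<beta>2 j) ^ (DIM('a) + 2)) \<le> core_const DIM('a) * A\<^sup>2"
proof -
  let ?m = "DIM('a) + 2"
  have A0: "A > 0" using A by (metis ennreal_less_zero_iff le_less_trans zero_le)
  obtain w where w: "(\<integral>\<^sup>+ z. ennreal (W z ^ ?m) \<partial>lborel) = ennreal w" "w \<ge> 0"
    using A by (cases "(\<integral>\<^sup>+ z. ennreal (W z ^ ?m) \<partial>lborel)") auto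
  have wA: "w < A" using A unfolding w(1) using w(2) by (simp add: ennreal_less_iff)
  define r where "r t = (LBINT x. W (t, x) ^ ?m)" for t
  have Wi: "integrable lborel (\<lambda>x. W (t, x) ^ ?m)" for t
  proof (rule integrable_bounded_support[OF _ bd_snd])
    show "norm (W (t, x) ^ ?m) \<le> (2 powi N) ^ ?m" for x
      using W_le[of "(t, x)"] W_nonneg[of "(t, x)"] unfolding norm_power by (intro power_mono) auto
    show "W (t, x) ^ ?m = 0" if "x \<notin> snd ` S" for x using that W_out[of "(t, x)"] by force
  qed measurable
  have r0: "r t \<ge> 0" for t unfolding r_def by (intro Bochner_Integration.integral_nonneg) (simp add: W_nonneg)
  have [measurable]: "r \<in> borel_measurable borel" unfolding r_def[abs_def] by measurable
  have r_nn: "(\<integral>\<^sup>+ x. ennreal (W (t, x) ^ ?m) \<partial>lborel) = ennreal (r t)" for t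
    unfolding r_def by (rule nn_integral_eq_integral[OF Wi]) (simp add: W_nonneg)
  have r_int: "(\<integral>\<^sup>+ t. ennreal (r t) \<partial>lborel) = ennreal w"
  proof -
    have "(\<integral>\<^sup>+ t. ennreal (r t) \<partial>lborel) = (\<integral>\<^sup>+ t. \<integral>\<^sup>+ x. ennreal (W (t, x) ^ ?m) \<partial>lborel \<partial>lborel)" by (simp only: r_nn)
    also have "\<dots> = (\<integral>\<^sup>+ z. ennreal (W z ^ ?m) \<partial>lborel)"
      by (subst nn_integral_lborel_pair) auto
    finally show ?thesis unfolding w(1) .
  qed
  \<comment> \<open>The Gaussian summand only serves to make \<open>H\<close> strictly positive.\<close>
  define H where "H t = r t / A + (1 - w / A) * std_normal_density t" for t
  have q: "1 - w / A > 0" using wA A0 by simp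
  have [measurable]: "H \<in> borel_measurable borel" unfolding H_def[abs_def] by measurable
  have Hpos: "H t > 0" for t
    unfolding H_def using r0[of t] A0 q by (intro add_nonneg_pos mult_pos_pos normal_density_pos) auto
  have sn: "(\<integral>\<^sup>+ t. ennreal (std_normal_density t) \<partial>lborel) = 1"
    using integral_normal_density[of 1 0] integrable_normal_density[of 1 0]
    by (subst nn_integral_eq_integral) (auto simp del: nn_integral_eq_integral)
  have "(\<integral>\<^sup>+ t. ennreal (H t) \<partial>lborel) = (\<integral>\<^sup>+ t. ennreal (1 / A) * ennreal (r t) + ennreal (1 - w / A) * ennreal (std_normal_density t) \<partial>lborel)"
    using A0 q r0 by (intro nn_integral_cong) (auto simp: H_def ennreal_plus ennreal_mult[symmetric])
  also have "\<dots> = ennreal (1 / A) * ennreal w + ennreal (1 - w / A) * 1"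
    by (subst nn_integral_add, measurable, subst nn_integral_cmult, measurable, subst nn_integral_cmult, measurable, simp add: r_int sn)
  also have "\<dots> = 1"
    using A0 q w(2) by (simp add: ennreal_mult[symmetric] ennreal_plus[symmetric] del: ennreal_plus)
  finally have Hint: "(\<integral>\<^sup>+ t. ennreal (H t) \<partial>lborel) \<le> 1" by simp
  have "(\<integral>\<^sup>+ x. ennreal (W (t, x) ^ ?m) \<partial>lborel) \<le> ennreal (A * H t)" for t
  proof -
    have "A * H t = r t + A * ((1 - w / A) * std_normal_density t)" using A0 by (simp add: H_def field_simps)
    also have "\<dots> \<ge> r t" using A0 q by simp
    finally show ?thesis unfolding r_nn by (rule ennreal_leI)
  qed
  note core_bound_weighted[of H A, OF _ Hpos Hint _ this]
  then have "ennreal (\<Sum>j\<in>J. sqrt (\<beta>2 j) ^ ?m) \<le> ennreal (36 / cc ^ DIM('a) * A\<^sup>2)" using A0 by simp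
  moreover have "0 \<le> 36 / cc ^ DIM('a) * A\<^sup>2" by (simp add: cc_def)
  ultimately have "(\<Sum>j\<in>J. sqrt (\<beta>2 j) ^ ?m) \<le> 36 / cc ^ DIM('a) * A\<^sup>2" by (simp add: ennreal_le_iff)
  then show ?thesis by (simp add: core_const_def cc_def power_divide)
qed

end

section \<open>The propagator as an instance of the core setting\<close>

lemma norm_schr_ext_le:
  fixes u :: "'a::euclidean_space \<Rightarrow> complex"
  assumes u: "integrable lborel u"
  shows "norm (schr_ext u t x) \<le> schr_amp DIM('a) t * (LBINT y. norm (u y))"
proof -
  have [measurable]: "u \<in> borel_measurable borel" using u by (auto dest: borel_measurable_integrable)
  have "norm (LBINT y. cis (schr_phase t x y) * u y) \<le> (LBINT y. norm (u y))"
    by (rule Bochner_Integration.integral_norm_bound_integral)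
      (auto simp: norm_mult u intro!: Bochner_Integration.integrable_bound[OF u])
  then show ?thesis by (simp add: schr_ext_def norm_mult mult_left_mono)
qed

lemma norm_schr_gram_le:
  fixes v x x' :: "'a::euclidean_space"
  shows "norm (schr_gram v t x t' x') \<le> schr_amp DIM('a) t * schr_amp DIM('a) t' * measure lborel (cbox (-v) v)"
proof -
  have "norm (LBINT y. indicator (cbox (-v) v) y *\<^sub>R cis (schr_phase t x y - schr_phase t' x' y)) \<le> (LBINT y. indicator (cbox (-v) v) y)"
  proof (rule Bochner_Integration.integral_norm_bound_integral)
    show "integrable lborel (\<lambda>y. indicator (cbox (-v) v) y *\<^sub>R cis (schr_phase t x y - schr_phase t' x' y))"
      using emeasure_bounded_finite[OF bounded_cbox, of "-v" v] by (intro integrable_indicator_cis) auto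
  qed (rule integrable_indicator_cbox, simp)
  then show ?thesis unfolding schr_gram_def norm_mult norm_of_real
    by (intro mult_mono) (auto simp: abs_mult)
qed

lemma schr_amp_antimono: "0 < s \<Longrightarrow> s \<le> \<bar>t\<bar> \<Longrightarrow> schr_amp d t \<le> schr_amp d s"
  unfolding schr_amp_def by (intro power_mono divide_left_mono real_sqrt_le_mono mult_left_mono) auto

text \<open>At distance \<open>s\<close> from time 0 the amplitude is at most its value at
  \<open>s\<close>, so the evolved functions and the kernel are bounded on \<open>S\<close>. The
  bound \<open>B\<close> is left existential because no later constant depends on it.\<close>

lemma strichartz_core_schr:
  fixes u :: "nat \<Rightarrow> 'a::euclidean_space \<Rightarrow> complex"
  assumes fin: "finite J" and b: "bessel_system J u" and um: "\<And>j. u j \<in> borel_measurable borel"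
    and supp: "\<And>j x. j \<in> J \<Longrightarrow> x \<notin> cbox (-v) v \<Longrightarrow> u j x = 0"
    and S: "bounded S" "\<And>z. z \<in> S \<Longrightarrow> s \<le> \<bar>fst z\<bar>" "s > 0"
    and W: "W \<in> borel_measurable borel" "\<And>z. z \<in> S \<Longrightarrow> \<exists>i\<in>{-N..N}. W z = 2 powi i" "\<And>z. z \<notin> S \<Longrightarrow> W z = 0"
  shows "\<exists>B. strichartz_core S W (\<lambda>j z. schr_ext (u j) (fst z) (snd z)) (\<lambda>z z'. schr_gram v (fst z) (snd z) (fst z') (snd z')) J N B"
proof -
  have uL: "L2 (u j)" if "j \<in> J" for j using b that by (simp add: bessel_system_def)
  have ui: "integrable lborel (u j)" if "j \<in> J" for j by (rule L2_cbox_integrable[OF uL[OF that] supp[OF that]])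
  note um[measurable] W(1)[measurable]
  let ?a = "schr_amp DIM('a)"
  define U where "U = (\<Sum>j\<in>J. LBINT y. norm (u j y))"
  have Uj: "(LBINT y. norm (u j y)) \<le> U" if "j \<in> J" for j
    unfolding U_def by (rule member_le_sum[OF that]) (auto intro!: Bochner_Integration.integral_nonneg fin)
  have U0: "U \<ge> 0" unfolding U_def by (intro sum_nonneg Bochner_Integration.integral_nonneg) auto
  define B where "B = ?a s * U + ?a s * ?a s * measure lborel (cbox (-v) v)"
  have t_nz: "fst z \<noteq> 0" if "z \<in> S" for z using S(2)[OF that] S(3) by auto
  have e_le: "norm (schr_ext (u j) (fst z) (snd z)) \<le> ?a s * U" if "j \<in> J" "z \<in> S" for j z
  proof -
    have "norm (schr_ext (u j) (fst z) (snd z)) \<le> ?a (fst z) * (LBINT y. norm (u j y))" by (rule norm_schr_ext_le[OF ui[OF that(1)]])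
    also have "\<dots> \<le> ?a s * U" using that S(2,3)
      by (intro mult_mono schr_amp_antimono Uj) (auto intro!: Bochner_Integration.integral_nonneg)
    finally show ?thesis .
  qed
  have Wle: "\<bar>W z\<bar> \<le> 2 powi N" for z
  proof (cases "z \<in> S")
    case True
    then obtain i where "i \<in> {-N..N}" "W z = 2 powi i" using W(2)[OF True] by blast
    then show ?thesis by (simp add: power_int_increasing)
  qed (simp add: W(3))
  have "strichartz_core S W (\<lambda>j z. schr_ext (u j) (fst z) (snd z)) (\<lambda>z z'. schr_gram v (fst z) (snd z) (fst z') (snd z')) J N B"
  proof
    show "B \<ge> 0" unfolding B_def using U0 by simp
    show "norm (schr_ext (u j) (fst z) (snd z)) \<le> B" if "j \<in> J" "z \<in> S" for j z
      using e_le[OF that] by (simp add: B_def add_increasing2)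
    show "norm (schr_gram v (fst z) (snd z) (fst z') (snd z')) \<le> B" if "z \<in> S" "z' \<in> S" for z z'
    proof -
      have "norm (schr_gram v (fst z) (snd z) (fst z') (snd z')) \<le> ?a (fst z) * ?a (fst z') * measure lborel (cbox (-v) v)"
        by (rule norm_schr_gram_le)
      also have "\<dots> \<le> ?a s * ?a s * measure lborel (cbox (-v) v)"
        using that S(2,3) by (intro mult_right_mono mult_mono schr_amp_antimono) auto
      also have "\<dots> \<le> B" using U0 by (simp add: B_def)
      finally show ?thesis .
    qed
    show "norm (schr_gram v (fst z) (snd z) (fst z') (snd z')) \<le> (1 / sqrt \<bar>fst z - fst z'\<bar>) ^ DIM('a)"
      if "z \<in> S" "z' \<in> S" "fst z \<noteq> fst z'" for z z'
      using that t_nz by (intro schr_gram_bound) auto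
    fix j assume j: "j \<in> J"
    let ?F = "\<lambda>z. complex_of_real (W z) * (W z * schr_ext (u j) (fst z) (snd z))"
    have "integrable lborel (\<lambda>z. of_real (?a (fst z)) * ?F z)"
    proof (rule integrable_bounded_support[OF _ S(1)])
      fix z assume z: "z \<in> S"
      show "norm (of_real (?a (fst z)) * ?F z) \<le> ?a s * (2 powi N * (2 powi N * (?a s * U)))"
        unfolding norm_mult norm_of_real using S(2)[OF z] S(3) U0
        by (intro mult_mono e_le[OF j z]) (auto intro!: schr_amp_antimono Wle)
    qed (auto simp: W(3))
    from gram_bessel[OF fin b supp this]
    have g: "(\<Sum>i\<in>J. (norm (LBINT z. cnj (schr_ext (u i) (fst z) (snd z)) * ?F z))\<^sup>2) \<le>
      Re (LBINT p. cnj (?F (fst p)) * ?F (snd p) * schr_gram v (fst (fst p)) (snd (fst p)) (fst (snd p)) (snd (snd p)))" .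
    have "(LBINT z. cnj (W z * schr_ext (u i) (fst z) (snd z)) * (W z * schr_ext (u j) (fst z) (snd z))) =
      (LBINT z. cnj (schr_ext (u i) (fst z) (snd z)) * ?F z)" for i
      by (intro Bochner_Integration.integral_cong refl) simp
    with g show "(\<Sum>i\<in>J. (norm (LBINT z. cnj (W z * schr_ext (u i) (fst z) (snd z)) * (W z * schr_ext (u j) (fst z) (snd z))))\<^sup>2) \<le>
      Re (LBINT p. cnj (?F (fst p)) * ?F (snd p) * schr_gram v (fst (fst p)) (snd (fst p)) (fst (snd p)) (snd (snd p)))"
      by (simp only:)
  qed (use fin S t_nz W schr_gram_form_bound in \<open>auto intro: schr_gram_form_bound\<close>)
  then show ?thesis ..
qed

section \<open>The endpoint \<open>q = 1 + 2 / d\<close> and interpolation\<close>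

text \<open>Read off from an inequality x \<le> M x^(2/(d+2)): the outer 4 is the square of the
  dyadic rounding error 2, the inner 4 comes from doubling x to obtain a strict bound in
  \<open>core_bound\<close>, and the outer power inverts x^(d/(d+2)).\<close>

definition end_const :: "nat \<Rightarrow> real" where
  "end_const d = (4 * (4 * core_const d) powr (1 / (real d + 2))) powr ((real d + 2) / real d)"

lemma end_const_pos: "end_const d > 0"
  using core_const_pos[of d] by (simp add: end_const_def)

lemma schr_ext_0: "schr_ext u 0 x = 0"
  by (simp add: schr_ext_def schr_amp_def)

lemma dyadic_floor:
  fixes y :: real
  assumes "y > 0"
  shows "2 powr real_of_int \<lfloor>log 2 y\<rfloor> \<le> y" "y < 2 * 2 powr real_of_int \<lfloor>log 2 y\<rfloor>"
proof -
  have "2 powr real_of_int \<lfloor>log 2 y\<rfloor> \<le> 2 powr (log 2 y)" by (intro powr_mono) auto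
  then show "2 powr real_of_int \<lfloor>log 2 y\<rfloor> \<le> y" using assms by simp
  have "2 powr (log 2 y) < 2 powr (1 + real_of_int \<lfloor>log 2 y\<rfloor>)" by (intro powr_less_mono) linarith+
  then show "y < 2 * 2 powr real_of_int \<lfloor>log 2 y\<rfloor>" using assms by (simp add: powr_add)
qed

text \<open>The integral \<open>x\<close> of E^q over \<open>S n\<close> is that of \<open>E\<close>
  times the square of \<open>y\<close>, at most 4 times the sum of \<open>\<nu> j * nrm j\<close>.
  Hoelder and \<open>core_bound\<close> bound the latter by a multiple of x^(2/(d+2)), and since
  \<open>x\<close> is finite one may divide. \<open>S n\<close> is cut out so that \<open>x\<close>
  is finite, times stay away from 0 and \<open>W\<close> has finitely many levels.\<close>

lemma endpoint_local:
  fixes u :: "nat \<Rightarrow> 'a::euclidean_space \<Rightarrow> complex" and \<nu> :: "nat \<Rightarrow> real"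
  assumes fin: "finite J" and b: "bessel_system J u" and um[measurable]: "\<And>j. u j \<in> borel_measurable borel"
    and supp: "\<And>j x. j \<in> J \<Longrightarrow> x \<notin> cbox (-v) v \<Longrightarrow> u j x = 0" and \<nu>: "\<And>j. \<nu> j \<ge> 0"
  defines "E \<equiv> \<lambda>z. \<Sum>j\<in>J. \<nu> j * (norm (schr_ext (u j) (fst z) (snd z)))\<^sup>2"
  defines "S \<equiv> \<lambda>n::nat. {z. norm z \<le> real (Suc n) \<and> 1 / real (Suc n) \<le> \<bar>fst z\<bar> \<and> 1 / real (Suc n) \<le> E z \<and> E z \<le> real (Suc n)}"
  shows "(\<integral>\<^sup>+ z. ennreal (E z powr ((real DIM('a) + 2) / real DIM('a))) * indicator (S n) z \<partial>lborel)
    \<le> ennreal (end_const DIM('a) * (\<Sum>j\<in>J. \<nu> j powr ((real DIM('a) + 2) / (real DIM('a) + 1))) powr ((real DIM('a) + 1) / real DIM('a)))"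
proof -
  let ?d = "real DIM('a)"
  have d: "?d \<ge> 1" by (simp add: DIM_positive Suc_leI)
  let ?q = "(?d + 2) / ?d" and ?\<alpha> = "(?d + 2) / (?d + 1)"
  let ?n = "real (Suc n)"
  have n1: "?n \<ge> 1" by simp
  have Em[measurable]: "E \<in> borel_measurable borel" unfolding E_def by measurable
  have E0: "E z \<ge> 0" for z unfolding E_def using \<nu> by (intro sum_nonneg mult_nonneg_nonneg) auto
  have Sm[measurable]: "S n \<in> sets borel" unfolding S_def by measurable
  have Sb: "bounded (S n)" unfolding S_def bounded_iff by auto
  \<comment> \<open>Duality: \<open>W\<^sup>2\<close> is, up to dyadic rounding, the extremal test function \<open>E powr (q - 1)\<close>.\<close>
  define y where "y z = E z powr (1 / ?d)" for z
  define i where "i z = \<lfloor>log 2 (y z)\<rfloor>" for z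
  define W where "W z = (if z \<in> S n then 2 powr real_of_int (i z) else 0)" for z
  have Wm[measurable]: "W \<in> borel_measurable borel" unfolding W_def[abs_def] i_def y_def by measurable
  have y: "1 / ?n \<le> y z" "y z \<le> ?n" if "z \<in> S n" for z
  proof -
    have e: "1 / ?n \<le> E z" "E z \<le> ?n" using that by (auto simp: S_def)
    have "1 / ?n = (1 / ?n) powr 1" by simp
    also have "\<dots> \<le> (1 / ?n) powr (1 / ?d)" using n1 d by (intro powr_mono') auto
    also have "\<dots> \<le> y z" unfolding y_def using e d by (intro powr_mono2) auto
    finally show "1 / ?n \<le> y z" .
    have "y z \<le> ?n powr (1 / ?d)" unfolding y_def using e E0 d by (intro powr_mono2) auto
    also have "\<dots> \<le> ?n powr 1" using n1 d by (intro powr_mono) auto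
    finally show "y z \<le> ?n" by simp
  qed
  have ypos: "y z > 0" if "z \<in> S n" for z using y(1)[OF that] n1 by (meson divide_pos_pos less_le_trans of_nat_0_less_iff zero_less_Suc zero_less_one)
  have W1: "W z \<le> y z" "y z < 2 * W z" if "z \<in> S n" for z
    using dyadic_floor[OF ypos[OF that]] that by (auto simp: W_def i_def)
  have W0: "W z \<ge> 0" for z by (simp add: W_def)
  \<comment> \<open>On \<open>S n\<close> the function \<open>y\<close> lies between
    \<open>1 / ?n\<close> and \<open>?n\<close>; this crude bound then places the dyadic exponents
    between \<open>- ?n\<close> and \<open>?n\<close>.\<close>
  have lg: "log 2 ?n \<le> ?n"
  proof -
    have "?n \<le> 2 ^ Suc n" using of_nat_less_two_power[of "Suc n", where 'a=real] by simp
    then have "?n \<le> 2 powr real (Suc n)" by (subst powr_realpow) auto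
    then show ?thesis by (subst log_le_iff) auto
  qed
  have Wd: "\<exists>i\<in>{- int (Suc n)..int (Suc n)}. W z = 2 powi i" if z: "z \<in> S n" for z
  proof (rule bexI[of _ "i z"])
    show "W z = 2 powi i z" using z by (simp add: W_def powr_real_of_int')
    have "log 2 (y z) \<le> log 2 ?n" using y(2)[OF z] ypos[OF z] by simp
    then have u: "log 2 (y z) \<le> ?n" using lg by linarith
    have "log 2 (1 / ?n) \<le> log 2 (y z)" using y(1)[OF z] ypos[OF z] by (subst log_le_cancel_iff) auto
    then have l: "- ?n \<le> log 2 (y z)" using lg by (simp add: log_divide)
    show "i z \<in> {- int (Suc n)..int (Suc n)}" using u l unfolding i_def by (auto simp: le_floor_iff floor_le_iff)
  qed
  have Wo: "W z = 0" if "z \<notin> S n" for z using that by (simp add: W_def)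
  have S2: "1 / ?n \<le> \<bar>fst z\<bar>" if "z \<in> S n" for z using that by (auto simp: S_def)
  obtain B where "strichartz_core (S n) W (\<lambda>j z. schr_ext (u j) (fst z) (snd z)) (\<lambda>z z'. schr_gram v (fst z) (snd z) (fst z') (snd z')) J (int (Suc n)) B"
    using strichartz_core_schr[OF fin b um supp Sb S2 _ Wm Wd Wo] by auto
  then interpret sc: strichartz_core "S n" W "\<lambda>j z. schr_ext (u j) (fst z) (snd z)" "\<lambda>z z'. schr_gram v (fst z) (snd z) (fst z') (snd z')" J "int (Suc n)" B .
  define x where "x = (LBINT z. E z powr ?q * indicator (S n) z)"
  have xi: "integrable lborel (\<lambda>z. E z powr ?q * indicator (S n) z)"
  proof (rule integrable_bounded_support[OF _ Sb])
    show "norm (E z powr ?q * indicator (S n) z) \<le> ?n powr ?q" if "z \<in> S n" for z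
      using that E0[of z] d by (auto simp: S_def intro!: powr_mono2)
  qed auto
  have x0: "x \<ge> 0" unfolding x_def by (intro Bochner_Integration.integral_nonneg) auto
  have xnn: "(\<integral>\<^sup>+ z. ennreal (E z powr ?q) * indicator (S n) z \<partial>lborel) = ennreal x"
    unfolding x_def by (subst nn_integral_eq_integral[OF xi, symmetric]) (auto simp: ennreal_mult ennreal_indicator)
  let ?V = "(\<Sum>j\<in>J. \<nu> j powr ?\<alpha>)"
  have V0: "?V \<ge> 0" by (intro sum_nonneg) auto
  have "x \<le> end_const DIM('a) * ?V powr ((?d + 1) / ?d)"
  proof (cases "x = 0")
    case True then show ?thesis using end_const_pos[of "DIM('a)"] by simp
  next
    case False
    then have xp: "x > 0" using x0 by simp
    have gi: "integrable lborel (\<lambda>z. \<nu> j * (norm (sc.g j z))\<^sup>2)" if "j \<in> J" for j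
      by (intro integrable_mult_right sc.g_sq_integrable that)
    have "x \<le> (LBINT z. 4 * (\<Sum>j\<in>J. \<nu> j * (norm (sc.g j z))\<^sup>2))"
      unfolding x_def
    proof (rule integral_mono[OF xi])
      show "integrable lborel (\<lambda>z. 4 * (\<Sum>j\<in>J. \<nu> j * (norm (sc.g j z))\<^sup>2))"
        by (intro integrable_mult_right Bochner_Integration.integrable_sum gi)
      fix z
      have gE: "(\<Sum>j\<in>J. \<nu> j * (norm (sc.g j z))\<^sup>2) = (W z)\<^sup>2 * E z"
        by (simp add: sc.g_def E_def norm_mult power_mult_distrib sum_distrib_left mult_ac)
      show "E z powr ?q * indicator (S n) z \<le> 4 * (\<Sum>j\<in>J. \<nu> j * (norm (sc.g j z))\<^sup>2)"
      proof (cases "z \<in> S n")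
        case True
        have Ep: "E z > 0" using True n1 unfolding S_def by (auto intro: less_le_trans[rotated])
        have "E z powr ?q = E z * (y z)\<^sup>2"
        proof -
          have "?q = 1 + 2 / ?d" using d by (simp add: field_simps)
          moreover have "(y z)\<^sup>2 = E z powr (2 / ?d)" by (simp add: y_def power2_eq_square powr_add[symmetric])
          ultimately show ?thesis using Ep by (simp add: powr_add)
        qed
        also have "\<dots> \<le> E z * (2 * W z)\<^sup>2"
          using W1(2)[OF True] ypos[OF True] E0 by (intro mult_left_mono power_mono) auto
        finally show ?thesis using True unfolding gE by (simp add: power_mult_distrib mult_ac)
      next
        case False
        then show ?thesis using \<nu> by (auto intro!: mult_nonneg_nonneg sum_nonneg)
      qed
    qed
    also have "\<dots> = 4 * (\<Sum>j\<in>J. LBINT z. \<nu> j * (norm (sc.g j z))\<^sup>2)"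
      using Bochner_Integration.integral_sum[OF gi] by simp
    also have "\<dots> = 4 * (\<Sum>j\<in>J. \<nu> j * sc.nrm j)" by (simp add: sc.nrm_def)
    also have "\<dots> \<le> 4 * (\<Sum>j\<in>J. \<nu> j * sqrt (sc.\<beta>2 j))"
      by (intro mult_left_mono sum_mono sc.nrm_le \<nu>) auto
    also have "(\<Sum>j\<in>J. \<nu> j * sqrt (sc.\<beta>2 j)) = (\<Sum>j\<in>J. (\<nu> j powr ?\<alpha>) powr (1 / ?\<alpha>) * (sqrt (sc.\<beta>2 j) ^ (DIM('a) + 2)) powr (1 / (?d + 2)))"
    proof (intro sum.cong refl)
      fix j
      have "(\<nu> j powr ?\<alpha>) powr (1 / ?\<alpha>) = \<nu> j" using \<nu>[of j] d by (simp add: powr_powr)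
      moreover have "(sqrt (sc.\<beta>2 j) ^ (DIM('a) + 2)) powr (1 / (?d + 2)) = sqrt (sc.\<beta>2 j)"
      proof (cases "sc.\<beta>2 j = 0")
        case False
        then have "sqrt (sc.\<beta>2 j) > 0" using sc.\<beta>2_nonneg[of j] by simp
        then have "(sqrt (sc.\<beta>2 j) ^ (DIM('a) + 2)) powr (1 / (?d + 2)) = (sqrt (sc.\<beta>2 j) powr (?d + 2)) powr (1 / (?d + 2))"
          by (subst powr_realpow[symmetric]) (auto simp: add.commute)
        then show ?thesis using sc.\<beta>2_nonneg[of j] d by (simp add: powr_powr)
      qed simp
      ultimately show "\<nu> j * sqrt (sc.\<beta>2 j) = (\<nu> j powr ?\<alpha>) powr (1 / ?\<alpha>) * (sqrt (sc.\<beta>2 j) ^ (DIM('a) + 2)) powr (1 / (?d + 2))" by simp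
    qed
    also have "\<dots> \<le> ?V powr (1 / ?\<alpha>) * (\<Sum>j\<in>J. sqrt (sc.\<beta>2 j) ^ (DIM('a) + 2)) powr (1 / (?d + 2))"
      using d by (intro Holder_sum fin) (auto simp: sc.\<beta>2_nonneg field_simps)
    also have "(\<Sum>j\<in>J. sqrt (sc.\<beta>2 j) ^ (DIM('a) + 2)) powr (1 / (?d + 2)) \<le> (4 * core_const DIM('a) * x\<^sup>2) powr (1 / (?d + 2))"
    proof (rule powr_mono2)
      have "(\<integral>\<^sup>+ z. ennreal (W z ^ (DIM('a) + 2)) \<partial>lborel) \<le> (\<integral>\<^sup>+ z. ennreal (E z powr ?q) * indicator (S n) z \<partial>lborel)"
      proof (rule nn_integral_mono)
        fix z
        show "ennreal (W z ^ (DIM('a) + 2)) \<le> ennreal (E z powr ?q) * indicator (S n) z"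
        proof (cases "z \<in> S n")
          case True
          have "W z ^ (DIM('a) + 2) \<le> y z ^ (DIM('a) + 2)" using W1(1)[OF True] W0 by (intro power_mono) auto
          also have "\<dots> = y z powr (?d + 2)" using ypos[OF True] by (subst powr_realpow[symmetric]) (auto simp: add.commute)
          also have "\<dots> = E z powr ?q" by (simp add: y_def powr_powr)
          finally show ?thesis using True by (simp add: ennreal_leI)
        qed (simp add: Wo)
      qed
      \<comment> \<open>\<open>core_bound\<close> wants a strict bound, so it is applied with
        \<open>2 * x\<close>; this needs \<open>x\<close> positive.\<close>
      also have "\<dots> < ennreal (2 * x)" unfolding xnn using xp by (simp add: ennreal_less_iff)
      finally show "(\<Sum>j\<in>J. sqrt (sc.\<beta>2 j) ^ (DIM('a) + 2)) \<le> 4 * core_const DIM('a) * x\<^sup>2"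
        using sc.core_bound[of "2 * x"] by (simp add: power_mult_distrib mult_ac)
    qed (auto intro!: sum_nonneg simp: sc.\<beta>2_nonneg)
    finally have "x \<le> 4 * (?V powr (1 / ?\<alpha>) * (4 * core_const DIM('a) * x\<^sup>2) powr (1 / (?d + 2)))"
      by (auto simp: mult_left_mono)
    also have "\<dots> = (4 * (4 * core_const DIM('a)) powr (1 / (?d + 2)) * ?V powr (1 / ?\<alpha>)) * x powr (2 / (?d + 2))"
    proof -
      have "(x\<^sup>2) powr (1 / (?d + 2)) = x powr (2 / (?d + 2))"
        using xp by (simp add: powr_powr flip: powr_numeral)
      then show ?thesis using core_const_pos[of "DIM('a)"] by (simp add: powr_mult mult_ac)
    qed
    finally have le: "x \<le> (4 * (4 * core_const DIM('a)) powr (1 / (?d + 2)) * ?V powr (1 / ?\<alpha>)) * x powr (2 / (?d + 2))" (is "_ \<le> ?M * _") .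
    have "x powr (?d / (?d + 2)) = x / x powr (2 / (?d + 2))"
    proof -
      have "?d / (?d + 2) = 1 - 2 / (?d + 2)" using d by (simp add: field_simps)
      then show ?thesis using xp by (simp add: powr_diff)
    qed
    also have "\<dots> \<le> ?M" using le xp by (simp add: divide_le_eq)
    finally have "x powr (?d / (?d + 2)) \<le> ?M" .
    then have "(x powr (?d / (?d + 2))) powr ?q \<le> ?M powr ?q" using d by (intro powr_mono2) auto
    moreover have "(x powr (?d / (?d + 2))) powr ?q = x" using xp d by (simp add: powr_powr)
    moreover have "?M powr ?q = end_const DIM('a) * ?V powr ((?d + 1) / ?d)"
    proof -
      have "?d + 2 \<noteq> 0" using d by linarith
      then have "1 / ?\<alpha> * ?q = (?d + 1) / ?d" by simp
      then have "(?V powr (1 / ?\<alpha>)) powr ?q = ?V powr ((?d + 1) / ?d)" by (simp only: powr_powr)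
      then show ?thesis by (simp only: powr_mult end_const_def)
    qed
    ultimately show ?thesis by simp
  qed
  then show ?thesis unfolding xnn by (rule ennreal_leI)
qed

text \<open>The sets \<open>S n\<close> eventually contain every point where \<open>E\<close> is
  positive, and Fatou's lemma removes the restriction. Points with \<open>E z = 0\<close> contribute
  nothing; time 0 is among them, since \<open>schr_amp\<close> is 0 there by division by
  zero.\<close>

lemma endpoint_truncated:
  fixes u :: "nat \<Rightarrow> 'a::euclidean_space \<Rightarrow> complex" and \<nu> :: "nat \<Rightarrow> real"
  assumes fin: "finite J" and b: "bessel_system J u" and um[measurable]: "\<And>j. u j \<in> borel_measurable borel"
    and supp: "\<And>j x. j \<in> J \<Longrightarrow> x \<notin> cbox (-v) v \<Longrightarrow> u j x = 0" and \<nu>: "\<And>j. \<nu> j \<ge> 0"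
  shows "(\<integral>\<^sup>+ t. \<integral>\<^sup>+ x. ennreal ((\<Sum>j\<in>J. \<nu> j * (norm (schr_ext (u j) t x))\<^sup>2) powr ((real DIM('a) + 2) / real DIM('a))) \<partial>lborel \<partial>lborel)
    \<le> ennreal (end_const DIM('a) * (\<Sum>j\<in>J. \<nu> j powr ((real DIM('a) + 2) / (real DIM('a) + 1))) powr ((real DIM('a) + 1) / real DIM('a)))"
    (is "_ \<le> ?R")
proof -
  let ?q = "(real DIM('a) + 2) / real DIM('a)"
  define E where "E z = (\<Sum>j\<in>J. \<nu> j * (norm (schr_ext (u j) (fst z) (snd z)))\<^sup>2)" for z
  define S where "S n = {z::real \<times> 'a. norm z \<le> real (Suc n) \<and> 1 / real (Suc n) \<le> \<bar>fst z\<bar> \<and> 1 / real (Suc n) \<le> E z \<and> E z \<le> real (Suc n)}" for n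
  have Em[measurable]: "E \<in> borel_measurable borel" unfolding E_def[abs_def] by measurable
  have E0: "E z \<ge> 0" for z unfolding E_def using \<nu> by (intro sum_nonneg mult_nonneg_nonneg) auto
  have Sm[measurable]: "S n \<in> sets borel" for n unfolding S_def by measurable
  have "(\<integral>\<^sup>+ t. \<integral>\<^sup>+ x. ennreal ((\<Sum>j\<in>J. \<nu> j * (norm (schr_ext (u j) t x))\<^sup>2) powr ?q) \<partial>lborel \<partial>lborel) =
      (\<integral>\<^sup>+ t. \<integral>\<^sup>+ x. ennreal (E (t, x) powr ?q) \<partial>lborel \<partial>lborel)" by (simp add: E_def)
  also have "\<dots> = (\<integral>\<^sup>+ z. ennreal (E z powr ?q) \<partial>lborel)"
    by (subst nn_integral_lborel_pair) auto
  also have "\<dots> \<le> (\<integral>\<^sup>+ z. liminf (\<lambda>n. ennreal (E z powr ?q) * indicator (S n) z) \<partial>lborel)"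
  proof (rule nn_integral_mono)
    fix z :: "real \<times> 'a"
    show "ennreal (E z powr ?q) \<le> liminf (\<lambda>n. ennreal (E z powr ?q) * indicator (S n) z)"
    proof (cases "E z = 0")
      case False
      then have Ep: "E z > 0" using E0[of z] by simp
      have "fst z \<noteq> 0" using False by (auto simp: E_def schr_ext_0)
      then have fp: "\<bar>fst z\<bar> > 0" by simp
      have c1: "\<forall>\<^sub>F n in sequentially. norm z \<le> real (Suc n)" by real_asymp
      have c2: "\<forall>\<^sub>F n in sequentially. 1 / real (Suc n) \<le> \<bar>fst z\<bar>" using fp by real_asymp
      have c3: "\<forall>\<^sub>F n in sequentially. 1 / real (Suc n) \<le> E z" using Ep by real_asymp
      have c4: "\<forall>\<^sub>F n in sequentially. E z \<le> real (Suc n)" by real_asymp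
      from c1 c2 c3 c4 have "\<forall>\<^sub>F n in sequentially. z \<in> S n" unfolding S_def mem_Collect_eq by eventually_elim auto
      then have "\<forall>\<^sub>F n in sequentially. ennreal (E z powr ?q) \<le> ennreal (E z powr ?q) * indicator (S n) z"
        by eventually_elim simp
      then show ?thesis by (rule Liminf_bounded)
    qed simp
  qed
  also have "\<dots> \<le> liminf (\<lambda>n. \<integral>\<^sup>+ z. ennreal (E z powr ?q) * indicator (S n) z \<partial>lborel)"
    by (rule nn_integral_liminf) measurable
  also have "\<dots> \<le> liminf (\<lambda>n. ?R)"
    unfolding S_def E_def
    by (intro Liminf_mono always_eventually allI endpoint_local[OF fin b um supp \<nu>])
  finally show ?thesis by (simp add: Liminf_const)
qed

section \<open>Interpolation with the mass bound\<close>

text \<open>Bessel's inequality tested with \<open>u j\<close> itself: the fourth power of the norm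
  is at most its square.\<close>

lemma bessel_norm_le_1:
  assumes fin: "finite J" and b: "bessel_system J u" and j: "j \<in> J"
  shows "(LBINT x. (norm (u j x))\<^sup>2) \<le> 1"
proof -
  let ?s = "LBINT x. (norm (u j x))\<^sup>2"
  have uL: "L2 (u j)" using b j by (simp add: bessel_system_def)
  have s0: "?s \<ge> 0" by (intro Bochner_Integration.integral_nonneg) auto
  have "L2_inner (u j) (u j) = (LBINT x. complex_of_real ((norm (u j x))\<^sup>2))"
    unfolding L2_inner_def by (intro Bochner_Integration.integral_cong refl) (simp only: complex_norm_square mult.commute)
  also have "\<dots> = of_real ?s" using uL by (intro integral_of_real) (simp add: L2_def)
  finally have "?s\<^sup>2 = (norm (L2_inner (u j) (u j)))\<^sup>2" by simp
  also have "\<dots> \<le> (\<Sum>i\<in>J. (norm (L2_inner (u i) (u j)))\<^sup>2)" by (rule member_le_sum) (auto simp: fin j)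
  also have "\<dots> \<le> ?s" using b uL by (simp add: bessel_system_def)
  finally have "?s * ?s \<le> 1 * ?s" by (simp add: power2_eq_square)
  then show ?thesis using s0 by (cases "?s = 0") (auto simp: mult_le_cancel_right)
qed

text \<open>With \<theta> = q0/p, where q0 is the endpoint exponent, the density is at most the
  power 1-\<theta> of a density bounded in L1 at every time, times the power \<theta> of one obeying
  the endpoint estimate. The time exponent p \<theta> is then q0, and the scaling relation makes the
  Hoelder weights in space add up to 1.\<close>

lemma strichartz_truncated:
  fixes u :: "nat \<Rightarrow> 'a::euclidean_space \<Rightarrow> complex" and \<nu> :: "nat \<Rightarrow> real" and p q :: real
  assumes fin: "finite J" and b: "bessel_system J u" and um[measurable]: "\<And>j. u j \<in> borel_measurable borel"
    and supp: "\<And>j x. j \<in> J \<Longrightarrow> x \<notin> cbox (-v) v \<Longrightarrow> u j x = 0" and \<nu>: "\<And>j. \<nu> j \<ge> 0"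
    and pq: "p \<ge> 1" "q > 1" "q \<le> 1 + 2 / real DIM('a)" "2 / p + real DIM('a) / q = real DIM('a)"
  shows "(\<integral>\<^sup>+ t. enn_powr (\<integral>\<^sup>+ x. ennreal ((\<Sum>j\<in>J. \<nu> j * (norm (schr_ext (u j) t x))\<^sup>2) powr q) \<partial>lborel) (p / q) \<partial>lborel)
    \<le> ennreal (end_const DIM('a) * (\<Sum>j\<in>J. \<nu> j powr (2 * q / (q + 1))) powr (p * (q + 1) / (2 * q)))"
proof -
  let ?d = "real DIM('a)"
  have d: "?d \<ge> 1" by (simp add: DIM_positive Suc_leI)
  define q0 where "q0 = (?d + 2) / ?d"
  define \<alpha>0 where "\<alpha>0 = (?d + 2) / (?d + 1)"
  define \<alpha> where "\<alpha> = 2 * q / (q + 1)"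
  have q0: "q0 = 1 + 2 / ?d" "q0 > 1" using d by (auto simp: q0_def field_simps)
  have "?d + 2 \<noteq> 0" using d by linarith
  then have \<alpha>: "\<alpha> > 0" "\<alpha>0 > 0" "q0 / \<alpha>0 = (?d + 1) / ?d" using pq d by (auto simp: \<alpha>_def \<alpha>0_def q0_def)
  have ip: "1 / p = (?d / 2) * (1 - 1 / q)" using pq(4) d pq(1,2) by (simp add: field_simps)
  have p\<alpha>: "p * (q + 1) / (2 * q) = p / \<alpha>" using pq by (simp add: \<alpha>_def)
  have ia: "1 / \<alpha> = 1/2 + (1/q)/2" using pq by (simp add: \<alpha>_def field_simps)
  have ia0: "q0 * (1 - 1 / \<alpha>0) = 1 / ?d" using d by (simp add: q0_def \<alpha>0_def field_simps)
  \<comment> \<open>By scaling, p (1 - 1/\<alpha>) equals 1/d for every admissible pair, in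
    particular at the endpoint; comparing the two gives the relation.\<close>
  have pp\<alpha>: "p / \<alpha> = (p - q0) + q0 / \<alpha>0"
  proof -
    have "1 - 1 / \<alpha> = (1 / 2) * (1 - 1 / q)" by (simp add: ia algebra_simps)
    also have "\<dots> = (1 / ?d) * (1 / p)" unfolding ip using d by (simp add: field_simps)
    finally have "p * (1 - 1 / \<alpha>) = 1 / ?d" using pq(1) d by (simp add: field_simps)
    then have "p * (1 - 1 / \<alpha>) = q0 * (1 - 1 / \<alpha>0)" using ia0 by simp
    then show ?thesis by (simp add: algebra_simps)
  qed
  define E where "E c t x = (\<Sum>j\<in>J. c j * (norm (schr_ext (u j) t x))\<^sup>2)" for c :: "nat \<Rightarrow> real" and t x
  have Em[measurable]: "(\<lambda>w. E c (f w) (g w)) \<in> borel_measurable M" if [measurable]: "f \<in> borel_measurable M" "g \<in> borel_measurable M"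
    for c f g and M :: "'m measure"
    unfolding E_def by measurable
  have E0: "E c t x \<ge> 0" if "\<And>j. c j \<ge> 0" for c t x unfolding E_def using that by (intro sum_nonneg mult_nonneg_nonneg) auto
  have endp: "(\<integral>\<^sup>+ t. \<integral>\<^sup>+ x. ennreal (E c t x powr q0) \<partial>lborel \<partial>lborel) \<le> ennreal (end_const DIM('a) * (\<Sum>j\<in>J. c j powr \<alpha>0) powr (q0 / \<alpha>0))"
    if "\<And>j. c j \<ge> 0" for c
    unfolding E_def q0_def \<alpha>0_def using endpoint_truncated[OF fin b um supp that] \<alpha>(3)[unfolded q0_def \<alpha>0_def] by simp
  show ?thesis
  proof (cases "q = q0")
    \<comment> \<open>Here \<theta> would be 1, which Hoelder with positive weights excludes; the
      endpoint estimate itself is the claim.\<close>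
    case True
    have "1 / p = 1 / q0" unfolding ip True using d by (simp add: q0_def field_simps)
    then have pq0: "p = q0" using pq(1) q0 by (simp add: field_simps)
    have "q0 / \<alpha> = q0 / \<alpha>0" using pp\<alpha> pq0 by simp
    then have eq\<alpha>: "\<alpha> = \<alpha>0" using q0 \<alpha> by (simp add: field_simps)
    have one: "p / q = 1" unfolding pq0 True using q0(2) by (intro divide_self) linarith
    show ?thesis
      using endp[OF \<nu>] unfolding one enn_powr_one p\<alpha> \<alpha>_def[symmetric] eq\<alpha> E_def by (simp only: pq0 True)
  next
    case False
    then have qlt: "q < q0" using pq(3) q0 by simp
    have "1 / p < 1 / q0"
    proof -
      have "1 - 1 / q < 1 - 1 / q0" using qlt pq(2) by (simp add: field_simps)
      then have "(?d / 2) * (1 - 1 / q) < (?d / 2) * (1 - 1 / q0)" using d by (intro mult_strict_left_mono) auto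
      also have "\<dots> = 1 / q0" using d by (simp add: q0_def field_simps)
      finally show ?thesis by (simp add: ip)
    qed
    then have plt: "q0 < p" using inverse_less_imp_less[of p q0] pq(1) by (simp add: inverse_eq_divide)
    define \<theta> where "\<theta> = q0 / p"
    have \<theta>: "0 < \<theta>" "\<theta> < 1" using plt q0(2) by (auto simp: \<theta>_def)
    define x where "x = (1 - \<theta>) * q"
    define y where "y = \<theta> * q / q0"
    have yqp: "y = q / p" using q0(2) by (simp add: y_def \<theta>_def)
    have xy: "x > 0" "y > 0" "x + y = 1"
    proof -
      show "x > 0" "y > 0" using \<theta> pq(2) q0(2) by (auto simp: x_def y_def)
      have "x + y = q - q * (q0 - 1) * (1 / p)" using q0(2) pq(1) by (simp add: x_def y_def \<theta>_def field_simps)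
      also have "\<dots> = q - q * (2 / ?d) * ((?d / 2) * (1 - 1 / q))" by (simp only: ip q0(1)) simp
      also have "\<dots> = 1" using pq(2) d by (simp add: field_simps)
      finally show "x + y = 1" .
    qed
    \<comment> \<open>The map \<open>n \<mapsto> \<rho>\<close> is positive, so it interpolates between \<open>L\<^sup>\<infinity> L\<^sup>1\<close> and the endpoint by Hoelder alone.\<close>
    define ca where "ca j = \<nu> j powr \<alpha>" for j
    define cb where "cb j = \<nu> j powr (\<alpha> / \<alpha>0)" for j
    have ca0: "ca j \<ge> 0" and cb0: "cb j \<ge> 0" for j by (simp_all add: ca_def cb_def)
    \<comment> \<open>So \<open>\<nu> j\<close> is \<open>ca j\<close> to the power 1-\<theta> times
      \<open>cb j\<close> to the power \<theta>, while the sum of the \<open>ca j\<close> and that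
      of the \<open>cb j powr \<alpha>0\<close> are the same number.\<close>
    have exps: "\<alpha> * (1 - \<theta>) + \<alpha> / \<alpha>0 * \<theta> = 1"
    proof -
      have "(1 - \<theta>) + \<theta> / \<alpha>0 = (p - q0 + q0 / \<alpha>0) / p" using pq(1) by (simp add: \<theta>_def field_simps)
      also have "\<dots> = 1 / \<alpha>" unfolding pp\<alpha>[symmetric] using pq(1) by simp
      finally have "\<alpha> * ((1 - \<theta>) + \<theta> / \<alpha>0) = 1" using \<alpha> by simp
      then show ?thesis by (simp add: algebra_simps)
    qed
    have pw: "E \<nu> t w powr q \<le> E ca t w powr x * (E cb t w powr q0) powr y" for t w
    proof -
      have "E \<nu> t w = (\<Sum>j\<in>J. (ca j * (norm (schr_ext (u j) t w))\<^sup>2) powr (1 - \<theta>) * (cb j * (norm (schr_ext (u j) t w))\<^sup>2) powr \<theta>)"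
        unfolding E_def
      proof (intro sum.cong refl)
        fix j
        let ?e = "(norm (schr_ext (u j) t w))\<^sup>2"
        have "(ca j * ?e) powr (1 - \<theta>) * (cb j * ?e) powr \<theta> = (\<nu> j powr (\<alpha> * (1 - \<theta>)) * \<nu> j powr (\<alpha> / \<alpha>0 * \<theta>)) * (?e powr (1 - \<theta>) * ?e powr \<theta>)"
          by (simp add: ca_def cb_def powr_mult powr_powr)
        also have "\<dots> = \<nu> j * ?e"
          unfolding powr_add[symmetric] exps using \<nu>[of j] by simp
        finally show "\<nu> j * ?e = (ca j * ?e) powr (1 - \<theta>) * (cb j * ?e) powr \<theta>" by simp
      qed
      also have "\<dots> \<le> E ca t w powr (1 - \<theta>) * E cb t w powr \<theta>"
        unfolding E_def by (rule Holder_sum[OF fin]) (use \<theta> ca0 cb0 in auto)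
      finally have "E \<nu> t w powr q \<le> (E ca t w powr (1 - \<theta>) * E cb t w powr \<theta>) powr q"
        using E0[OF \<nu>] pq(2) by (intro powr_mono2) auto
      also have "\<dots> = E ca t w powr x * (E cb t w powr q0) powr y"
        using q0(2) by (simp add: powr_mult powr_powr x_def y_def)
      finally show ?thesis .
    qed
    let ?S = "\<Sum>j\<in>J. ca j"
    have S0: "?S \<ge> 0" by (intro sum_nonneg ca0)
    have mass: "(\<integral>\<^sup>+ w. ennreal (E ca t w) \<partial>lborel) \<le> ennreal ?S" if t: "t \<noteq> 0" for t
    proof -
      have "(\<integral>\<^sup>+ w. ennreal (E ca t w) \<partial>lborel) = (\<integral>\<^sup>+ w. (\<Sum>j\<in>J. ennreal (ca j) * ennreal ((norm (schr_ext (u j) t w))\<^sup>2)) \<partial>lborel)"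
        by (simp add: E_def sum_ennreal[symmetric] ca0 ennreal_mult)
      also have "\<dots> = (\<Sum>j\<in>J. ennreal (ca j) * L2_mass (schr_ext (u j) t))"
        by (subst nn_integral_sum, measurable, intro sum.cong refl nn_integral_cmult, measurable)
      also have "\<dots> \<le> (\<Sum>j\<in>J. ennreal (ca j) * 1)"
      proof (intro sum_mono mult_left_mono)
        fix j assume j: "j \<in> J"
        have uL: "L2 (u j)" using b j by (simp add: bessel_system_def)
        have "L2_mass (schr_ext (u j) t) \<le> L2_mass (u j)"
          by (rule schr_ext_L2_bound[OF t L2_cbox_integrable[OF uL supp[OF j]]])
        also have "\<dots> = ennreal (LBINT w. (norm (u j w))\<^sup>2)" using uL by (intro nn_integral_eq_integral) (auto simp: L2_def)
        also have "\<dots> \<le> ennreal 1" by (intro ennreal_leI bessel_norm_le_1[OF fin b j])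
        finally show "L2_mass (schr_ext (u j) t) \<le> 1" by simp
      qed simp
      also have "\<dots> = ennreal ?S" by (simp add: sum_ennreal ca0)
      finally show ?thesis .
    qed
    have slice: "enn_powr (\<integral>\<^sup>+ w. ennreal (E \<nu> t w powr q) \<partial>lborel) (p / q) \<le> ennreal (?S powr (p - q0)) * (\<integral>\<^sup>+ w. ennreal (E cb t w powr q0) \<partial>lborel)"
      if t: "t \<noteq> 0" for t
    proof -
      have "(\<integral>\<^sup>+ w. ennreal (E \<nu> t w powr q) \<partial>lborel) \<le> (\<integral>\<^sup>+ w. ennreal (E ca t w powr x * (E cb t w powr q0) powr y) \<partial>lborel)"
        by (intro nn_integral_mono ennreal_leI pw)
      also have "\<dots> \<le> enn_powr (\<integral>\<^sup>+ w. ennreal (E ca t w) \<partial>lborel) x * enn_powr (\<integral>\<^sup>+ w. ennreal (E cb t w powr q0) \<partial>lborel) y"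
        by (rule Holder_nn_integral) (auto simp: E0 ca0 cb0 xy)
      also have "\<dots> \<le> enn_powr (ennreal ?S) x * enn_powr (\<integral>\<^sup>+ w. ennreal (E cb t w powr q0) \<partial>lborel) y"
        using xy by (intro mult_right_mono enn_powr_mono mass t) auto
      finally have "enn_powr (\<integral>\<^sup>+ w. ennreal (E \<nu> t w powr q) \<partial>lborel) (p / q) \<le>
         enn_powr (enn_powr (ennreal ?S) x * enn_powr (\<integral>\<^sup>+ w. ennreal (E cb t w powr q0) \<partial>lborel) y) (p / q)"
        using pq by (intro enn_powr_mono) auto
      also have "\<dots> = enn_powr (ennreal ?S) (x * (p / q)) * enn_powr (\<integral>\<^sup>+ w. ennreal (E cb t w powr q0) \<partial>lborel) (y * (p / q))"
        using pq by (subst enn_powr_mult) (auto simp: enn_powr_enn_powr)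
      also have "x * (p / q) = p - q0" using pq(1,2) by (simp add: x_def \<theta>_def field_simps)
      also have "y * (p / q) = 1" using pq(1,2) by (simp add: yqp)
      finally show ?thesis using S0 by (simp add: enn_powr_ennreal)
    qed
    have "(\<integral>\<^sup>+ t. enn_powr (\<integral>\<^sup>+ w. ennreal (E \<nu> t w powr q) \<partial>lborel) (p / q) \<partial>lborel) \<le>
        (\<integral>\<^sup>+ t. ennreal (?S powr (p - q0)) * (\<integral>\<^sup>+ w. ennreal (E cb t w powr q0) \<partial>lborel) \<partial>lborel)"
      by (rule nn_integral_mono_AE, rule AE_mp[OF AE_lborel_singleton[of 0]], intro AE_I2 impI slice)
    also have "\<dots> = ennreal (?S powr (p - q0)) * (\<integral>\<^sup>+ t. (\<integral>\<^sup>+ w. ennreal (E cb t w powr q0) \<partial>lborel) \<partial>lborel)"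
      by (rule nn_integral_cmult) measurable
    also have "\<dots> \<le> ennreal (?S powr (p - q0)) * ennreal (end_const DIM('a) * (\<Sum>j\<in>J. cb j powr \<alpha>0) powr (q0 / \<alpha>0))"
      by (intro mult_left_mono endp cb0) auto
    also have "(\<Sum>j\<in>J. cb j powr \<alpha>0) = ?S" using \<alpha> by (intro sum.cong refl) (simp add: cb_def ca_def powr_powr)
    also have "ennreal (?S powr (p - q0)) * ennreal (end_const DIM('a) * ?S powr (q0 / \<alpha>0)) = ennreal (end_const DIM('a) * ?S powr (p / \<alpha>))"
      unfolding pp\<alpha> powr_add using end_const_pos[of "DIM('a)"] by (simp add: ennreal_mult[symmetric] mult_ac)
    finally show ?thesis unfolding p\<alpha> E_def ca_def \<alpha>_def .
  qed
qed

section \<open>Passage to the limit\<close>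

text \<open>Passes from summability of weighted squares of increments to summability of the
  increments themselves.\<close>

lemma norm_le_am_gm:
  fixes d c :: real
  assumes "c > 0" "d \<ge> 0" shows "d \<le> c + d\<^sup>2 / c"
proof -
  have "0 \<le> (d - c)\<^sup>2" by simp
  then have "2 * (d * c) \<le> c\<^sup>2 + d\<^sup>2" by (simp add: power2_diff algebra_simps)
  then have "d * c \<le> c\<^sup>2 + d\<^sup>2" using assms by (smt (verit) mult_nonneg_nonneg)
  then have "d \<le> (c\<^sup>2 + d\<^sup>2) / c" using assms by (simp add: le_divide_eq)
  then show ?thesis using assms by (simp add: add_divide_distrib power2_eq_square)
qed

text \<open>Riesz-Fischer, in terms of the squared distance that \<open>schr\<close> uses. Along a
  subsequence with squared increments at most 4^(-k) in mean, the sum of 2^k times these squares is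
  finite almost everywhere, hence the increments are summable there. Fatou identifies the pointwise
  limit as the limit in mean.\<close>

lemma L2_complete:
  fixes F :: "nat \<Rightarrow> 'a::euclidean_space \<Rightarrow> complex"
  assumes F: "\<And>n. L2 (F n)"
    and cauchy: "\<And>\<epsilon>. \<epsilon> > 0 \<Longrightarrow> \<exists>N. \<forall>m\<ge>N. \<forall>n\<ge>N. L2_mass (\<lambda>x. F m x - F n x) \<le> ennreal \<epsilon>"
  shows "\<exists>v. L2 v \<and> ((\<lambda>n. \<integral>\<^sup>+ x. ennreal ((norm (F n x - v x))\<^sup>2) \<partial>lborel) \<longlonglongrightarrow> 0)"
proof -
  have [measurable]: "F n \<in> borel_measurable borel" for n using F by (rule L2_measurable)
  have "\<exists>N. \<forall>k. \<forall>m\<ge>N k. \<forall>n\<ge>N k. L2_mass (\<lambda>x. F m x - F n x) \<le> ennreal ((1/4)^k)"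
    by (rule choice) (auto intro!: cauchy)
  then obtain N where N: "\<And>k m n. m \<ge> N k \<Longrightarrow> n \<ge> N k \<Longrightarrow> L2_mass (\<lambda>x. F m x - F n x) \<le> ennreal ((1/4)^k)"
    by metis
  \<comment> \<open>Adding up all thresholds makes \<open>r j\<close> exceed \<open>N k\<close> for
    every k \<le> j; the summand \<open>k\<close> makes \<open>r\<close> tend to infinity.\<close>
  define r where "r k = (\<Sum>i\<le>k. N i) + k" for k
  have rN: "N k \<le> r j" if "k \<le> j" for k j
  proof -
    have "N k \<le> (\<Sum>i\<le>j. N i)" by (rule member_le_sum) (use that in auto)
    then show ?thesis by (simp add: r_def)
  qed
  define D where "D k x = norm (F (r (Suc k)) x - F (r k) x)" for k x
  have [measurable]: "D k \<in> borel_measurable borel" for k unfolding D_def[abs_def] by measurable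
  have "(\<integral>\<^sup>+ x. (\<Sum>k. ennreal (2^k * (D k x)\<^sup>2)) \<partial>lborel) = (\<Sum>k. \<integral>\<^sup>+ x. ennreal (2^k * (D k x)\<^sup>2) \<partial>lborel)"
    by (rule nn_integral_suminf) measurable
  also have "\<dots> \<le> (\<Sum>k. ennreal ((1/2)^k))"
  proof (rule suminf_le)
    fix k
    have "(\<integral>\<^sup>+ x. ennreal (2^k * (D k x)\<^sup>2) \<partial>lborel) = ennreal (2^k) * (\<integral>\<^sup>+ x. ennreal ((D k x)\<^sup>2) \<partial>lborel)"
      by (subst nn_integral_cmult[symmetric]) (auto simp: ennreal_mult)
    also have "\<dots> \<le> ennreal (2^k) * ennreal ((1/4)^k)"
      unfolding D_def by (intro mult_left_mono N rN) auto
    also have "\<dots> = ennreal ((1/2)^k)" by (simp add: ennreal_mult[symmetric] power_mult_distrib[symmetric])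
    finally show "(\<integral>\<^sup>+ x. ennreal (2^k * (D k x)\<^sup>2) \<partial>lborel) \<le> ennreal ((1/2)^k)" .
  qed auto
  also have "\<dots> < \<infinity>"
    by (subst suminf_ennreal2) (auto intro!: summable_geometric)
  finally have "AE x in lborel. (\<Sum>k. ennreal (2^k * (D k x)\<^sup>2)) \<noteq> \<infinity>"
    by (intro nn_integral_noteq_infinite) auto
  then have conv: "AE x in lborel. convergent (\<lambda>k. F (r k) x)"
  proof eventually_elim
    case (elim x)
    have s1: "summable (\<lambda>k. 2^k * (D k x)\<^sup>2)"
      by (rule summable_suminf_not_top) (use elim in auto)
    have "summable (\<lambda>k. (1/2)^k + 2^k * (D k x)\<^sup>2)"
      by (intro summable_add s1 summable_geometric) simp
    then have "summable (\<lambda>k. F (r (Suc k)) x - F (r k) x)"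
    proof (rule summable_comparison_test'[where N=0])
      fix k
      show "norm (F (r (Suc k)) x - F (r k) x) \<le> (1/2)^k + 2^k * (D k x)\<^sup>2"
        using norm_le_am_gm[of "(1/2)^k" "D k x"] by (simp add: D_def power_divide mult.commute)
    qed
    then have "convergent (\<lambda>n. \<Sum>k<n. F (r (Suc k)) x - F (r k) x)" by (simp add: summable_iff_convergent)
    then have "convergent (\<lambda>n. F (r n) x - F (r 0) x)" by (simp only: sum_lessThan_telescope[where f="\<lambda>k. F (r k) x"])
    then have "convergent (\<lambda>n. (F (r n) x - F (r 0) x) + F (r 0) x)" by (intro convergent_add convergent_const)
    then show ?case by simp
  qed
  define v where "v x = lim (\<lambda>k. F (r k) x)" for x
  have vm[measurable]: "v \<in> borel_measurable borel" unfolding v_def[abs_def] by measurable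
  have lim_bound: "L2_mass (\<lambda>x. F n x - v x) \<le> ennreal \<epsilon>"
    if n: "n \<ge> M" and M: "\<forall>m\<ge>M. \<forall>n\<ge>M. L2_mass (\<lambda>x. F m x - F n x) \<le> ennreal \<epsilon>" for n M \<epsilon>
  proof -
    have "L2_mass (\<lambda>x. F n x - v x) \<le> (\<integral>\<^sup>+ x. liminf (\<lambda>k. ennreal ((norm (F n x - F (r k) x))\<^sup>2)) \<partial>lborel)"
    proof (rule nn_integral_mono_AE, use conv in eventually_elim)
      case (elim x)
      then have "(\<lambda>k. F (r k) x) \<longlonglongrightarrow> v x" by (simp add: v_def convergent_LIMSEQ_iff)
      then have "(\<lambda>k. ennreal ((norm (F n x - F (r k) x))\<^sup>2)) \<longlonglongrightarrow> ennreal ((norm (F n x - v x))\<^sup>2)"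
        by (intro tendsto_ennrealI tendsto_intros)
      from lim_imp_Liminf[OF sequentially_bot this] show ?case by (simp only: order_refl)
    qed
    also have "\<dots> \<le> liminf (\<lambda>k. \<integral>\<^sup>+ x. ennreal ((norm (F n x - F (r k) x))\<^sup>2) \<partial>lborel)"
      by (rule nn_integral_liminf) measurable
    also have "\<dots> \<le> liminf (\<lambda>k. ennreal \<epsilon>)"
    proof (rule Liminf_mono)
      show "\<forall>\<^sub>F k in sequentially. L2_mass (\<lambda>x. F n x - F (r k) x) \<le> ennreal \<epsilon>"
        using eventually_ge_at_top[of M]
      proof eventually_elim
        case (elim k)
        then have "r k \<ge> M" by (simp add: r_def)
        then show ?case using M n by blast
      qed
    qed
    finally show ?thesis by (simp add: Liminf_const)
  qed
  have lim0: "(\<lambda>n. \<integral>\<^sup>+ x. ennreal ((norm (F n x - v x))\<^sup>2) \<partial>lborel) \<longlonglongrightarrow> 0"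
  proof (rule order_tendstoI)
    fix a :: ennreal assume "a < 0" then show "\<forall>\<^sub>F n in sequentially. a < L2_mass (\<lambda>x. F n x - v x)" by simp
  next
    fix a :: ennreal assume a: "0 < a"
    obtain \<epsilon> :: real where \<epsilon>: "\<epsilon> > 0" "ennreal \<epsilon> < a"
    proof (cases a)
      case (real x)
      then show ?thesis using a that[of "x/2"] by (auto simp: ennreal_less_iff)
    next
      case top then show ?thesis using that[of 1] by simp
    qed
    obtain M where M: "\<forall>m\<ge>M. \<forall>n\<ge>M. L2_mass (\<lambda>x. F m x - F n x) \<le> ennreal \<epsilon>" using cauchy[OF \<epsilon>(1)] by blast
    show "\<forall>\<^sub>F n in sequentially. L2_mass (\<lambda>x. F n x - v x) < a"
      using eventually_ge_at_top[of M] by eventually_elim (rule le_less_trans[OF lim_bound[OF _ M] \<epsilon>(2)])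
  qed
  have "L2 v"
  proof -
    obtain M where M: "\<forall>m\<ge>M. \<forall>n\<ge>M. L2_mass (\<lambda>x. F m x - F n x) \<le> ennreal 1" using cauchy[of 1] by auto
    have fin: "L2_mass (\<lambda>x. F M x - v x) < \<infinity>"
      by (rule le_less_trans[OF lim_bound[OF order_refl M]]) simp
    have "L2 (\<lambda>x. F M x - v x)" unfolding L2_def by (intro conjI integrableI_bounded) (use fin in auto)
    from L2_add[OF F[of M] L2_cmult[OF this, of "-1"]] show ?thesis by simp
  qed
  then show ?thesis using lim0 by blast
qed

section \<open>Truncation and the propagator on L2\<close>

definition trunc :: "('a::euclidean_space \<Rightarrow> complex) \<Rightarrow> nat \<Rightarrow> 'a \<Rightarrow> complex" where
  "trunc f R = (\<lambda>y. indicator (ball 0 (real R)) y * f y)"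

text \<open>The propagator is defined through balls, whereas the oscillatory estimates need
  cubes.\<close>

lemma ball_subset_cbox: "ball 0 R \<subseteq> cbox (- (R *\<^sub>R One)) (R *\<^sub>R One :: 'a::euclidean_space)"
proof
  fix x :: 'a assume "x \<in> ball 0 R"
  then have "\<bar>x \<bullet> b\<bar> \<le> R" if "b \<in> Basis" for b using Basis_le_norm[OF that, of x] by auto
  then show "x \<in> cbox (- (R *\<^sub>R One)) (R *\<^sub>R One)" by (auto simp: mem_box abs_le_iff) (smt (verit))
qed

lemma trunc_out: "x \<notin> cbox (- (real R *\<^sub>R One)) (real R *\<^sub>R One) \<Longrightarrow> trunc f R x = 0"
  using ball_subset_cbox[of "real R"] by (auto simp: trunc_def indicator_def)

lemma L2_trunc: "L2 f \<Longrightarrow> L2 (trunc f R)"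
  unfolding trunc_def by (rule L2_indicator) auto

lemma trunc_integrable: "L2 f \<Longrightarrow> integrable lborel (trunc f R)"
  by (rule L2_cbox_integrable[OF L2_trunc trunc_out])

lemma L2_nn: "L2 f \<Longrightarrow> L2_mass f < \<infinity>"
  by (subst nn_integral_eq_integral) (auto simp: L2_def)

lemma schr_kernel_diff:
  assumes t: "t \<noteq> 0" and f: "integrable lborel f" and g: "integrable lborel g"
  shows "norm (schr_kernel t f x - schr_kernel t g x) = norm (schr_ext (\<lambda>y. f y - g y) t x)"
proof -
  have [measurable]: "f \<in> borel_measurable borel" "g \<in> borel_measurable borel" using f g by (auto dest: borel_measurable_integrable)
  have i: "integrable lborel (\<lambda>y. exp (\<i> * complex_of_real ((norm (x - y))\<^sup>2 / (4 * t))) * h y)" if "integrable lborel h" "h \<in> borel_measurable borel" for h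
    using that(2) by (intro Bochner_Integration.integrable_bound[OF that(1)]) (auto simp: norm_mult)
  have "schr_kernel t f x - schr_kernel t g x = schr_kernel t (\<lambda>y. f y - g y) x"
    unfolding schr_kernel_def right_diff_distrib[symmetric]
    by (subst Bochner_Integration.integral_diff[symmetric, OF i[OF f] i[OF g]]) (auto simp: right_diff_distrib)
  then show ?thesis using norm_schr_kernel[OF t] by metis
qed

lemma measurable_schr_kernel:
  assumes [measurable]: "f \<in> borel_measurable borel"
  shows "schr_kernel t f \<in> borel_measurable borel"
  unfolding schr_kernel_def[abs_def] by measurable

text \<open>The kernel contracts the L2 norm, so images of two truncations differ by at most a tail
  of \<open>f\<close>, and they converge by completeness. This existence is what gives the Hilbert
  choice in \<open>schr\<close> its meaning.\<close>

lemma schr_spec: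
  fixes f :: "'a::euclidean_space \<Rightarrow> complex"
  assumes t: "t \<noteq> 0" and f: "L2 f"
  shows "L2 (schr t f)"
    and "(\<lambda>R. \<integral>\<^sup>+ x. ennreal ((norm (schr_kernel t (trunc f R) x - schr t f x))\<^sup>2) \<partial>lborel) \<longlonglongrightarrow> 0"
proof -
  have [measurable]: "f \<in> borel_measurable borel" using f by (rule L2_measurable)
  have tm[measurable]: "trunc f R \<in> borel_measurable borel" for R using L2_trunc[OF f] by (rule L2_measurable)
  let ?F = "\<lambda>R. schr_kernel t (trunc f R)"
  have FL: "L2 (?F R)" for R
  proof -
    have "L2_mass (?F R) \<le> L2_mass (trunc f R)"
      unfolding norm_schr_kernel[OF t] by (rule schr_ext_L2_bound[OF t trunc_integrable[OF f]])
    also have "\<dots> < \<infinity>" by (rule L2_nn[OF L2_trunc[OF f]])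
    finally show ?thesis unfolding L2_def
      by (intro conjI integrableI_bounded) (use measurable_schr_kernel[OF tm[of R]] in auto)
  qed
  define T where "T M = L2_mass (\<lambda>x. f x - trunc f M x)" for M
  have diff: "L2_mass (\<lambda>x. ?F m x - ?F n x) \<le> T M" if "M \<le> m" "M \<le> n" for m n M
  proof -
    have "L2_mass (\<lambda>x. ?F m x - ?F n x) \<le> L2_mass (\<lambda>x. trunc f m x - trunc f n x)"
      unfolding schr_kernel_diff[OF t trunc_integrable[OF f] trunc_integrable[OF f]]
      by (rule schr_ext_L2_bound[OF t]) (intro Bochner_Integration.integrable_diff trunc_integrable f)
    also have "\<dots> \<le> T M"
      unfolding T_def using that by (intro nn_integral_mono ennreal_leI power_mono) (auto simp: trunc_def indicator_def)
    finally show ?thesis .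
  qed
  have "T \<longlonglongrightarrow> (\<integral>\<^sup>+ x. 0 \<partial>(lborel :: 'a measure))"
    unfolding T_def
  proof (rule nn_integral_dominated_convergence[where w="\<lambda>x. ennreal ((norm (f x))\<^sup>2)"])
    show "AE x in lborel. (\<lambda>M. ennreal ((norm (f x - trunc f M x))\<^sup>2)) \<longlonglongrightarrow> 0"
    proof (rule AE_I2)
      fix x :: 'a
      have "\<forall>\<^sub>F M in sequentially. norm x < real M" by real_asymp
      then have "\<forall>\<^sub>F M in sequentially. ennreal ((norm (f x - trunc f M x))\<^sup>2) = 0"
        by eventually_elim (auto simp: trunc_def)
      then show "(\<lambda>M. ennreal ((norm (f x - trunc f M x))\<^sup>2)) \<longlonglongrightarrow> 0" by (rule tendsto_eventually)
    qed
    show "AE x in lborel. ennreal ((norm (f x - trunc f M x))\<^sup>2) \<le> ennreal ((norm (f x))\<^sup>2)" for M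
      by (rule AE_I2) (auto simp: trunc_def indicator_def)
  qed (use L2_nn[OF f] in auto)
  then have T0: "T \<longlonglongrightarrow> 0" by simp
  have "\<exists>N. \<forall>m\<ge>N. \<forall>n\<ge>N. L2_mass (\<lambda>x. ?F m x - ?F n x) \<le> ennreal \<epsilon>" if "\<epsilon> > 0" for \<epsilon>
  proof -
    have "\<forall>\<^sub>F M in sequentially. T M < ennreal \<epsilon>" using order_tendstoD(2)[OF T0] that by simp
    then obtain M where "T M < ennreal \<epsilon>" by (auto simp: eventually_sequentially)
    then show ?thesis using diff[of M] by (meson less_imp_le order_trans)
  qed
  from L2_complete[OF FL this]
  have ex: "\<exists>v. L2 v \<and> ((\<lambda>R. \<integral>\<^sup>+ x. ennreal ((norm (?F R x - v x))\<^sup>2) \<partial>lborel) \<longlonglongrightarrow> 0)" .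
  have "schr t f = (SOME v. L2 v \<and> ((\<lambda>R. \<integral>\<^sup>+ x. ennreal ((norm (?F R x - v x))\<^sup>2) \<partial>lborel) \<longlonglongrightarrow> 0))"
    using t by (simp add: schr_def trunc_def)
  with someI_ex[OF ex] show "L2 (schr t f)" "(\<lambda>R. \<integral>\<^sup>+ x. ennreal ((norm (?F R x - schr t f x))\<^sup>2) \<partial>lborel) \<longlonglongrightarrow> 0" by auto
qed

text \<open>Convergence in mean yields pointwise convergence only along subsequences. So one passes
  to a subsequence realising the lower limit, then to a further one converging almost everywhere,
  and applies Fatou; the value of the lower limit is not changed by the second choice.\<close>

lemma schr_finite_liminf:
  fixes u :: "nat \<Rightarrow> 'a::euclidean_space \<Rightarrow> complex" and \<nu> :: "nat \<Rightarrow> real"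
  assumes t: "t \<noteq> 0" and u: "\<And>j. j \<in> J \<Longrightarrow> L2 (u j)" and fin: "finite J" and \<nu>: "\<And>j. \<nu> j \<ge> 0" and q: "q > 0"
  shows "(\<integral>\<^sup>+ x. ennreal ((\<Sum>j\<in>J. \<nu> j * (norm (schr t (u j) x))\<^sup>2) powr q) \<partial>lborel) \<le>
    liminf (\<lambda>R. \<integral>\<^sup>+ x. ennreal ((\<Sum>j\<in>J. \<nu> j * (norm (schr_ext (trunc (u j) R) t x))\<^sup>2) powr q) \<partial>lborel)"
proof -
  let ?F = "\<lambda>j R. schr_kernel t (trunc (u j) R)"
  let ?v = "\<lambda>j. schr t (u j)"
  have tm: "trunc (u j) R \<in> borel_measurable borel" if "j \<in> J" for j R using L2_trunc[OF u[OF that]] by (rule L2_measurable)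
  have Fm[measurable]: "j \<in> J \<Longrightarrow> ?F j R \<in> borel_measurable borel" for j R by (rule measurable_schr_kernel[OF tm])
  have vL: "L2 (?v j)" if "j \<in> J" for j by (rule schr_spec(1)[OF t u[OF that]])
  have vm[measurable]: "j \<in> J \<Longrightarrow> ?v j \<in> borel_measurable borel" for j by (rule L2_measurable[OF vL])
  define I where "I R = (\<integral>\<^sup>+ x. ennreal ((\<Sum>j\<in>J. \<nu> j * (norm (?F j R x))\<^sup>2) powr q) \<partial>lborel)" for R
  have FL: "L2 (?F j R)" if "j \<in> J" for j R
  proof -
    have "L2_mass (?F j R) \<le> L2_mass (trunc (u j) R)"
      unfolding norm_schr_kernel[OF t] by (rule schr_ext_L2_bound[OF t trunc_integrable[OF u[OF that]]])
    also have "\<dots> < \<infinity>" by (rule L2_nn[OF L2_trunc[OF u[OF that]]])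
    finally show ?thesis unfolding L2_def
      by (intro conjI integrableI_bounded) (use Fm[OF that] in auto)
  qed
  obtain s :: "nat \<Rightarrow> nat" where s: "strict_mono s" "(I \<circ> s) \<longlonglongrightarrow> liminf I" using liminf_subseq_lim by blast
  \<comment> \<open>One sum over all \<open>j\<close>, so that a single further subsequence serves
    the whole system.\<close>
  define D where "D k x = (\<Sum>j\<in>J. (norm (?F j (s k) x - ?v j x))\<^sup>2)" for k x
  have dL: "L2 (\<lambda>x. ?F j R x - ?v j x)" if "j \<in> J" for j R
    using L2_add[OF FL[OF that, of R] L2_cmult[OF vL[OF that], of "-1"]] by simp
  have Dint: "integrable lborel (D k)" for k
    unfolding D_def[abs_def] by (intro Bochner_Integration.integrable_sum) (use dL in \<open>auto simp: L2_def\<close>)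
  have "(\<lambda>k. LBINT x. norm (D k x)) \<longlonglongrightarrow> 0"
  proof -
    have "(\<lambda>k. LBINT x. (norm (?F j (s k) x - ?v j x))\<^sup>2) \<longlonglongrightarrow> 0" if j: "j \<in> J" for j
    proof -
      have "(\<lambda>k. \<integral>\<^sup>+ x. ennreal ((norm (?F j (s k) x - ?v j x))\<^sup>2) \<partial>lborel) \<longlonglongrightarrow> 0"
        using LIMSEQ_subseq_LIMSEQ[OF schr_spec(2)[OF t u[OF j]] s(1)] by (simp add: o_def)
      then have "(\<lambda>k. ennreal (LBINT x. (norm (?F j (s k) x - ?v j x))\<^sup>2)) \<longlonglongrightarrow> ennreal 0"
        using dL[OF j] by (subst (asm) nn_integral_eq_integral) (auto simp: L2_def)
      then show ?thesis by (rule tendsto_ennrealD) (auto intro!: always_eventually Bochner_Integration.integral_nonneg)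
    qed
    then have "(\<lambda>k. \<Sum>j\<in>J. LBINT x. (norm (?F j (s k) x - ?v j x))\<^sup>2) \<longlonglongrightarrow> (\<Sum>j\<in>J. 0)"
      by (intro tendsto_sum) auto
    moreover have "(LBINT x. norm (D k x)) = (\<Sum>j\<in>J. LBINT x. (norm (?F j (s k) x - ?v j x))\<^sup>2)" for k
    proof -
      have "norm (D k x) = D k x" for x by (simp add: D_def sum_nonneg)
      then show ?thesis unfolding D_def using dL by (simp add: L2_def)
    qed
    ultimately show ?thesis by simp
  qed
  from tendsto_L1_AE_subseq[OF Dint this]
  obtain w where w: "strict_mono w" "AE x in lborel. (\<lambda>k. D (w k) x) \<longlonglongrightarrow> 0" by blast
  have "(\<integral>\<^sup>+ x. ennreal ((\<Sum>j\<in>J. \<nu> j * (norm (?v j x))\<^sup>2) powr q) \<partial>lborel) \<le>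
     (\<integral>\<^sup>+ x. liminf (\<lambda>k. ennreal ((\<Sum>j\<in>J. \<nu> j * (norm (?F j (s (w k)) x))\<^sup>2) powr q)) \<partial>lborel)"
  proof (rule nn_integral_mono_AE, use w(2) in eventually_elim)
    case (elim x)
    have "(\<lambda>k. ?F j (s (w k)) x) \<longlonglongrightarrow> ?v j x" if j: "j \<in> J" for j
    proof -
      have "(\<lambda>k. (norm (?F j (s (w k)) x - ?v j x))\<^sup>2) \<longlonglongrightarrow> 0"
      proof (rule tendsto_sandwich[OF _ _ tendsto_const elim])
        show "\<forall>\<^sub>F k in sequentially. (norm (?F j (s (w k)) x - ?v j x))\<^sup>2 \<le> D (w k) x"
          unfolding D_def by (intro always_eventually allI member_le_sum) (use fin j in auto)
      qed simp
      then have "(\<lambda>k. sqrt ((norm (?F j (s (w k)) x - ?v j x))\<^sup>2)) \<longlonglongrightarrow> sqrt 0" by (intro tendsto_intros)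
      then show ?thesis by (simp add: LIM_zero_iff tendsto_norm_zero_iff)
    qed
    then have "(\<lambda>k. \<Sum>j\<in>J. \<nu> j * (norm (?F j (s (w k)) x))\<^sup>2) \<longlonglongrightarrow> (\<Sum>j\<in>J. \<nu> j * (norm (?v j x))\<^sup>2)"
      by (intro tendsto_intros) auto
    then have "(\<lambda>k. (\<Sum>j\<in>J. \<nu> j * (norm (?F j (s (w k)) x))\<^sup>2) powr q) \<longlonglongrightarrow> (\<Sum>j\<in>J. \<nu> j * (norm (?v j x))\<^sup>2) powr q"
      using q \<nu> by (intro tendsto_powr') (auto intro!: always_eventually sum_nonneg mult_nonneg_nonneg)
    then have "(\<lambda>k. ennreal ((\<Sum>j\<in>J. \<nu> j * (norm (?F j (s (w k)) x))\<^sup>2) powr q)) \<longlonglongrightarrow> ennreal ((\<Sum>j\<in>J. \<nu> j * (norm (?v j x))\<^sup>2) powr q)"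
      by (rule tendsto_ennrealI)
    from lim_imp_Liminf[OF sequentially_bot this] show ?case by (simp only: order_refl)
  qed
  also have "\<dots> \<le> liminf (\<lambda>k. I (s (w k)))"
    unfolding I_def by (rule nn_integral_liminf) measurable
  also have "\<dots> = liminf I"
    using LIMSEQ_subseq_LIMSEQ[OF s(2) w(1)] by (intro lim_imp_Liminf) (auto simp: o_def)
  finally show ?thesis unfolding I_def norm_schr_kernel[OF t] .
qed

section \<open>Infinite systems\<close>

lemma summable_partial_sums_tendsto:
  fixes f :: "nat \<Rightarrow> complex"
  assumes "f summable_on J"
  shows "(\<lambda>m. \<Sum>j\<in>J \<inter> {..<m}. f j) \<longlonglongrightarrow> (\<Sum>\<^sub>\<infinity>j\<in>J. f j)"
proof -
  have "(sum f \<longlongrightarrow> (\<Sum>\<^sub>\<infinity>j\<in>J. f j)) (finite_subsets_at_top J)"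
    using has_sum_infsum[OF assms] by (simp add: has_sum_def)
  moreover have "filterlim (\<lambda>m. J \<inter> {..<m}) (finite_subsets_at_top J) sequentially"
    unfolding filterlim_finite_subsets_at_top
  proof (intro allI impI)
    fix X assume X: "finite X \<and> X \<subseteq> J"
    then obtain m where m: "X \<subseteq> {..<m}" using finite_nat_bounded by blast
    show "\<forall>\<^sub>F y in sequentially. finite (J \<inter> {..<y}) \<and> X \<subseteq> J \<inter> {..<y} \<and> J \<inter> {..<y} \<subseteq> J"
      using eventually_ge_at_top[of m] by eventually_elim (use X m in force)
  qed
  ultimately show ?thesis by (rule filterlim_compose)
qed

text \<open>A single index \<open>R\<close> governs both the number of terms and the radius of
  truncation. With the coefficients replaced by their moduli all terms are nonnegative, so for fixed
  \<open>m\<close> the sum over indices below \<open>m\<close> is dominated by the one below any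
  \<open>R \<ge> m\<close>.\<close>

lemma density_liminf:
  fixes u :: "nat \<Rightarrow> 'a::euclidean_space \<Rightarrow> complex"
  assumes t: "t \<noteq> 0" and u: "\<And>j. j \<in> J \<Longrightarrow> L2 (u j)" and q: "q > 0"
  shows "(\<integral>\<^sup>+ x. ennreal ((norm (density J n u t x)) powr q) \<partial>lborel) \<le>
    liminf (\<lambda>R. \<integral>\<^sup>+ x. ennreal ((\<Sum>j\<in>J \<inter> {..<R}. norm (n j) * (norm (schr_ext (trunc (u j) R) t x))\<^sup>2) powr q) \<partial>lborel)"
    (is "_ \<le> liminf ?G")
proof -
  let ?\<rho> = "\<lambda>m x. \<Sum>j\<in>J \<inter> {..<m}. norm (n j) * (norm (schr t (u j) x))\<^sup>2"
  have [measurable]: "schr t (u j) \<in> borel_measurable borel" if "j \<in> J" for j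
    using schr_spec(1)[OF t u[OF that]] by (rule L2_measurable)
  have pos: "0 \<le> (\<Sum>j\<in>A. norm (n j) * c j)" if "\<And>j. c j \<ge> 0" for A and c :: "nat \<Rightarrow> real"
    using that by (intro sum_nonneg mult_nonneg_nonneg) auto
  have "(\<integral>\<^sup>+ x. ennreal ((norm (density J n u t x)) powr q) \<partial>lborel) \<le> (\<integral>\<^sup>+ x. liminf (\<lambda>m. ennreal (?\<rho> m x powr q)) \<partial>lborel)"
  proof (rule nn_integral_mono)
    fix x
    let ?f = "\<lambda>j. n j * complex_of_real ((norm (schr t (u j) x))\<^sup>2)"
    show "ennreal ((norm (density J n u t x)) powr q) \<le> liminf (\<lambda>m. ennreal (?\<rho> m x powr q))"
    proof (cases "?f summable_on J")
      case False \<comment> \<open>then the density is \<open>0\<close> by the convention for \<open>infsum\<close>\<close>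
      then show ?thesis using q by (simp add: density_def infsum_not_exists)
    next
      case True
      have "(\<lambda>m. norm (\<Sum>j\<in>J \<inter> {..<m}. ?f j) powr q) \<longlonglongrightarrow> norm (density J n u t x) powr q"
        unfolding density_def using q by (intro tendsto_powr' tendsto_norm summable_partial_sums_tendsto[OF True] tendsto_const) auto
      then have "ennreal (norm (density J n u t x) powr q) = liminf (\<lambda>m. ennreal (norm (\<Sum>j\<in>J \<inter> {..<m}. ?f j) powr q))"
        by (intro lim_imp_Liminf[symmetric] tendsto_ennrealI) auto
      also have "\<dots> \<le> liminf (\<lambda>m. ennreal (?\<rho> m x powr q))"
      proof (intro Liminf_mono always_eventually allI ennreal_leI powr_mono2)
        fix m
        have "norm (\<Sum>j\<in>J \<inter> {..<m}. ?f j) \<le> (\<Sum>j\<in>J \<inter> {..<m}. norm (?f j))" by (rule norm_sum)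
        then show "norm (\<Sum>j\<in>J \<inter> {..<m}. ?f j) \<le> ?\<rho> m x" by (simp add: norm_mult norm_power)
      qed (use q in auto)
      finally show ?thesis .
    qed
  qed
  also have "\<dots> \<le> liminf (\<lambda>m. \<integral>\<^sup>+ x. ennreal (?\<rho> m x powr q) \<partial>lborel)"
    by (rule nn_integral_liminf) measurable
  also have "\<dots> \<le> liminf (\<lambda>m. liminf ?G)"
  proof (intro Liminf_mono always_eventually allI)
    fix m
    have "(\<integral>\<^sup>+ x. ennreal (?\<rho> m x powr q) \<partial>lborel) \<le>
      liminf (\<lambda>R. \<integral>\<^sup>+ x. ennreal ((\<Sum>j\<in>J \<inter> {..<m}. norm (n j) * (norm (schr_ext (trunc (u j) R) t x))\<^sup>2) powr q) \<partial>lborel)"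
      by (rule schr_finite_liminf[OF t _ _ _ q]) (use u in auto)
    also have "\<dots> \<le> liminf ?G"
    proof (rule Liminf_mono)
      show "\<forall>\<^sub>F R in sequentially. (\<integral>\<^sup>+ x. ennreal ((\<Sum>j\<in>J \<inter> {..<m}. norm (n j) * (norm (schr_ext (trunc (u j) R) t x))\<^sup>2) powr q) \<partial>lborel) \<le> ?G R"
        using eventually_ge_at_top[of m]
      proof eventually_elim
        case (elim R)
        then show ?case using q
          by (intro nn_integral_mono ennreal_leI powr_mono2 sum_mono2 pos) auto
      qed
    qed
    finally show "(\<integral>\<^sup>+ x. ennreal (?\<rho> m x powr q) \<partial>lborel) \<le> liminf ?G" .
  qed
  finally show ?thesis by (simp add: Liminf_const)
qed

theorem mainTheorem1:
  fixes p q :: real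
  assumes "p \<ge> 1" and "q > 1"
    and "q \<le> 1 + 2 / real DIM('a::euclidean_space)"
    and "2 / p + real DIM('a) / q = real DIM('a)"
  shows "\<exists>C>0. \<forall>(J::nat set) (u::nat \<Rightarrow> 'a \<Rightarrow> complex) (n::nat \<Rightarrow> complex).
     orthonormal_system J u \<longrightarrow>
     (\<integral>\<^sup>+ t. enn_powr (\<integral>\<^sup>+ x. ennreal ((norm (density J n u t x)) powr q) \<partial>lborel) (p / q) \<partial>lborel)
       \<le> ennreal (C powr p) *
         enn_powr (\<integral>\<^sup>+ j. ennreal ((norm (n j)) powr (2 * q / (q + 1))) \<partial>count_space J)
                  (p * (q + 1) / (2 * q))"
proof (intro exI[of _ "end_const DIM('a) powr (1 / p)"] conjI allI impI)
  show "end_const DIM('a) powr (1 / p) > 0" using end_const_pos[of "DIM('a)"] by simp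
  have C: "(end_const DIM('a) powr (1 / p)) powr p = end_const DIM('a)"
    using assms(1) end_const_pos[of "DIM('a)"] by (simp add: powr_powr)
  fix J :: "nat set" and u :: "nat \<Rightarrow> 'a \<Rightarrow> complex" and n :: "nat \<Rightarrow> complex"
  assume on: "orthonormal_system J u"
  have uL: "L2 (u j)" if "j \<in> J" for j using on that by (simp add: orthonormal_system_def)
  let ?\<alpha> = "2 * q / (q + 1)" and ?r = "p * (q + 1) / (2 * q)"
  have r: "?r > 0" "p / q > 0" using assms by auto
  let ?N = "\<integral>\<^sup>+ j. ennreal ((norm (n j)) powr ?\<alpha>) \<partial>count_space J"
  \<comment> \<open>\<open>0\<close> off \<open>J\<close>, where \<open>u j\<close> need not be measurable\<close>
  define w where "w R j = (if j \<in> J then trunc (u j) R else (\<lambda>_. 0))" for R j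
  have wm[measurable]: "w R j \<in> borel_measurable borel" for R j
    using L2_measurable[OF L2_trunc[OF uL]] by (simp add: w_def)
  define G where "G R t = (\<integral>\<^sup>+ x. ennreal ((\<Sum>j\<in>J \<inter> {..<R}. norm (n j) * (norm (schr_ext (w R j) t x))\<^sup>2) powr q) \<partial>lborel)" for R t
  have Gm[measurable]: "G R \<in> borel_measurable borel" for R unfolding G_def[abs_def] by measurable
  have Gp[measurable]: "(\<lambda>t. enn_powr (G R t) (p / q)) \<in> borel_measurable borel" for R
    by (rule borel_measurable_enn_powr[OF r(2) Gm])
  have G_eq: "G R t = (\<integral>\<^sup>+ x. ennreal ((\<Sum>j\<in>J \<inter> {..<R}. norm (n j) * (norm (schr_ext (trunc (u j) R) t x))\<^sup>2) powr q) \<partial>lborel)" for R t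
    unfolding G_def by (intro nn_integral_cong arg_cong[where f=ennreal] arg_cong2[where f="(powr)"] sum.cong refl) (simp add: w_def)
  have bound: "(\<integral>\<^sup>+ t. enn_powr (G R t) (p / q) \<partial>lborel) \<le> ennreal (end_const DIM('a)) * enn_powr ?N ?r" for R
  proof -
    let ?J = "J \<inter> {..<R}"
    have "bessel_system ?J (\<lambda>j. trunc (u j) R)"
      unfolding trunc_def by (rule bessel_system_indicator[OF orthonormal_imp_bessel[OF on]]) auto
    then have b: "bessel_system ?J (w R)" unfolding bessel_system_def w_def by simp
    have "(\<integral>\<^sup>+ t. enn_powr (G R t) (p / q) \<partial>lborel) \<le> ennreal (end_const DIM('a) * (\<Sum>j\<in>?J. norm (n j) powr ?\<alpha>) powr ?r)"
      unfolding G_def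
      by (rule strichartz_truncated[OF _ b wm, where v="real R *\<^sub>R One"]) (use assms in \<open>auto simp: w_def trunc_out\<close>)
    also have "\<dots> = ennreal (end_const DIM('a)) * enn_powr (ennreal (\<Sum>j\<in>?J. norm (n j) powr ?\<alpha>)) ?r"
      using end_const_pos[of "DIM('a)"] by (simp add: enn_powr_ennreal sum_nonneg ennreal_mult)
    also have "\<dots> \<le> ennreal (end_const DIM('a)) * enn_powr ?N ?r"
    proof (intro mult_left_mono enn_powr_mono)
      have "ennreal (\<Sum>j\<in>?J. norm (n j) powr ?\<alpha>) = (\<integral>\<^sup>+ j. ennreal ((norm (n j)) powr ?\<alpha>) \<partial>count_space ?J)"
        by (subst nn_integral_count_space_finite) (auto simp: sum_ennreal)
      also have "\<dots> \<le> ?N"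
        by (subst (1 2) nn_integral_count_space_indicator) (auto intro!: nn_integral_mono simp: indicator_def)
      finally show "ennreal (\<Sum>j\<in>?J. norm (n j) powr ?\<alpha>) \<le> ?N" .
    qed (use r in auto)
    finally show ?thesis .
  qed
  \<comment> \<open>\<open>schr t\<close> is chosen separately for each \<open>t\<close>, so the left-hand side need not be measurable in \<open>t\<close>;
    only the monotonicity of the integral is used for it, and Fatou's lemma for the measurable \<open>G\<close>.\<close>
  have "(\<integral>\<^sup>+ t. enn_powr (\<integral>\<^sup>+ x. ennreal ((norm (density J n u t x)) powr q) \<partial>lborel) (p / q) \<partial>lborel)
      \<le> (\<integral>\<^sup>+ t. liminf (\<lambda>R. enn_powr (G R t) (p / q)) \<partial>lborel)"
  proof (rule nn_integral_mono_AE, rule AE_mp[OF AE_lborel_singleton[of 0]], intro AE_I2 impI)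
    fix t :: real assume t: "t \<noteq> 0"
    have "(\<integral>\<^sup>+ x. ennreal ((norm (density J n u t x)) powr q) \<partial>lborel) \<le> liminf (\<lambda>R. G R t)"
      unfolding G_eq by (rule density_liminf[OF t uL]) (use assms in auto)
    then have "enn_powr (\<integral>\<^sup>+ x. ennreal ((norm (density J n u t x)) powr q) \<partial>lborel) (p / q) \<le> enn_powr (liminf (\<lambda>R. G R t)) (p / q)"
      using r by (intro enn_powr_mono) auto
    \<comment> \<open>A continuous monotone function commutes with the lower limit.\<close>
    also have "\<dots> = liminf (\<lambda>R. enn_powr (G R t) (p / q))"
      using r by (intro Liminf_compose_continuous_mono[symmetric] continuous_enn_powr) (auto intro!: monoI enn_powr_mono)
    finally show "enn_powr (\<integral>\<^sup>+ x. ennreal ((norm (density J n u t x)) powr q) \<partial>lborel) (p / q) \<le> liminf (\<lambda>R. enn_powr (G R t) (p / q))" .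
  qed
  also have "\<dots> \<le> liminf (\<lambda>R. \<integral>\<^sup>+ t. enn_powr (G R t) (p / q) \<partial>lborel)"
    by (rule nn_integral_liminf) measurable
  also have "\<dots> \<le> liminf (\<lambda>R::nat. ennreal (end_const DIM('a)) * enn_powr ?N ?r)"
    by (intro Liminf_mono always_eventually allI bound)
  finally show "(\<integral>\<^sup>+ t. enn_powr (\<integral>\<^sup>+ x. ennreal ((norm (density J n u t x)) powr q) \<partial>lborel) (p / q) \<partial>lborel)
       \<le> ennreal ((end_const DIM('a) powr (1 / p)) powr p) * enn_powr ?N ?r"
    unfolding C by (simp add: Liminf_const)
qed

end
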